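(* Let $k,n$ be positive integers with $k+2\le n$ and let $Z\in\mathrm{Mat}^{>0}_{n,k+2}$ with rows $Z_1,\dots,Z_n$. Let $$\mathcal F^\circ_{n,k,2}(Z):=\{Y\in\mathrm{Gr}_{k,k+2}\ :\ \langle YZ_iZ_{i+1}\rangle>0\text{ for }1\le i\le n-1,\ \langle YZ_n\hat Z_1\rangle>0,\ \text{and } \mathrm{var}(\langle YZ_1Z_2\rangle,\langle YZ_1Z_3\rangle,\dots,\langle YZ_1Z_n\rangle)=k\}.$$ Then $\mathcal A_{n,k,2}(Z)=\overline{\mathcal F^\circ_{n,k,2}(Z)}$.
   Context: $\mathrm{Gr}_{k,n}$ is the Grassmannian of $k$-dimensional subspaces of $\mathbb R^n$, represented by full-rank $k\times n$ matrices; $\mathrm{Gr}^{\ge0}_{k,n}$ is the set of points having a representative with all maximal minors $\ge0$. $\mathrm{Mat}^{>0}_{n,k+2}$ is the set of real $n\times(k+2)$ matrices with all maximal minors positive. Such a $Z$ induces a well-defined map $\tilde Z:\mathrm{Gr}^{\ge0}_{k,n}\to\mathrm{Gr}_{k,k+2}$, $C\mapsto CZ$, and the amplituhedron is $\mathcal A_{n,k,2}(Z):=\tilde Z(\mathrm{Gr}_{k,n}^{\ge0})$. $\hat Z_i:=(-1)^{k+1}Z_i$. For $Y\in\mathrm{Gr}_{k,k+2}$ represented by a matrix with rows $y_1,\dots,y_k$ and vectors $u,v\in\mathbb R^{k+2}$, $\langle Yuv\rangle$ is the determinant of the matrix with rows $y_1,\dots,y_k,u,v$. These are defined up to a common nonzero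 scalar; the list of sign conditions on $Y$ is understood to hold if it holds for some matrix representative of $Y$ (the same one for all conditions). For $v\in\mathbb R^N$, $\mathrm{var}(v)$ is the number of times $v$ changes sign when its components are read from left to right, ignoring zeros. Closure is in the Hausdorff (Euclidean) topology on $\mathrm{Gr}_{k,k+2}$. *)

theory Defs
  imports
    "HOL-Analysis.Analysis"
    "Jordan_Normal_Form.DL_Rank"
    "Jordan_Normal_Form.DL_Submatrix"
begin

text \<open>
  Vectors and matrices are those of \<open>Jordan_Normal_Form.Matrix\<close>, so all indices start at \<open>0\<close>:
  the mathematical row \<open>Z\<^sub>i\<close> is \<open>row Z (i - 1)\<close>.
\<close>

abbreviation rowspan :: "nat \<Rightarrow> real mat \<Rightarrow> real vec set" where
  "rowspan \<equiv> vec_space.row_space"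

text \<open>The \<open>d\<close>-dimensional linear subspaces of \<open>\<real>\<^sup>m\<close>.\<close>

definition Gr :: "nat \<Rightarrow> nat \<Rightarrow> real vec set set" where
  "Gr d m = {V. VectorSpace.subspace class_ring V (module_vec TYPE(real) m) \<and>
                vectorspace.dim class_ring ((module_vec TYPE(real) m)\<lparr>carrier := V\<rparr>) = d}"

text \<open>
  The library's \<open>rank\<close> is the dimension of the column space; rank \<open>d\<close> is imposed here on the rows.
\<close>

definition full_rank_mats :: "nat \<Rightarrow> nat \<Rightarrow> real mat set" where
  "full_rank_mats d m = {A \<in> carrier_mat d m. vec_space.rank m (transpose_mat A) = d}"

definition represents :: "nat \<Rightarrow> nat \<Rightarrow> real mat \<Rightarrow> real vec set \<Rightarrow> bool" where
  "represents d m A V \<longleftrightarrow> A \<in> full_rank_mats d m \<and> rowspan m A = V"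

text \<open>
  Matrices have no topology in the library; this is the Euclidean one on the entries.
\<close>

definition mat_topology :: "nat \<Rightarrow> nat \<Rightarrow> real mat topology" where
  "mat_topology r c =
     pullback_topology (carrier_mat r c) (\<lambda>A. \<lambda>ij \<in> {..<r} \<times> {..<c}. A $$ ij)
       (product_topology (\<lambda>_. euclideanreal) ({..<r} \<times> {..<c}))"

text \<open>
  The Euclidean (Hausdorff) topology on the Grassmannian is the quotient topology of the
  full-rank matrices under row span; see \<open>quotient_map_rowspan\<close> below.
\<close>

definition Gr_topology :: "nat \<Rightarrow> nat \<Rightarrow> real vec set topology" where
  "Gr_topology d m = topology (\<lambda>U. U \<subseteq> Gr d m \<and>
     openin (subtopology (mat_topology d m) (full_rank_mats d m))
       {A \<in> full_rank_mats d m. rowspan m A \<in> U})"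

definition Gr_nonneg :: "nat \<Rightarrow> nat \<Rightarrow> real vec set set" where
  "Gr_nonneg d m = {V \<in> Gr d m. \<exists>C. represents d m C V \<and>
     (\<forall>J \<subseteq> {..<m}. card J = d \<longrightarrow> Determinant.det (submatrix C UNIV J) \<ge> 0)}"

text \<open>Maximal minors of an \<open>n \<times> p\<close> matrix with \<open>p \<le> n\<close> are indexed by sets of \<open>p\<close> rows.\<close>

definition Mat_pos :: "nat \<Rightarrow> nat \<Rightarrow> real mat set" where
  "Mat_pos n p = {Z \<in> carrier_mat n p.
     \<forall>I \<subseteq> {..<n}. card I = p \<longrightarrow> Determinant.det (submatrix Z I UNIV) > 0}"

text \<open>
  The map \<open>C \<mapsto> C Z\<close> on row spans: a row vector \<open>v\<close> is sent to \<open>v Z\<close>, which is \<open>Z\<^sup>T v\<close> in the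
  column convention of \<open>*\<^sub>v\<close>; see \<open>Ztilde_rowspan\<close> below.
\<close>

definition Ztilde :: "real mat \<Rightarrow> real vec set \<Rightarrow> real vec set" where
  "Ztilde Z V = (\<lambda>v. transpose_mat Z *\<^sub>v v) ` V"

definition amplituhedron :: "nat \<Rightarrow> nat \<Rightarrow> real mat \<Rightarrow> real vec set set" where
  "amplituhedron n k Z = Ztilde Z ` Gr_nonneg k n"

text \<open>\<open>\<langle>Y u v\<rangle>\<close>, the determinant with the rows of \<open>Y\<close> followed by \<open>u\<close> and \<open>v\<close>.\<close>

definition bracket :: "real mat \<Rightarrow> real vec \<Rightarrow> real vec \<Rightarrow> real" where
  "bracket Y u v = Determinant.det (mat_of_rows (dim_col Y) (Matrix.rows Y @ [u, v]))"

definition var :: "real list \<Rightarrow> nat" where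
  "var xs = (let ys = filter (\<lambda>x. x \<noteq> 0) xs
             in card {i. Suc i < length ys \<and> ys ! i * ys ! Suc i < 0})"

definition F_open :: "nat \<Rightarrow> nat \<Rightarrow> real mat \<Rightarrow> real vec set set" where
  "F_open n k Z = {V \<in> Gr k (k + 2). \<exists>Y. represents k (k + 2) Y V \<and>
     (\<forall>i. i + 1 < n \<longrightarrow> bracket Y (Matrix.row Z i) (Matrix.row Z (i + 1)) > 0) \<and>
     bracket Y (Matrix.row Z (n - 1)) ((-1) ^ (k + 1) \<cdot>\<^sub>v Matrix.row Z 0) > 0 \<and>
     var (map (\<lambda>j. bracket Y (Matrix.row Z 0) (Matrix.row Z j)) [1..<n]) = k}"

lemma Ztilde_rowspan:
  assumes C: "C \<in> carrier_mat d n" and Z: "Z \<in> carrier_mat n p"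
  shows "Ztilde Z (rowspan n C) = rowspan p (C * Z)"
proof -
  have CZ: "C * Z \<in> carrier_mat d p" using C Z by simp
  have *: "transpose_mat (C * Z) *\<^sub>v y = transpose_mat Z *\<^sub>v (transpose_mat C *\<^sub>v y)"
    if "y \<in> carrier_vec d" for y
    using that C Z by (simp add: transpose_mult[OF C Z] assoc_mult_mat_vec[of _ p n _ d])
  have "rowspan p (C * Z) = (\<lambda>y. transpose_mat (C * Z) *\<^sub>v y) ` carrier_vec d"
    unfolding vec_space.row_space_eq[OF CZ] using CZ C Z
    by (auto intro!: mult_mat_vec_carrier[of _ p d])
  also have "\<dots> = (\<lambda>v. transpose_mat Z *\<^sub>v v) ` (\<lambda>y. transpose_mat C *\<^sub>v y) ` carrier_vec d"
    unfolding image_image using * by (intro image_cong) simp_all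
  also have "(\<lambda>y. transpose_mat C *\<^sub>v y) ` carrier_vec d = rowspan n C"
    unfolding vec_space.row_space_eq[OF C] using C
    by (auto intro!: mult_mat_vec_carrier[of _ n d])
  finally show ?thesis unfolding Ztilde_def ..
qed

lemma openin_Gr_topology:
  "openin (Gr_topology d m) U \<longleftrightarrow> U \<subseteq> Gr d m \<and>
     openin (subtopology (mat_topology d m) (full_rank_mats d m))
       {A \<in> full_rank_mats d m. rowspan m A \<in> U}"
proof -
  let ?T = "subtopology (mat_topology d m) (full_rank_mats d m)"
  let ?p = "\<lambda>U. {A \<in> full_rank_mats d m. rowspan m A \<in> U}"
  have I: "?p (S \<inter> T) = ?p S \<inter> ?p T" for S T by auto
  have U: "?p (\<Union>K) = (\<Union>S\<in>K. ?p S)" for K by auto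
  have "istopology (\<lambda>U. U \<subseteq> Gr d m \<and> openin ?T (?p U))"
    unfolding istopology_def I U by (auto intro: openin_Int openin_Union)
  then show ?thesis unfolding Gr_topology_def by (simp add: topology_inverse')
qed

lemma (in vec_space) subspace_finite_generating_set:
  assumes "VectorSpace.subspace class_ring W V"
  shows "\<exists>B. finite B \<and> B \<subseteq> W \<and> span B = W \<and> card B = vectorspace.dim class_ring (vs W)"
proof -
  interpret W: vectorspace class_ring "vs W" by (rule subspace_is_vs[OF assms])
  have sub: "submodule class_ring W V" using assms unfolding VectorSpace.subspace_def by simp
  have WV: "W \<subseteq> carrier_vec n" using submodule.subset[OF sub] by simp
  have card_le: "finite T \<and> card T \<le> n" if "T \<subseteq> W" "W.lin_indpt T" for T
    using li_le_dim[OF fin_dim, of T] span_li_not_depend(2)[OF that(1) sub] that WV dim_is_n by auto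
  have "\<exists>B. finite B \<and> maximal B (\<lambda>S. S \<subseteq> carrier (vs W) \<and> W.lin_indpt S)"
  proof (rule maximal_exists)
    show "finite T \<and> card T \<le> n" if "T \<subseteq> carrier (vs W) \<and> W.lin_indpt T" for T
      using card_le that by simp
    show "{} \<subseteq> carrier (vs W) \<and> W.lin_indpt {}"
      using span_li_not_depend(2)[OF _ sub, of "{}"] by (simp add: finite_lin_indpt2)
  qed
  then obtain B where B: "finite B" "maximal B (\<lambda>S. S \<subseteq> carrier (vs W) \<and> W.lin_indpt S)" by blast
  have basis: "W.basis B" by (rule W.max_li_is_basis[OF B(2)])
  then have "B \<subseteq> W" "W.span B = W" unfolding W.basis_def by auto
  moreover have "W.dim = card B" by (rule W.dim_basis[OF B(1) basis])
  ultimately show ?thesis using B(1) span_li_not_depend(1)[OF _ sub, of B] by auto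
qed

lemma rowspan_full_rank_mats: "rowspan m ` full_rank_mats d m = Gr d m"
proof -
  interpret vec_space "TYPE(real)" m .
  show ?thesis
  proof (intro equalityI subsetI)
    fix W assume "W \<in> rowspan m ` full_rank_mats d m"
    then obtain A where A: "A \<in> carrier_mat d m" "rank (transpose_mat A) = d" "W = row_space A"
      unfolding full_rank_mats_def by auto
    have "set (Matrix.rows A) \<subseteq> carrier_vec m" using A(1) rows_carrier[of A] by auto
    then have "VectorSpace.subspace class_ring W V"
      using span_is_subspace A(3) unfolding row_space_def by simp
    then show "W \<in> Gr d m" using A unfolding Gr_def rank_def row_space_def by simp
  next
    fix W assume "W \<in> Gr d m"
    then have W: "VectorSpace.subspace class_ring W V" "vectorspace.dim class_ring (vs W) = d"
      unfolding Gr_def by auto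
    obtain B where B: "finite B" "B \<subseteq> W" "span B = W" "card B = d"
      using subspace_finite_generating_set[OF W(1)] W(2) by auto
    obtain bs where bs: "set bs = B" "distinct bs" using finite_distinct_list[OF B(1)] by auto
    have len: "length bs = d" using bs B(4) distinct_card by fastforce
    have "W \<subseteq> carrier_vec m" using W(1) submodule.subset unfolding VectorSpace.subspace_def by fastforce
    then have rows: "Matrix.rows (mat_of_rows m bs) = bs" using bs(1) B(2) by (intro rows_mat_of_rows) auto
    have "row_space (mat_of_rows m bs) = W" unfolding row_space_def rows bs(1) B(3) ..
    moreover have "rank (transpose_mat (mat_of_rows m bs)) = d"
      unfolding rank_def cols_transpose rows bs(1) B(3) W(2) ..
    ultimately show "W \<in> rowspan m ` full_rank_mats d m"
      unfolding full_rank_mats_def using len by (intro image_eqI[of _ _ "mat_of_rows m bs"]) auto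
  qed
qed

lemma topspace_Gr_topology: "topspace (Gr_topology d m) = Gr d m"
  and quotient_map_rowspan:
    "quotient_map (subtopology (mat_topology d m) (full_rank_mats d m)) (Gr_topology d m) (rowspan m)"
proof -
  have "full_rank_mats d m \<subseteq> topspace (mat_topology d m)"
    unfolding mat_topology_def topspace_pullback_topology full_rank_mats_def by auto
  then have top: "topspace (subtopology (mat_topology d m) (full_rank_mats d m)) = full_rank_mats d m"
    by auto
  have "{A \<in> full_rank_mats d m. rowspan m A \<in> Gr d m} = full_rank_mats d m"
    using rowspan_full_rank_mats by blast
  then have "openin (Gr_topology d m) (Gr d m)"
    using openin_topspace[of "subtopology (mat_topology d m) (full_rank_mats d m)"]
    unfolding openin_Gr_topology top by simp
  then show ts: "topspace (Gr_topology d m) = Gr d m"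
    using openin_subset openin_topspace openin_Gr_topology by (metis subset_antisym)
  show "quotient_map (subtopology (mat_topology d m) (full_rank_mats d m)) (Gr_topology d m) (rowspan m)"
    unfolding quotient_map_def top ts openin_Gr_topology using rowspan_full_rank_mats by auto
qed

end

theory Submission
  imports Defs "HOL-Library.Sublist"
begin

text \<open>
  Call a \<open>d \<times> n\<close> matrix totally positive if its maximal minors are positive, and totally
  nonnegative if they are nonnegative. The proof rests on two dual variation estimates for a totally
  positive \<open>M\<close> with \<open>d \<le> n\<close>. A nonzero combination of the rows of \<open>M\<close> cannot alternate in sign, zeros
  counting as either sign, at \<open>d + 1\<close> positions (\<open>row_combination_not_weakly_alternating\<close>). A nonzero
  vector annihilated by \<open>M\<close> does alternate strictly at some \<open>d + 1\<close> positions
  (\<open>kernel_vector_alternates\<close>).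

  Let \<open>C\<close> be totally positive, \<open>Y = C Z\<close> and \<open>u\<close> a vector. The sequence \<open>j \<mapsto> \<langle>Y u Z\<^sub>j\<rangle>\<close> is a combination
  of the \<open>k + 2\<close> columns of \<open>Z\<close> and is annihilated by \<open>C\<close>. So, unless it vanishes, it alternates strictly
  at \<open>k + 1\<close> positions but not even weakly at \<open>k + 3\<close>. For \<open>u = Z\<^sub>a\<close> it is zero at \<open>a\<close>, and there is so little
  room left that the signs at \<open>a - 1\<close> and \<open>a + 1\<close> are forced to be opposite (\<open>neighbours_of_zero\<close>). Hence
  all \<open>\<langle>Y Z\<^sub>a Z\<^sub>a\<^sub>+\<^sub>1\<rangle>\<close> have the same sign; the sequence for \<open>u = Z\<^sub>1\<close> gives the cyclic bracket and the number of
  sign changes. Thus totally positive \<open>C\<close> map into the sign-flip set. Every point of the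
  nonnegative Grassmannian is a limit of totally positive ones (\<open>TNN_approx_TP\<close>), so the
  amplituhedron lies in the closure.

  Conversely, if \<open>Y\<close> satisfies the sign conditions, let \<open>i\<^sub>1 < \<dots> < i\<^sub>k\<close> be the places where
  \<open>\<langle>Y Z\<^sub>1 Z\<^sub>j\<rangle>\<close> flips sign. Modulo \<open>Y\<close> the ambient space is a plane, so Cramer's rule puts
  \<open>\<langle>Y Z\<^sub>i Z\<^sub>i\<^sub>+\<^sub>1\<rangle> Z\<^sub>1 - \<langle>Y Z\<^sub>1 Z\<^sub>i\<^sub>+\<^sub>1\<rangle> Z\<^sub>i + \<langle>Y Z\<^sub>1 Z\<^sub>i\<rangle> Z\<^sub>i\<^sub>+\<^sub>1\<close> into \<open>Y\<close>. For \<open>i = i\<^sub>1, \<dots>, i\<^sub>k\<close> and up to alternating signs, the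
  coefficients of these vectors form a totally nonnegative matrix \<open>C\<close> of rank \<open>k\<close> with
  \<open>C Z\<close> spanning \<open>Y\<close> (\<open>sign_flip_matrix\<close>).

  Finally the amplituhedron is closed. A vector \<open>v\<close> in a totally nonnegative \<open>k\<close>-dimensional subspace
  never alternates strictly at \<open>k + 1\<close> positions. A nonzero vector annihilated by \<open>Z\<close> would have to, so
  by compactness \<open>v\<close> is bounded in terms of \<open>v Z\<close> (\<open>nonalternating_bounded\<close>). If \<open>C Z\<close> converges, \<open>C\<close>
  therefore stays bounded, and a limit point of \<open>C\<close> represents the limit of \<open>C Z\<close>.
\<close>

section \<open>Determinants of two-index functions\<close>

text \<open>
  Matrices are handled as functions of two indices, so that selecting rows or columns, with or without
  repetition, is composition with an index map.
\<close>

definition detf :: "nat \<Rightarrow> (nat \<Rightarrow> nat \<Rightarrow> real) \<Rightarrow> real" where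
  "detf d A = Determinant.det (Matrix.mat d d (\<lambda>(i, j). A i j))"

lemma detf_cong:
  assumes "\<And>i j. i < d \<Longrightarrow> j < d \<Longrightarrow> A i j = B i j"
  shows "detf d A = detf d B"
  unfolding detf_def by (rule arg_cong[of _ _ Determinant.det], rule eq_matI) (auto simp: assms)

lemma detf_permutes:
  "detf d A = (\<Sum>p | p permutes {0..<d}. signof p * (\<Prod>i = 0..<d. A i (p i)))"
  unfolding detf_def
  by (subst det_def'[of _ d]) (auto intro!: sum.cong prod.cong simp: permutes_in_image)

lemma detf_transpose: "detf d (\<lambda>i j. A j i) = detf d A"
proof -
  have "Matrix.mat d d (\<lambda>(i, j). A j i) = transpose_mat (Matrix.mat d d (\<lambda>(i, j). A i j))"
    by (rule eq_matI) auto
  then show ?thesis unfolding detf_def by (simp add: Determinant.det_transpose[of _ d])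
qed

lemma detf_linear_row:
  assumes c: "c < d"
    and A: "\<And>j. j < d \<Longrightarrow> A c j = a * B c j + b * D c j"
    and BD: "\<And>i j. i < d \<Longrightarrow> j < d \<Longrightarrow> i \<noteq> c \<Longrightarrow> B i j = A i j \<and> D i j = A i j"
  shows "detf d A = a * detf d B + b * detf d D"
proof -
  have *: "(\<Prod>i = 0..<d. A i (p i)) = a * (\<Prod>i = 0..<d. B i (p i)) + b * (\<Prod>i = 0..<d. D i (p i))"
    if p: "p permutes {0..<d}" for p
  proof -
    have pd: "p i < d" if "i < d" for i using permutes_in_image[OF p, of i] that by simp
    have r: "(\<Prod>i = 0..<d. f i) = f c * prod f ({0..<d} - {c})" for f :: "nat \<Rightarrow> real"
      using c by (subst prod.remove[of _ c]) auto
    have "prod (\<lambda>i. B i (p i)) ({0..<d} - {c}) = prod (\<lambda>i. A i (p i)) ({0..<d} - {c})"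
         "prod (\<lambda>i. D i (p i)) ({0..<d} - {c}) = prod (\<lambda>i. A i (p i)) ({0..<d} - {c})"
      using BD pd by (auto intro!: prod.cong)
    then show ?thesis unfolding r using A[OF pd[OF c]] by (simp add: algebra_simps)
  qed
  show ?thesis unfolding detf_permutes sum_distrib_left sum.distrib[symmetric]
    by (rule sum.cong) (auto simp: * algebra_simps)
qed

lemma detf_linear_col:
  assumes c: "c < d"
    and A: "\<And>i. i < d \<Longrightarrow> A i c = a * B i c + b * D i c"
    and BD: "\<And>i j. i < d \<Longrightarrow> j < d \<Longrightarrow> j \<noteq> c \<Longrightarrow> B i j = A i j \<and> D i j = A i j"
  shows "detf d A = a * detf d B + b * detf d D"
  using detf_linear_row[of c d "\<lambda>i j. A j i" a "\<lambda>i j. B j i" b "\<lambda>i j. D j i"] assms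
  unfolding detf_transpose[of d A] detf_transpose[of d B] detf_transpose[of d D] by simp

lemma detf_equal_rows:
  assumes "c < d" "c' < d" "c \<noteq> c'" "\<And>j. j < d \<Longrightarrow> A c j = A c' j"
  shows "detf d A = 0"
  unfolding detf_def
  by (rule det_identical_rows[of _ d c c']) (use assms in \<open>auto simp: Matrix.row_def\<close>)

lemma detf_equal_cols:
  assumes "c < d" "c' < d" "c \<noteq> c'" "\<And>i. i < d \<Longrightarrow> A i c = A i c'"
  shows "detf d A = 0"
  using detf_equal_rows[of c d c' "\<lambda>i j. A j i"] assms unfolding detf_transpose[of d A] by simp

lemma detf_eq_0_iff:
  "detf d A = 0 \<longleftrightarrow> (\<exists>x. (\<exists>i<d. x i \<noteq> 0) \<and> (\<forall>j<d. (\<Sum>i<d. x i * A i j) = 0))"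
proof -
  let ?M = "Matrix.mat d d (\<lambda>(i, j). A j i)"
  have mv: "(?M *\<^sub>v v = 0\<^sub>v d) \<longleftrightarrow> (\<forall>j<d. (\<Sum>i<d. vec_index v i * A i j) = 0)"
    if "v \<in> carrier_vec d" for v
    using that unfolding vec_eq_iff
    by (auto simp: scalar_prod_def lessThan_atLeast0 mult.commute)
  have "detf d A = 0 \<longleftrightarrow> (\<exists>v\<in>carrier_vec d. v \<noteq> 0\<^sub>v d \<and> ?M *\<^sub>v v = 0\<^sub>v d)"
    unfolding detf_transpose[symmetric, of d A] unfolding detf_def
    by (subst det_0_iff_vec_prod_zero_field[of _ d]) auto
  also have "\<dots> \<longleftrightarrow> (\<exists>x. (\<exists>i<d. x i \<noteq> 0) \<and> (\<forall>j<d. (\<Sum>i<d. x i * A i j) = 0))"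
  proof (intro iffI; elim bexE exE)
    fix v assume v: "v \<in> carrier_vec d" "v \<noteq> 0\<^sub>v d \<and> ?M *\<^sub>v v = 0\<^sub>v d"
    have "\<exists>i<d. vec_index v i \<noteq> 0" using v by (auto simp: vec_eq_iff)
    with v mv[OF v(1)] show "\<exists>x. (\<exists>i<d. x i \<noteq> 0) \<and> (\<forall>j<d. (\<Sum>i<d. x i * A i j) = 0)" by blast
  next
    fix x assume x: "(\<exists>i<d. x i \<noteq> 0) \<and> (\<forall>j<d. (\<Sum>i<d. x i * A i j) = 0)"
    have "Matrix.vec d x \<noteq> 0\<^sub>v d" using x by (auto simp: vec_eq_iff)
    moreover have "?M *\<^sub>v Matrix.vec d x = 0\<^sub>v d" using x by (subst mv) auto
    ultimately show "\<exists>v\<in>carrier_vec d. v \<noteq> 0\<^sub>v d \<and> ?M *\<^sub>v v = 0\<^sub>v d" by auto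
  qed
  finally show ?thesis .
qed

lemma detf_laplace_first_row:
  "detf (Suc d) A =
     (\<Sum>j\<le>d. (-1) ^ j * A 0 j * detf d (\<lambda>i l. A (Suc i) (if l < j then l else Suc l)))"
proof -
  let ?M = "Matrix.mat (Suc d) (Suc d) (\<lambda>(i, j). A i j)"
  have "detf (Suc d) A = (\<Sum>j<Suc d. ?M $$ (0, j) * cofactor ?M 0 j)"
    unfolding detf_def by (rule laplace_expansion_row) auto
  also have "\<dots> = (\<Sum>j\<le>d. (-1) ^ j * A 0 j * detf d (\<lambda>i l. A (Suc i) (if l < j then l else Suc l)))"
    unfolding lessThan_Suc_atMost
  proof (rule sum.cong)
    fix j assume j: "j \<in> {..d}"
    have "mat_delete ?M 0 j = Matrix.mat d d (\<lambda>(i, l). A (Suc i) (if l < j then l else Suc l))"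
      using j by (intro eq_matI) (auto simp: mat_delete_def)
    then show "?M $$ (0, j) * cofactor ?M 0 j =
        (-1) ^ j * A 0 j * detf d (\<lambda>i l. A (Suc i) (if l < j then l else Suc l))"
      using j by (simp add: cofactor_def detf_def)
  qed simp
  finally show ?thesis .
qed

text \<open>
  The cofactors of the last column do not depend on that column, so the determinant is a linear
  functional of it. The cofactor of the corner is the remaining principal minor.
\<close>

lemma detf_laplace_last_col:
  obtains c where "c d = detf d A"
    "\<And>v. detf (Suc d) (\<lambda>i j. if j = d then v i else A i j) = (\<Sum>i\<le>d. c i * v i)"
proof -
  let ?M = "\<lambda>v :: nat \<Rightarrow> real. Matrix.mat (Suc d) (Suc d) (\<lambda>(i, j). if j = d then v i else A i j)"
  have indep: "cofactor (?M v) i d = cofactor (?M (\<lambda>_. 0)) i d" if "i \<le> d" for v i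
  proof -
    have "mat_delete (?M v) i d = mat_delete (?M (\<lambda>_. 0)) i d"
      using that by (intro eq_matI) (auto simp: mat_delete_def)
    then show ?thesis by (simp add: cofactor_def)
  qed
  have "mat_delete (?M (\<lambda>_. 0)) d d = Matrix.mat d d (\<lambda>(i, j). A i j)"
    by (intro eq_matI) (auto simp: mat_delete_def)
  then have "cofactor (?M (\<lambda>_. 0)) d d = detf d A" by (simp add: cofactor_def detf_def)
  moreover have "detf (Suc d) (\<lambda>i j. if j = d then v i else A i j) =
      (\<Sum>i\<le>d. cofactor (?M (\<lambda>_. 0)) i d * v i)" for v
  proof -
    have "detf (Suc d) (\<lambda>i j. if j = d then v i else A i j) =
        (\<Sum>i<Suc d. ?M v $$ (i, d) * cofactor (?M v) i d)"
      unfolding detf_def by (rule laplace_expansion_column) auto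
    also have "\<dots> = (\<Sum>i\<le>d. cofactor (?M (\<lambda>_. 0)) i d * v i)"
      unfolding lessThan_Suc_atMost by (rule sum.cong) (simp_all add: indep[of _ v] mult.commute[of "v _"])
    finally show ?thesis .
  qed
  ultimately show ?thesis by (rule that)
qed

lemma tendsto_detf:
  assumes "\<And>i j. i < d \<Longrightarrow> j < d \<Longrightarrow> (\<lambda>m. A m i j) \<longlonglongrightarrow> B i j"
  shows "(\<lambda>m. detf d (A m)) \<longlonglongrightarrow> detf d B"
  unfolding detf_permutes
  by (intro tendsto_sum tendsto_mult tendsto_const tendsto_prod) (auto intro!: assms simp: permutes_in_image)

section \<open>Total positivity and alternating positions\<close>

text \<open>
  Index sets of maximal minors, given by their increasing enumerations. Being extensional, they form a
  finite set.
\<close>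

definition sorted_maps :: "nat \<Rightarrow> nat \<Rightarrow> (nat \<Rightarrow> nat) set" where
  "sorted_maps d n = {f \<in> {..<d} \<rightarrow>\<^sub>E {..<n}. strict_mono_on {..<d} f}"

definition TP :: "nat \<Rightarrow> nat \<Rightarrow> (nat \<Rightarrow> nat \<Rightarrow> real) \<Rightarrow> bool" where
  "TP d n M \<longleftrightarrow> (\<forall>f \<in> sorted_maps d n. detf d (\<lambda>i j. M i (f j)) > 0)"

definition TNN :: "nat \<Rightarrow> nat \<Rightarrow> (nat \<Rightarrow> nat \<Rightarrow> real) \<Rightarrow> bool" where
  "TNN d n M \<longleftrightarrow> (\<forall>f \<in> sorted_maps d n. detf d (\<lambda>i j. M i (f j)) \<ge> 0)"

lemma restrict_sorted_maps:
  assumes "strict_mono_on {..<d} f" "\<And>j. j < d \<Longrightarrow> f j < n"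
  shows "restrict f {..<d} \<in> sorted_maps d n"
  using assms by (auto simp: sorted_maps_def strict_mono_on_def)

lemma minor_restrict: "detf d (\<lambda>i j. M i (restrict f {..<d} j)) = detf d (\<lambda>i j. M i (f j))"
  by (rule detf_cong) auto

lemma TP_minor_pos:
  assumes "TP d n M" "strict_mono_on {..<d} f" "\<And>j. j < d \<Longrightarrow> f j < n"
  shows "detf d (\<lambda>i j. M i (f j)) > 0"
  using assms(1) restrict_sorted_maps[OF assms(2,3)] minor_restrict[of d M f]
  unfolding TP_def by force

lemma TNN_minor_nonneg:
  assumes "TNN d n M" "strict_mono_on {..<d} f" "\<And>j. j < d \<Longrightarrow> f j < n"
  shows "detf d (\<lambda>i j. M i (f j)) \<ge> 0"
  using assms(1) restrict_sorted_maps[OF assms(2,3)] minor_restrict[of d M f]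
  unfolding TNN_def by force

lemma finite_sorted_maps: "finite (sorted_maps d n)"
  unfolding sorted_maps_def by (rule finite_subset[OF _ finite_PiE[of "{..<d}" "\<lambda>_. {..<n}"]]) auto

text \<open>
  The list holds positions, and \<open>s\<close> is the sign required at the first of them. In the weak form a zero is
  compatible with either sign.
\<close>

fun weakly_alt :: "real \<Rightarrow> (nat \<Rightarrow> real) \<Rightarrow> nat list \<Rightarrow> bool" where
  "weakly_alt s w [] \<longleftrightarrow> True"
| "weakly_alt s w (p # ps) \<longleftrightarrow> s * w p \<ge> 0 \<and> weakly_alt (- s) w ps"

fun strictly_alt :: "real \<Rightarrow> (nat \<Rightarrow> real) \<Rightarrow> nat list \<Rightarrow> bool" where
  "strictly_alt s w [] \<longleftrightarrow> True"
| "strictly_alt s w (p # ps) \<longleftrightarrow> s * w p > 0 \<and> strictly_alt (- s) w ps"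

lemma weakly_alt_append: "weakly_alt s w (ps @ qs) \<longleftrightarrow> weakly_alt s w ps \<and> weakly_alt ((-1) ^ length ps * s) w qs"
  by (induction ps arbitrary: s) auto

lemma strictly_alt_append: "strictly_alt s w (ps @ qs) \<longleftrightarrow> strictly_alt s w ps \<and> strictly_alt ((-1) ^ length ps * s) w qs"
  by (induction ps arbitrary: s) auto

lemma strictly_alt_imp_weakly_alt: "strictly_alt s w ps \<Longrightarrow> weakly_alt s w ps"
  by (induction ps arbitrary: s) auto

lemma weakly_alt_nth: "weakly_alt s w ps \<longleftrightarrow> (\<forall>j<length ps. (-1) ^ j * s * w (ps ! j) \<ge> 0)"
proof (induction ps arbitrary: s)
  case (Cons p ps)
  show ?case unfolding weakly_alt.simps Cons.IH All_less_Suc2 length_Cons by simp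
qed simp

lemma strictly_alt_nth: "strictly_alt s w ps \<longleftrightarrow> (\<forall>j<length ps. (-1) ^ j * s * w (ps ! j) > 0)"
proof (induction ps arbitrary: s)
  case (Cons p ps)
  show ?case unfolding strictly_alt.simps Cons.IH All_less_Suc2 length_Cons by simp
qed simp

definition positions :: "nat \<Rightarrow> nat list \<Rightarrow> bool" where
  "positions n ps \<longleftrightarrow> sorted_wrt (<) ps \<and> set ps \<subseteq> {..<n}"

text \<open>
  Border \<open>M\<close>, restricted to the \<open>d + 1\<close> positions, by the row combination \<open>v\<close>. The determinant vanishes, yet its
  expansion along \<open>v\<close> is, under weak alternation, a sum of terms of one sign with positive minors as
  coefficients. So \<open>v\<close> vanishes at all the positions, and \<open>d\<close> of them already determine the coefficients \<open>x\<close>.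
\<close>

lemma row_combination_not_weakly_alternating:
  assumes TP: "TP d n M" and x: "\<exists>i<d. x i \<noteq> 0"
    and v: "\<And>j. j < n \<Longrightarrow> v j = (\<Sum>i<d. x i * M i j)"
    and ps: "positions n ps" "length ps = Suc d" and s: "s \<noteq> 0"
  shows "\<not> weakly_alt s v ps"
proof
  assume "weakly_alt s v ps"
  then have w: "(-1) ^ j * s * v (ps ! j) \<ge> 0" if "j \<le> d" for j
    using that ps(2) unfolding weakly_alt_nth by simp
  have psn: "ps ! j < n" if "j \<le> d" for j
  proof -
    have "ps ! j \<in> set ps" using ps(2) that by (intro nth_mem) simp
    then show ?thesis using ps(1) unfolding positions_def by auto
  qed
  have mono: "ps ! i < ps ! j" if "i < j" "j \<le> d" for i j
    using ps that unfolding positions_def by (auto simp: sorted_wrt_iff_nth_less)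
  let ?A = "\<lambda>i j. case i of 0 \<Rightarrow> v (ps ! j) | Suc i \<Rightarrow> M i (ps ! j)"
  let ?m = "\<lambda>j. detf d (\<lambda>i l. M i (ps ! (if l < j then l else Suc l)))"
  have mpos: "?m j > 0" if "j \<le> d" for j
    by (rule TP_minor_pos[OF TP]) (auto intro!: strict_mono_onI psn mono)
  have "detf (Suc d) ?A = 0"
    unfolding detf_eq_0_iff
  proof (intro exI conjI allI impI)
    let ?y = "\<lambda>i. case i of 0 \<Rightarrow> -1 | Suc i \<Rightarrow> x i"
    show "0 < Suc d" "?y 0 \<noteq> 0" by auto
    fix j assume "j < Suc d"
    then show "(\<Sum>i<Suc d. ?y i * ?A i j) = 0"
      using v[OF psn[of j]] unfolding sum.lessThan_Suc_shift by simp
  qed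
  moreover have "detf (Suc d) ?A = (\<Sum>j\<le>d. (-1) ^ j * v (ps ! j) * ?m j)"
    unfolding detf_laplace_first_row by simp
  ultimately have "s * (\<Sum>j\<le>d. (-1) ^ j * v (ps ! j) * ?m j) = 0"
    by simp
  also have "s * (\<Sum>j\<le>d. (-1) ^ j * v (ps ! j) * ?m j) = (\<Sum>j\<le>d. (-1) ^ j * s * v (ps ! j) * ?m j)"
    unfolding sum_distrib_left by (rule sum.cong) (simp_all only: ac_simps)
  finally have "\<forall>j\<in>{..d}. (-1) ^ j * s * v (ps ! j) * ?m j = 0"
    using w mpos by (subst (asm) sum_nonneg_eq_0_iff) (auto intro!: mult_nonneg_nonneg[OF w less_imp_le[OF mpos]])
  then have v0: "v (ps ! j) = 0" if "j \<le> d" for j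
    using that mpos[OF that] s by auto
  have "detf d (\<lambda>i j. M i (ps ! j)) = 0"
    unfolding detf_eq_0_iff
    using x v0 v[OF psn] by (intro exI[of _ x]) auto
  moreover have "detf d (\<lambda>i j. M i (ps ! j)) > 0"
    by (rule TP_minor_pos[OF TP]) (auto intro!: strict_mono_onI psn mono)
  ultimately show False by simp
qed

lemma positions_map:
  assumes "positions n ps" "\<And>p q. p < q \<Longrightarrow> q < n \<Longrightarrow> L p < L q" "\<And>p. p < n \<Longrightarrow> L p < m"
  shows "positions m (map L ps)"
proof -
  have "set ps \<subseteq> {..<n} \<Longrightarrow> sorted_wrt (<) ps \<Longrightarrow> sorted_wrt (<) (map L ps)"
    by (induction ps) (auto intro: assms(2))
  then show ?thesis using assms(1,3) unfolding positions_def by auto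
qed

text \<open>
  Fusing the neighbours \<open>j0\<close> and \<open>j0 + 1\<close> of an index range into one term: the bookkeeping for the
  induction that proves \<open>kernel_vector_alternates\<close>.
\<close>

lemma sum_merge_adjacent:
  fixes g :: "nat \<Rightarrow> real"
  assumes "j0 < n"
  shows "(\<Sum>j<Suc n. g j) =
    (\<Sum>j<n. if j < j0 then g j else if j = j0 then g j0 + g (Suc j0) else g (Suc j))"
  using assms
proof (induction n)
  case (Suc n)
  show ?case
  proof (cases "j0 < n")
    case True
    then show ?thesis using Suc.IH by simp
  next
    case False
    then have j0: "j0 = n" using Suc.prems by simp
    have "(\<Sum>j<n. if j < j0 then g j else if j = j0 then g j0 + g (Suc j0) else g (Suc j)) = sum g {..<n}"
      using j0 by (intro sum.cong) auto
    then show ?thesis using j0 by simp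
  qed
qed simp

text \<open>
  A minor is linear in the merged column, so a minor of the new matrix is a positive combination
  of minors of the old one: replacing \<open>j0\<close> by \<open>j0\<close> or by \<open>j0 + 1\<close> in an increasing index map keeps it
  increasing once the later indices are shifted. This is where adjacency of the two columns matters.
\<close>

lemma TP_merge_adjacent:
  assumes TP: "TP d (Suc n) M" and j0: "j0 < n" and ab: "a \<ge> 0" "b \<ge> 0" "a + b > 0"
  shows "TP d n (\<lambda>i j. if j < j0 then M i j else if j = j0 then a * M i j0 + b * M i (Suc j0)
                         else M i (Suc j))" (is "TP d n ?M'")
  unfolding TP_def
proof
  fix f assume f: "f \<in> sorted_maps d n"
  then have fn: "f j < n" if "j < d" for j using that by (auto simp: sorted_maps_def)
  have fm: "f i < f j" if "i < j" "j < d" for i j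
    using f that by (auto simp: sorted_maps_def strict_mono_on_def)
  let ?f1 = "\<lambda>j. if f j \<le> j0 then f j else Suc (f j)"
  let ?f2 = "\<lambda>j. if f j < j0 then f j else Suc (f j)"
  have p1: "detf d (\<lambda>i j. M i (?f1 j)) > 0"
  proof (rule TP_minor_pos[OF TP])
    show "strict_mono_on {..<d} ?f1"
      using fm by (intro strict_mono_onI) (auto, meson le_trans less_imp_le)
  qed (auto dest: fn)
  have p2: "detf d (\<lambda>i j. M i (?f2 j)) > 0"
  proof (rule TP_minor_pos[OF TP])
    show "strict_mono_on {..<d} ?f2"
      using fm by (intro strict_mono_onI) (auto, meson less_trans)
  qed (auto dest: fn)
  show "detf d (\<lambda>i j. ?M' i (f j)) > 0"
  proof (cases "\<exists>c<d. f c = j0")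
    case True
    then obtain c where c: "c < d" "f c = j0" by blast
    have fc: "f j \<noteq> j0" if "j < d" "j \<noteq> c" for j
      using c that fm[of c j] fm[of j c] by (metis nat_neq_iff)
    have "detf d (\<lambda>i j. ?M' i (f j)) =
        a * detf d (\<lambda>i j. M i (?f1 j)) + b * detf d (\<lambda>i j. M i (?f2 j))"
      by (rule detf_linear_col[OF c(1)]) (use c fc in auto)
    also have "\<dots> > 0"
    proof (cases "a > 0")
      case True
      then show ?thesis using p1 p2 ab by (intro add_pos_nonneg mult_pos_pos mult_nonneg_nonneg) auto
    next
      case False
      then show ?thesis using p1 p2 ab by (intro add_nonneg_pos mult_pos_pos mult_nonneg_nonneg) auto
    qed
    finally show ?thesis .
  next
    case False
    then have "detf d (\<lambda>i j. ?M' i (f j)) = detf d (\<lambda>i j. M i (?f1 j))"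
      by (intro detf_cong) (auto simp: nat_neq_iff)
    then show ?thesis using p1 by simp
  qed
qed

text \<open>
  Induction on the number of columns. If two adjacent entries of \<open>v\<close> are not strictly opposite, merge
  the two columns, weighted by the absolute values of the entries; this preserves total positivity and the relation
  \<open>M v = 0\<close>. Otherwise \<open>v\<close> alternates everywhere. For \<open>n = d\<close> the matrix is invertible and there
  is no nonzero \<open>v\<close>.
\<close>

lemma kernel_vector_alternates:
  assumes "TP d n M" "d \<le> n" "\<exists>j<n. v j \<noteq> 0" "\<And>i. i < d \<Longrightarrow> (\<Sum>j<n. M i j * v j) = 0"
  shows "\<exists>s ps. s \<noteq> 0 \<and> positions n ps \<and> length ps = Suc d \<and> strictly_alt s v ps"
  using assms(2,1,3,4)
proof (induction n arbitrary: M v rule: dec_induct)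
  case base
  have "detf d (\<lambda>i j. M i ((\<lambda>j. j) j)) > 0"
    by (rule TP_minor_pos[OF base(1)]) (auto intro: strict_mono_onI)
  moreover have "detf d (\<lambda>i j. M j i) = 0"
    unfolding detf_eq_0_iff using base(2,3) by (intro exI[of _ v]) (auto simp: mult.commute)
  ultimately show ?case using detf_transpose[of d M] by simp
next
  case (step n)
  show ?case
  proof (cases "\<exists>j0<n. v j0 * v (Suc j0) \<ge> 0")
    case False
    then have neg: "v j * v (Suc j) < 0" if "j < n" for j using that by (auto simp: not_le)
    have v0: "v 0 \<noteq> 0" using step.prems(2) neg[of 0] by (cases n) auto
    have *: "(-1) ^ j * v 0 * v j > 0" if "j \<le> n" for j
      using that
    proof (induction j)
      case 0
      then show ?case using v0 by (simp add: zero_less_mult_iff linorder_neq_iff disj_commute)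
    next
      case (Suc j)
      then have "(-1) ^ j * v 0 * v j > 0" "v j * v (Suc j) < 0" using neg[of j] by auto
      then show ?case by (auto simp: zero_less_mult_iff mult_less_0_iff)
    qed
    have "strictly_alt (v 0) v [0..<Suc d]" unfolding strictly_alt_nth using * step.hyps by (auto simp del: upt_Suc)
    then show ?thesis using v0 step.hyps
      by (intro exI[of _ "v 0"] exI[of _ "[0..<Suc d]"]) (auto simp: positions_def simp del: upt_Suc)
  next
    case True
    then obtain j0 where j0: "j0 < n" "v j0 * v (Suc j0) \<ge> 0" by blast
    \<comment> \<open>\<open>a\<close>, \<open>b\<close> are the absolute values of the two entries and \<open>s\<close> is the sign that they share up to zeros;
      if both entries vanish, the weights \<open>0\<close>, \<open>1\<close> simply drop one column.\<close>
    obtain a b s where abs: "a \<ge> 0" "b \<ge> 0" "a + b > 0" "s * a = v j0" "s * b = v (Suc j0)"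
    proof (cases "v j0 = 0 \<and> v (Suc j0) = 0")
      case True
      then show ?thesis by (intro that[of 0 1 0]) auto
    next
      case False
      then show ?thesis using j0(2)
        by (intro that[of "\<bar>v j0\<bar>" "\<bar>v (Suc j0)\<bar>" "sgn (v j0 + v (Suc j0))"])
           (auto simp: sgn_if abs_if zero_le_mult_iff split: if_splits)
    qed
    let ?M' = "\<lambda>i j. if j < j0 then M i j else if j = j0 then a * M i j0 + b * M i (Suc j0)
                         else M i (Suc j)"
    let ?v' = "\<lambda>j. if j < j0 then v j else if j = j0 then s else v (Suc j)"
    have TP': "TP d n ?M'" by (rule TP_merge_adjacent[OF step.prems(1) j0(1) abs(1-3)])
    have nz: "\<exists>j<n. ?v' j \<noteq> 0"
    proof -
      obtain j where j: "j < Suc n" "v j \<noteq> 0" using step.prems(2) by blast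
      consider "j < j0" | "j = j0 \<or> j = Suc j0" | "j > Suc j0" by linarith
      then show ?thesis
      proof cases
        case 1 then show ?thesis using j j0 by (intro exI[of _ j]) auto
      next
        case 2 then show ?thesis using j j0 abs by (intro exI[of _ j0]) auto
      next
        case 3 then show ?thesis using j j0 by (intro exI[of _ "j - 1"]) auto
      qed
    qed
    have ker: "(\<Sum>j<n. ?M' i j * ?v' j) = 0" if "i < d" for i
    proof -
      have "(\<Sum>j<n. ?M' i j * ?v' j) = (\<Sum>j<Suc n. M i j * v j)"
        unfolding sum_merge_adjacent[OF j0(1)]
        by (rule sum.cong) (auto simp: abs(4,5)[symmetric] algebra_simps)
      then show ?thesis using step.prems(3)[OF that] by simp
    qed
    obtain t ps where ps: "t \<noteq> 0" "positions n ps" "length ps = Suc d" "strictly_alt t ?v' ps"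
      using step.IH[OF TP' nz ker] by blast
    \<comment> \<open>A position of the merged vector is lifted back; a merged position goes to a summand that is nonzero
      whenever \<open>s\<close> is.\<close>
    let ?L = "\<lambda>p. if p < j0 then p else if p = j0 then (if a > 0 then j0 else Suc j0) else Suc p"
    have L: "u * v (?L p) > 0" if "u * ?v' p > 0" for u p
    proof (cases "p = j0")
      case True
      then have "u * s > 0" using that by simp
      moreover have "u * v j0 = (u * s) * a" "u * v (Suc j0) = (u * s) * b"
        by (simp_all add: abs(4,5)[symmetric])
      moreover have "a > 0 \<or> a = 0 \<and> b > 0" using abs(1-3) by auto
      ultimately have "u * v (if a > 0 then j0 else Suc j0) > 0" by (auto simp only: if_True if_False less_irrefl mult_pos_pos)
      then show ?thesis using True by simp
    qed (use that in auto)
    have "strictly_alt t v (map ?L ps)"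
      using ps(4) L unfolding strictly_alt_nth by auto
    moreover have "positions (Suc n) (map ?L ps)"
      by (rule positions_map[OF ps(2)]) auto
    ultimately show ?thesis using ps(1,3) by (intro exI[of _ t] exI[of _ "map ?L ps"]) auto
  qed
qed

section \<open>Approximating nonnegative minors by positive ones\<close>

lemma sorted_maps_shift:
  assumes h: "h \<in> sorted_maps k n" and c: "c < k" and q: "q < n" "q = Suc (h c) \<or> Suc q = h c"
  shows "h(c := q) \<in> sorted_maps k n \<or> (\<exists>c'<k. c' \<noteq> c \<and> h c' = q)"
proof (cases "\<exists>c'<k. c' \<noteq> c \<and> h c' = q")
  case False
  have m: "h i < h j" if "i < j" "j < k" for i j
    using h that by (auto simp: sorted_maps_def strict_mono_on_def)
  have "strict_mono_on {..<k} (h(c := q))"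
  proof (rule strict_mono_onI)
    fix i j assume ij: "i \<in> {..<k}" "j \<in> {..<k}" "i < j"
    have "i \<noteq> c \<Longrightarrow> h i \<noteq> q" "j \<noteq> c \<Longrightarrow> h j \<noteq> q"
      using False ij(1,2) lessThan_iff by blast+
    then show "(h(c := q)) i < (h(c := q)) j" using m[of i j] ij q(2) by auto
  qed
  moreover have "h(c := q) \<in> {..<k} \<rightarrow>\<^sub>E {..<n}"
    using h c q by (auto simp: sorted_maps_def PiE_def extensional_def)
  ultimately show ?thesis by (simp add: sorted_maps_def)
qed simp

text \<open>
  Any increasing map can be brought to \<open>j \<mapsto> j\<close> by lowering one value at a time by one: the least index
  that is not fixed can be lowered. So a property that survives such moves in both directions is
  constant.
\<close>

lemma sorted_maps_connected:
  assumes step: "\<And>h c. h \<in> sorted_maps k n \<Longrightarrow> c < k \<Longrightarrow> h c > 0 \<Longrightarrow>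
      h(c := h c - 1) \<in> sorted_maps k n \<Longrightarrow> P h \<longleftrightarrow> P (h(c := h c - 1))"
    and h: "h \<in> sorted_maps k n"
  shows "P h \<longleftrightarrow> P (restrict (\<lambda>j. j) {..<k})"
  using h
proof (induction "\<Sum>j<k. h j" arbitrary: h rule: less_induct)
  case (less h)
  have m: "h i < h j" if "i < j" "j < k" for i j
    using less.prems that by (auto simp: sorted_maps_def strict_mono_on_def)
  have hn: "h j < n" if "j < k" for j using less.prems that by (auto simp: sorted_maps_def)
  show ?case
  proof (cases "\<exists>c<k. h c \<noteq> c")
    case False
    then have "h = restrict (\<lambda>j. j) {..<k}"
      using less.prems by (auto simp: sorted_maps_def PiE_def extensional_def)
    then show ?thesis by simp
  next
    case True
    define c where "c = (LEAST c. c < k \<and> h c \<noteq> c)"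
    have c: "c < k" "h c \<noteq> c" unfolding c_def using LeastI_ex[OF True] by auto
    have below: "h i = i" if "i < c" for i
      using not_less_Least[of i "\<lambda>c. c < k \<and> h c \<noteq> c"] that c(1) unfolding c_def[symmetric] by auto
    have "c < h c"
    proof (cases c)
      case (Suc b)
      then show ?thesis using below[of b] m[of b c] c by simp
    qed (use c in auto)
    have S: "h(c := h c - 1) \<in> sorted_maps k n"
    proof -
      have "h c' \<noteq> h c - 1" if "c' < k" "c' \<noteq> c" for c'
        using that below[of c'] m[of c c'] \<open>c < h c\<close> by (cases "c' < c") auto
      moreover have "h c - 1 < n" "Suc (h c - 1) = h c" using hn[OF c(1)] \<open>c < h c\<close> by auto
      ultimately show ?thesis using sorted_maps_shift[OF less.prems c(1), of "h c - 1"] by blast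
    qed
    have "(\<Sum>j<k. (h(c := h c - 1)) j) < (\<Sum>j<k. h j)"
      using c(1) \<open>c < h c\<close> by (intro sum_strict_mono_ex1) auto
    then show ?thesis using less.hyps[OF _ S] step[OF less.prems c(1) _ S] \<open>c < h c\<close> by simp
  qed
qed

lemma minor_column_operation:
  assumes h: "h \<in> sorted_maps k n" and c: "c < k"
  shows "detf k (\<lambda>i j. if h j = h c then C i (h c) + t * C i q else C i (h j)) =
         detf k (\<lambda>i j. C i (h j)) + t * detf k (\<lambda>i j. C i ((h(c := q)) j))"
proof -
  have inj: "h j = h c \<longleftrightarrow> j = c" if "j < k" for j
    using h c that strict_mono_on_imp_inj_on[of "{..<k}" h] by (auto simp: sorted_maps_def inj_on_def)
  have "detf k (\<lambda>i j. if h j = h c then C i (h c) + t * C i q else C i (h j)) =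
         1 * detf k (\<lambda>i j. C i (h j)) + t * detf k (\<lambda>i j. C i ((h(c := q)) j))"
    by (rule detf_linear_col[OF c]) (auto simp: inj)
  then show ?thesis by simp
qed

text \<open>
  If some minor vanishes and some minor does not, then by connectedness there are a vanishing
  and a positive one that differ in a single index, moved by one. Adding a small multiple of the column with the
  second index to the column with the first makes the vanishing minor positive and
  decreases no minor, because the two columns are adjacent. Repeating this removes all zero minors.
\<close>

lemma TNN_approx_TP:
  assumes "TNN k n C" "f0 \<in> sorted_maps k n" "detf k (\<lambda>i j. C i (f0 j)) > 0" "e > 0"
  shows "\<exists>C'. TP k n C' \<and> (\<forall>i<k. \<forall>j<n. \<bar>C' i j - C i j\<bar> < e)"
  using assms
proof (induction "card {f \<in> sorted_maps k n. detf k (\<lambda>i j. C i (f j)) = 0}" arbitrary: C e rule: less_induct)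
  case (less C e)
  let ?m = "\<lambda>C f. detf k (\<lambda>i j. C i (f j))"
  show ?case
  proof (cases "TP k n C")
    case True
    then show ?thesis using less.prems by (intro exI[of _ C]) auto
  next
    case False
    then obtain f1 where f1: "f1 \<in> sorted_maps k n" "\<not> ?m C f1 > 0" unfolding TP_def by blast
    have nn: "?m C f \<ge> 0" if "f \<in> sorted_maps k n" for f using less.prems(1) that by (simp add: TNN_def)
    have "\<exists>h c. h \<in> sorted_maps k n \<and> c < k \<and> h c > 0 \<and>
      h(c := h c - 1) \<in> sorted_maps k n \<and> (?m C h > 0) \<noteq> (?m C (h(c := h c - 1)) > 0)"
    proof (rule ccontr)
      assume "\<not> ?thesis"
      then have "(?m C h > 0) \<longleftrightarrow> (?m C (restrict (\<lambda>j. j) {..<k}) > 0)" if "h \<in> sorted_maps k n" for h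
        using that by (intro sorted_maps_connected[where P = "\<lambda>h. ?m C h > 0"]) blast+
      then show False using f1 less.prems(2,3) by blast
    qed
    then obtain h c where hc: "h \<in> sorted_maps k n" "c < k" "h c > 0"
      "h(c := h c - 1) \<in> sorted_maps k n" "(?m C h > 0) \<noteq> (?m C (h(c := h c - 1)) > 0)" by blast
    obtain g q where g: "g \<in> sorted_maps k n" "g(c := q) \<in> sorted_maps k n" "q < n"
       "q = Suc (g c) \<or> Suc q = g c" "?m C g = 0" "?m C (g(c := q)) > 0"
    proof (cases "?m C h > 0")
      case True
      then have "?m C (h(c := h c - 1)) = 0" using hc nn[OF hc(4)] by linarith
      moreover have "(h(c := h c - 1))(c := h c) = h" by simp
      moreover have "h c < n" using hc by (auto simp: sorted_maps_def)
      ultimately show ?thesis using True hc by (intro that[of "h(c := h c - 1)" "h c"]) auto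
    next
      case False
      then have "?m C h = 0" using nn[OF hc(1)] by linarith
      moreover have "h c < n" using hc by (auto simp: sorted_maps_def)
      ultimately show ?thesis using False hc by (intro that[of h "h c - 1"]) auto
    qed
    define p where "p = g c"
    define X where "X = (\<Sum>i<k. \<bar>C i q\<bar>)"
    \<comment> \<open>The column operation may use up half of the error \<open>e\<close>; the \<open>1\<close> guards against \<open>X = 0\<close>.\<close>
    define t where "t = e / (2 * (1 + X))"
    have X: "\<bar>C i q\<bar> \<le> X" if "i < k" for i
      unfolding X_def using that by (auto intro!: member_le_sum)
    have X0: "X \<ge> 0" unfolding X_def by (auto intro!: sum_nonneg)
    have t: "t > 0" using less.prems(4) X0 by (simp add: t_def)
    have small: "\<bar>t * C i q\<bar> < e / 2" if "i < k" for i
    proof -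
      have "\<bar>t * C i q\<bar> \<le> t * X" using X[OF that] t by (simp add: abs_mult)
      also have "\<dots> < t * (1 + X)" using t by simp
      also have "\<dots> = e / 2" using X0 by (simp add: t_def field_simps)
      finally show ?thesis .
    qed
    define D where "D = (\<lambda>i j. if j = p then C i p + t * C i q else C i j)"
    have mD: "?m D f \<ge> ?m C f" if f: "f \<in> sorted_maps k n" for f
    proof (cases "\<exists>b<k. f b = p")
      case False
      then have "?m D f = ?m C f" by (intro detf_cong) (auto simp: D_def)
      then show ?thesis by simp
    next
      case True
      then obtain b where b: "b < k" "f b = p" by blast
      \<comment> \<open>Replacing \<open>p\<close> by its neighbour \<open>q\<close> either keeps the index map increasing or repeats \<open>q\<close>.\<close>
      have "?m C (f(b := q)) \<ge> 0"
      proof (cases "f(b := q) \<in> sorted_maps k n")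
        case True then show ?thesis by (rule nn)
      next
        case False
        then obtain c' where c': "c' < k" "c' \<noteq> b" "f c' = q"
          using sorted_maps_shift[OF f b(1) g(3)] g(4) b(2) p_def by auto
        have "?m C (f(b := q)) = 0"
          by (rule detf_equal_cols[of b k c']) (use c' b in auto)
        then show ?thesis by simp
      qed
      moreover have "?m D f = ?m C f + t * ?m C (f(b := q))"
        using minor_column_operation[OF f b(1), of C t q] unfolding D_def b(2) by simp
      ultimately show ?thesis using t by simp
    qed
    have "?m D g = ?m C g + t * ?m C (g(c := q))"
      unfolding D_def p_def by (rule minor_column_operation[OF g(1) hc(2)])
    then have Dg: "?m D g > 0" using g t by simp
    have "card {f \<in> sorted_maps k n. ?m D f = 0} < card {f \<in> sorted_maps k n. ?m C f = 0}"
    proof (rule psubset_card_mono)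
      show "finite {f \<in> sorted_maps k n. ?m C f = 0}" using finite_sorted_maps by simp
      have "?m C f = 0" if "f \<in> sorted_maps k n" "?m D f = 0" for f
        using mD[OF that(1)] nn[OF that(1)] that(2) by linarith
      then have "{f \<in> sorted_maps k n. ?m D f = 0} \<subseteq> {f \<in> sorted_maps k n. ?m C f = 0}" by blast
      moreover have "g \<in> {f \<in> sorted_maps k n. ?m C f = 0}" "g \<notin> {f \<in> sorted_maps k n. ?m D f = 0}"
        using g Dg by auto
      ultimately show "{f \<in> sorted_maps k n. ?m D f = 0} \<subset> {f \<in> sorted_maps k n. ?m C f = 0}" by blast
    qed
    moreover have "TNN k n D" unfolding TNN_def using mD nn by (meson order_trans)
    moreover have "?m D f0 > 0" using mD[OF less.prems(2)] less.prems(3) by linarith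
    ultimately obtain C' where C': "TP k n C'" "\<forall>i<k. \<forall>j<n. \<bar>C' i j - D i j\<bar> < e / 2"
      using less.hyps[of D "e / 2"] less.prems(2,4) by auto
    have "\<bar>C' i j - C i j\<bar> < e" if ij: "i < k" "j < n" for i j
    proof -
      have "\<bar>D i j - C i j\<bar> < e / 2" using small[OF ij(1)] less.prems(4) by (auto simp: D_def)
      moreover have "\<bar>C' i j - D i j\<bar> < e / 2" using C' ij by blast
      ultimately show ?thesis by linarith
    qed
    then show ?thesis using C'(1) by blast
  qed
qed

definition indep_rows :: "nat \<Rightarrow> nat \<Rightarrow> (nat \<Rightarrow> nat \<Rightarrow> real) \<Rightarrow> bool" where
  "indep_rows d n M \<longleftrightarrow> (\<forall>x. (\<forall>j<n. (\<Sum>i<d. x i * M i j) = 0) \<longrightarrow> (\<forall>i<d. x i = 0))"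

text \<open>
  A nonzero minor grows by one row at a time: if bordering it with the new row and an arbitrary column always
  gave zero, the cofactors would be a linear relation between the rows, with the old minor as a coefficient.
\<close>

lemma indep_rows_minor:
  assumes "indep_rows d n M"
  shows "\<exists>f. (\<forall>j<d. f j < n) \<and> detf d (\<lambda>i j. M i (f j)) \<noteq> 0"
  using assms
proof (induction d)
  case 0
  show ?case by (auto simp: detf_def)
next
  case (Suc d)
  have "indep_rows d n M"
    unfolding indep_rows_def
  proof (intro allI impI)
    fix x i assume x: "\<forall>j<n. (\<Sum>i<d. x i * M i j) = 0" "i < d"
    have "\<forall>j<n. (\<Sum>i<Suc d. (x(d := 0)) i * M i j) = 0" using x by auto
    then have "\<forall>i<Suc d. (x(d := 0)) i = 0" using Suc.prems unfolding indep_rows_def by blast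
    then show "x i = 0" using x(2) by (auto dest!: spec[of _ i])
  qed
  then obtain f where f: "\<forall>j<d. f j < n" "detf d (\<lambda>i j. M i (f j)) \<noteq> 0" using Suc.IH by blast
  obtain c where c: "c d = detf d (\<lambda>i j. M i (f j))"
    "\<And>v. detf (Suc d) (\<lambda>i j. if j = d then v i else M i (f j)) = (\<Sum>i\<le>d. c i * v i)"
    by (rule detf_laplace_last_col[of d "\<lambda>i j. M i (f j)"]) blast
  have "c d \<noteq> 0" using c f by simp
  then have "\<not> (\<forall>j<n. (\<Sum>i<Suc d. c i * M i j) = 0)"
    using Suc.prems unfolding indep_rows_def by blast
  then obtain l where l: "l < n" "(\<Sum>i\<le>d. c i * M i l) \<noteq> 0" by (auto simp: lessThan_Suc_atMost)
  have "(\<lambda>i j. M i ((f(d := l)) j)) = (\<lambda>i j. if j = d then M i l else M i (f j))" by (auto simp: fun_eq_iff)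
  then have "detf (Suc d) (\<lambda>i j. M i ((f(d := l)) j)) \<noteq> 0" using c(2)[of "\<lambda>i. M i l"] l by simp
  then show ?case using f l by (intro exI[of _ "f(d := l)"]) auto
qed

text \<open>
  Reordering the columns does not affect whether a left kernel exists, hence whether the minor vanishes.
\<close>

lemma indep_rows_sorted_minor:
  assumes "indep_rows d n M"
  shows "\<exists>f \<in> sorted_maps d n. detf d (\<lambda>i j. M i (f j)) \<noteq> 0"
proof -
  obtain f where f: "\<forall>j<d. f j < n" "detf d (\<lambda>i j. M i (f j)) \<noteq> 0"
    using indep_rows_minor[OF assms] by blast
  have "inj_on f {..<d}"
    using f(2) detf_equal_cols[of _ d _ "\<lambda>i j. M i (f j)"] unfolding inj_on_def by (metis lessThan_iff)
  then have "card (f ` {..<d}) = d" by (simp add: card_image)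
  then obtain h where h: "bij_betw h {..<d} (f ` {..<d})" "strict_mono_on {..<d} h"
    using ex_bij_betw_strict_mono_card[of "f ` {..<d}"] by auto
  have hn: "h j < n" if "j < d" for j using h(1) f(1) that unfolding bij_betw_def by force
  have "detf d (\<lambda>i j. M i (h j)) \<noteq> 0"
  proof
    assume "detf d (\<lambda>i j. M i (h j)) = 0"
    then obtain x where x: "\<exists>i<d. x i \<noteq> 0" "\<forall>j<d. (\<Sum>i<d. x i * M i (h j)) = 0"
      unfolding detf_eq_0_iff by blast
    have "(\<Sum>i<d. x i * M i (f j)) = 0" if "j < d" for j
    proof -
      have "f j \<in> h ` {..<d}" using h(1) that unfolding bij_betw_def by auto
      then show ?thesis using x(2) by auto
    qed
    then have "detf d (\<lambda>i j. M i (f j)) = 0" unfolding detf_eq_0_iff using x(1) by blast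
    then show False using f by simp
  qed
  then show ?thesis
    using restrict_sorted_maps[OF h(2) hn] minor_restrict[of d M h] by (intro bexI[of _ "restrict h {..<d}"]) auto
qed

lemma eventually_strictly_alt:
  assumes "\<And>p. p \<in> set ps \<Longrightarrow> (\<lambda>m. w m p) \<longlonglongrightarrow> v p" "strictly_alt s v ps"
  shows "eventually (\<lambda>m. strictly_alt s (w m) ps) sequentially"
  using assms
proof (induction ps arbitrary: s)
  case (Cons p ps)
  have "(\<lambda>m. s * w m p) \<longlonglongrightarrow> s * v p" using Cons.prems by (intro tendsto_mult_left) auto
  then have "eventually (\<lambda>m. s * w m p > 0) sequentially"
    using Cons.prems by (auto dest: order_tendstoD)
  moreover have "eventually (\<lambda>m. strictly_alt (- s) (w m) ps) sequentially" using Cons by auto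
  ultimately show ?case by (auto elim: eventually_elim2)
qed simp

text \<open>
  Strict alternation is an open condition, so it would persist for a totally positive matrix near \<open>C\<close>
  and the same coefficients.
\<close>

lemma TNN_row_combination_not_alternating:
  assumes TNN: "TNN k n C" and ind: "indep_rows k n C"
    and v: "\<And>j. j < n \<Longrightarrow> v j = (\<Sum>i<k. x i * C i j)"
    and ps: "positions n ps" "length ps = Suc k" and s: "s \<noteq> 0"
  shows "\<not> strictly_alt s v ps"
proof
  assume strictly_alt: "strictly_alt s v ps"
  obtain f where f: "f \<in> sorted_maps k n" "detf k (\<lambda>i j. C i (f j)) \<noteq> 0"
    using indep_rows_sorted_minor[OF ind] by blast
  then have "detf k (\<lambda>i j. C i (f j)) > 0" using TNN unfolding TNN_def by force
  from TNN_approx_TP[OF TNN f(1) this]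
  have "\<exists>C'. TP k n C' \<and> (\<forall>i<k. \<forall>j<n. \<bar>C' i j - C i j\<bar> < inverse (real (Suc m)))" for m by simp
  then obtain C' where C': "\<And>m. TP k n (C' m)"
    "\<And>m i j. i < k \<Longrightarrow> j < n \<Longrightarrow> \<bar>C' m i j - C i j\<bar> < inverse (real (Suc m))" by metis
  have C'lim: "(\<lambda>m. C' m i j) \<longlonglongrightarrow> C i j" if "i < k" "j < n" for i j
  proof -
    have "(\<lambda>m. C' m i j - C i j) \<longlonglongrightarrow> 0"
      by (rule Lim_null_comparison[OF _ LIMSEQ_inverse_real_of_nat])
        (use C'(2)[OF that] in \<open>auto intro!: always_eventually less_imp_le\<close>)
    then show ?thesis by (simp add: LIM_zero_iff)
  qed
  let ?w = "\<lambda>m j. \<Sum>i<k. x i * C' m i j"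
  have psn: "p < n" if "p \<in> set ps" for p using ps that unfolding positions_def by auto
  have "eventually (\<lambda>m. strictly_alt s (?w m) ps) sequentially"
  proof (rule eventually_strictly_alt[OF _ strictly_alt])
    fix p assume "p \<in> set ps"
    then show "(\<lambda>m. ?w m p) \<longlonglongrightarrow> v p"
      using psn v by (auto intro!: tendsto_sum tendsto_mult_left C'lim)
  qed
  then obtain m where m: "strictly_alt s (?w m) ps" by (auto simp: eventually_sequentially)
  have "\<exists>i<k. x i \<noteq> 0"
  proof (rule ccontr)
    assume "\<not> ?thesis"
    then have "?w m p = 0" for p by simp
    then show False using m ps(2) by (cases ps) auto
  qed
  then show False
    using row_combination_not_weakly_alternating[OF C'(1) _ _ ps s, of x "?w m" m] strictly_alt_imp_weakly_alt[OF m]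
    by blast
qed

section \<open>Sign changes of lists and alternating positions\<close>

fun alternates :: "real \<Rightarrow> real list \<Rightarrow> bool" where
  "alternates s [] \<longleftrightarrow> True"
| "alternates s (z # zs) \<longleftrightarrow> s * z > 0 \<and> alternates (- s) zs"

lemma strictly_alt_eq_alternates: "strictly_alt s w ps \<longleftrightarrow> alternates s (map w ps)"
  by (induction ps arbitrary: s) auto

fun sign_changes :: "real list \<Rightarrow> nat" where
  "sign_changes (x # y # l) = (if x * y < 0 then 1 else 0) + sign_changes (y # l)"
| "sign_changes _ = 0"

lemma sign_changes_card:
  "card {i. Suc i < length ys \<and> ys ! i * ys ! Suc i < 0} = sign_changes ys"
proof (induction ys rule: sign_changes.induct)
  case (1 x y l)
  let ?S = "{i. Suc i < length (y # l) \<and> (y # l) ! i * (y # l) ! Suc i < 0}"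
  have fin: "finite ?S" by (rule finite_subset[of _ "{..<length (y # l)}"]) auto
  have eq: "{i. Suc i < length (x # y # l) \<and> (x # y # l) ! i * (x # y # l) ! Suc i < 0} =
      (if x * y < 0 then {0} else {}) \<union> Suc ` ?S" (is "?T = ?U")
  proof (rule Set.set_eqI)
    fix i show "i \<in> ?T \<longleftrightarrow> i \<in> ?U" by (cases i) auto
  qed
  have "card ((if x * y < 0 then {0} else {}) \<union> Suc ` ?S) = (if x * y < 0 then 1 else 0) + card (Suc ` ?S)"
    using fin by (auto simp: card_insert_if)
  also have "card (Suc ` ?S) = card ?S" by (simp add: card_image)
  finally show ?case unfolding eq 1 by simp
qed auto

lemma var_eq_sign_changes: "var xs = sign_changes (filter (\<lambda>x. x \<noteq> 0) xs)"
  unfolding var_def Let_def sign_changes_card ..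

text \<open>
  Keep the first entry and then the entries at which the sign changes. The induction has to know that
  the chosen subsequence starts with the sign of the first entry.
\<close>

lemma alternating_subsequence:
  assumes "\<forall>z\<in>set (x # l). z \<noteq> 0"
  shows "\<exists>s zs. subseq zs (x # l) \<and> length zs = Suc (sign_changes (x # l)) \<and> s * x > 0 \<and> alternates s zs"
  using assms
proof (induction l arbitrary: x)
  case Nil
  then show ?case by (intro exI[of _ x] exI[of _ "[x]"]) (auto simp: zero_less_mult_iff linorder_neq_iff)
next
  case (Cons y l)
  have "\<exists>s zs. subseq zs (y # l) \<and> length zs = Suc (sign_changes (y # l)) \<and> s * y > 0 \<and> alternates s zs"
    using Cons.prems by (intro Cons.IH) auto
  then obtain s zs where zs: "subseq zs (y # l)" "length zs = Suc (sign_changes (y # l))" "s * y > 0" "alternates s zs"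
    by blast
  show ?case
  proof (cases "x * y < 0")
    case True
    then have "- s * x > 0" using zs(3) by (auto simp: zero_less_mult_iff mult_less_0_iff)
    then show ?thesis using zs True by (intro exI[of _ "- s"] exI[of _ "x # zs"]) auto
  next
    case False
    have "x \<noteq> 0" "y \<noteq> 0" using Cons.prems by auto
    with False have "s * x > 0" using zs(3) by (auto simp: zero_less_mult_iff mult_less_0_iff)
    moreover obtain z t where t: "zs = z # t" using zs(2) by (cases zs) auto
    moreover have "subseq t (y # l)" using zs(1) t by (metis subseq_Cons')
    ultimately show ?thesis using zs False by (intro exI[of _ s] exI[of _ "x # t"]) auto
  qed
qed

text \<open>
  If \<open>x\<close> and \<open>y\<close> have the same sign, then an alternating subsequence that starts with \<open>x\<close> may start
  with \<open>y\<close> instead, since its second element, having the opposite sign, is not this \<open>y\<close>.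
\<close>

lemma alternating_subsequence_length:
  assumes "subseq zs ys" "alternates s zs" "\<forall>z\<in>set ys. z \<noteq> 0"
  shows "length zs \<le> Suc (sign_changes ys)"
  using assms
proof (induction ys arbitrary: zs s rule: sign_changes.induct)
  case (1 x y l)
  show ?case
  proof (cases "subseq zs (y # l)")
    case True
    then show ?thesis using "1.IH"[OF True "1.prems"(2)] "1.prems"(3) by auto
  next
    case False
    then obtain zt where zt: "zs = x # zt" "subseq zt (y # l)"
      using "1.prems"(1) by (cases zs) (auto split: if_splits)
    show ?thesis
    proof (cases "x * y < 0")
      case True
      have "length zt \<le> Suc (sign_changes (y # l))"
        using "1.IH"[OF zt(2), of "- s"] "1.prems" zt(1) by auto
      then show ?thesis using zt True by simp
    next
      case xy: False
      show ?thesis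
      proof (cases zt)
        case (Cons z1 t1)
        have "x \<noteq> 0" "y \<noteq> 0" using "1.prems" by auto
        then have sy: "s * y > 0" using xy "1.prems"(2) zt(1) by (auto simp: zero_less_mult_iff mult_less_0_iff)
        then have "z1 \<noteq> y" using "1.prems"(2) zt(1) Cons by auto
        then have "subseq (y # zt) (y # l)" using zt(2) Cons by auto
        then have "length (y # zt) \<le> Suc (sign_changes (y # l))"
          using "1.IH"[of "y # zt" s] "1.prems" zt(1) sy by auto
        then show ?thesis using zt(1) by simp
      qed (use zt in auto)
    qed
  qed
next
  case "2_1"
  then have "length zs \<le> length ([] :: real list)" using list_emb_length by blast
  then show ?case by simp
next
  case ("2_2" v)
  then have "length zs \<le> length [v]" using list_emb_length by blast
  then show ?case by simp
qed

lemma subseq_imp_sorted_wrt: "subseq xs ys \<Longrightarrow> sorted_wrt P ys \<Longrightarrow> sorted_wrt P xs"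
proof (induction rule: list_emb.induct)
  case (list_emb_Cons2 x y xs ys)
  then show ?case using list_emb_set by fastforce
qed auto

lemma subseq_upt_iff: "subseq ps [a..<n] \<longleftrightarrow> sorted_wrt (<) ps \<and> set ps \<subseteq> {a..<n}"
proof
  assume sub: "subseq ps [a..<n]"
  have "set ps \<subseteq> set [a..<n]" using list_emb_set[OF sub] by (metis subsetI)
  then show "sorted_wrt (<) ps \<and> set ps \<subseteq> {a..<n}"
    using subseq_imp_sorted_wrt[OF sub sorted_wrt_upt] by simp
next
  assume ps: "sorted_wrt (<) ps \<and> set ps \<subseteq> {a..<n}"
  have "filter (\<lambda>x. x \<in> set ps) [a..<n] = ps"
    by (rule strict_sorted_equal) (use ps in \<open>auto intro: sorted_wrt_filter\<close>)
  then show "subseq ps [a..<n]" by (metis subseq_filter_left)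
qed

text \<open>
  The form in which \<open>var\<close> is used: at least \<open>m\<close> sign changes amount to \<open>m + 1\<close> strictly alternating
  positions. For \<open>m = 0\<close> the right-hand side would require a nonzero entry.
\<close>

lemma var_ge_iff:
  assumes "m > 0"
  shows "m \<le> var (map w [a..<n]) \<longleftrightarrow>
    (\<exists>s ps. s \<noteq> 0 \<and> sorted_wrt (<) ps \<and> set ps \<subseteq> {a..<n} \<and> length ps = Suc m \<and> strictly_alt s w ps)"
proof
  let ?ys = "filter (\<lambda>x. x \<noteq> 0) (map w [a..<n])"
  assume le: "m \<le> var (map w [a..<n])"
  then have "?ys \<noteq> []" using assms by (auto simp: var_eq_sign_changes)
  then obtain x l where xl: "?ys = x # l" by (cases ?ys) auto
  have "\<forall>z\<in>set ?ys. z \<noteq> 0" by simp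
  then have "\<forall>z\<in>set (x # l). z \<noteq> 0" unfolding xl .
  from alternating_subsequence[OF this] obtain s zs where zs: "subseq zs ?ys"
    "length zs = Suc (var (map w [a..<n]))" "s * x > 0" "alternates s zs"
    unfolding var_eq_sign_changes xl by blast
  have "subseq zs (map w [a..<n])" using zs(1) subseq_filter_left subseq_order.trans by blast
  then obtain N where "zs = nths (map w [a..<n]) N" by (auto simp: subseq_conv_nths)
  then have zs': "zs = map w (nths [a..<n] N)" by (simp add: nths_map)
  let ?ps = "take (Suc m) (nths [a..<n] N)"
  have "subseq ?ps [a..<n]"
    by (meson subseq_conv_nths subseq_order.trans subseq_rev_drop_many take_is_prefix prefix_imp_subseq)
  moreover have "strictly_alt s w ?ps"
    using zs(4) unfolding zs' strictly_alt_eq_alternates[symmetric] strictly_alt_nth by auto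
  moreover have "length ?ps = Suc m" using zs(2) le unfolding zs' by simp
  moreover have "s \<noteq> 0" using zs(3) by auto
  ultimately show "\<exists>s ps. s \<noteq> 0 \<and> sorted_wrt (<) ps \<and> set ps \<subseteq> {a..<n} \<and> length ps = Suc m \<and> strictly_alt s w ps"
    unfolding subseq_upt_iff by blast
next
  let ?ys = "filter (\<lambda>x. x \<noteq> 0) (map w [a..<n])"
  assume "\<exists>s ps. s \<noteq> 0 \<and> sorted_wrt (<) ps \<and> set ps \<subseteq> {a..<n} \<and> length ps = Suc m \<and> strictly_alt s w ps"
  then obtain s ps where ps: "subseq ps [a..<n]" "length ps = Suc m" "strictly_alt s w ps"
    unfolding subseq_upt_iff by blast
  have alt: "alternates s (map w ps)" using ps(3) by (simp add: strictly_alt_eq_alternates)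
  have "alternates t zs \<Longrightarrow> filter (\<lambda>x. x \<noteq> 0) zs = zs" for t zs
    by (induction zs arbitrary: t) auto
  then have "filter (\<lambda>x. x \<noteq> 0) (map w ps) = map w ps" using alt by blast
  moreover have "subseq (map w ps) (map w [a..<n])" using ps(1) by (rule subseq_map)
  ultimately have "subseq (map w ps) ?ys" using subseq_filter by metis
  from alternating_subsequence_length[OF this alt] ps(2)
  show "m \<le> var (map w [a..<n])" unfolding var_eq_sign_changes by simp
qed

section \<open>Brackets on coordinate functions\<close>

text \<open>
  The bracket \<open>\<langle>Y u v\<rangle>\<close> on coordinate functions; \<open>bracket_eq_fbracket\<close> is the link.
\<close>

definition fbracket :: "nat \<Rightarrow> (nat \<Rightarrow> nat \<Rightarrow> real) \<Rightarrow> (nat \<Rightarrow> real) \<Rightarrow> (nat \<Rightarrow> real) \<Rightarrow> real" where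
  "fbracket k Y u v = detf (k + 2) (\<lambda>i j. if i < k then Y i j else if i = k then u j else v j)"

lemma fbracket_cong:
  assumes "\<And>i j. i < k \<Longrightarrow> j < k + 2 \<Longrightarrow> Y i j = Y' i j"
    "\<And>j. j < k + 2 \<Longrightarrow> u j = u' j" "\<And>j. j < k + 2 \<Longrightarrow> v j = v' j"
  shows "fbracket k Y u v = fbracket k Y' u' v'"
  unfolding fbracket_def by (rule detf_cong) (use assms in auto)

lemma fbracket_functional:
  obtains c where "\<And>v. fbracket k Y u v = (\<Sum>l<k + 2. c l * v l)"
proof -
  let ?A = "\<lambda>i j. if j < k then Y j i else u i"
  obtain c where c: "\<And>v. detf (Suc (Suc k)) (\<lambda>i j. if j = Suc k then v i else ?A i j) = (\<Sum>i\<le>Suc k. c i * v i)"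
    by (rule detf_laplace_last_col[of "Suc k" ?A]) blast
  have "fbracket k Y u v = (\<Sum>l<k + 2. c l * v l)" for v
  proof -
    have "fbracket k Y u v = detf (Suc (Suc k)) (\<lambda>i j. if j < k then Y j i else if j = k then u i else v i)"
      unfolding fbracket_def
      using detf_transpose[of "k + 2" "\<lambda>i j. if i < k then Y i j else if i = k then u j else v j"]
      by (simp add: numeral_2_eq_2)
    also have "\<dots> = detf (Suc (Suc k)) (\<lambda>i j. if j = Suc k then v i else ?A i j)"
      by (rule detf_cong) auto
    also have "\<dots> = (\<Sum>l<k + 2. c l * v l)" unfolding c by (simp add: lessThan_Suc_atMost)
    finally show ?thesis .
  qed
  then show ?thesis by (rule that)
qed

lemma fbracket_add_scaled_right:
  "fbracket k Y u (\<lambda>j. a * v j + b * w j) = a * fbracket k Y u v + b * fbracket k Y u w"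
proof -
  obtain c where c: "\<And>v. fbracket k Y u v = (\<Sum>l<k + 2. c l * v l)" by (rule fbracket_functional) blast
  show ?thesis unfolding c sum_distrib_left sum.distrib[symmetric]
    by (rule sum.cong) (auto simp: algebra_simps)
qed

lemma fbracket_sum_right:
  "fbracket k Y u (\<lambda>j. \<Sum>i\<in>I. a i * v i j) = (\<Sum>i\<in>I. a i * fbracket k Y u (v i))"
proof -
  obtain c where c: "\<And>v. fbracket k Y u v = (\<Sum>l<k + 2. c l * v l)" by (rule fbracket_functional) blast
  show ?thesis unfolding c sum_distrib_left
    by (subst sum.swap) (auto simp: algebra_simps)
qed

lemma fbracket_same: "fbracket k Y u u = 0"
  unfolding fbracket_def by (rule detf_equal_rows[of k _ "Suc k"]) auto

lemma fbracket_row: "i < k \<Longrightarrow> fbracket k Y u (Y i) = 0"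
  unfolding fbracket_def by (rule detf_equal_rows[of i _ "Suc k"]) auto

lemma fbracket_swap: "fbracket k Y u v = - fbracket k Y v u"
proof -
  have l: "fbracket k Y (\<lambda>j. 1 * a j + 1 * b j) w = 1 * fbracket k Y a w + 1 * fbracket k Y b w" for a b w
    unfolding fbracket_def by (rule detf_linear_row[of k]) auto
  have "fbracket k Y (\<lambda>j. 1 * u j + 1 * v j) (\<lambda>j. 1 * u j + 1 * v j) = 0" by (rule fbracket_same)
  then show ?thesis unfolding l fbracket_add_scaled_right fbracket_same by simp
qed

lemma fbracket_uminus_row:
  assumes "k > 0"
  shows "fbracket k (Y(0 := \<lambda>j. - Y 0 j)) u v = - fbracket k Y u v"
proof -
  have "fbracket k (Y(0 := \<lambda>j. - Y 0 j)) u v = (-1) * fbracket k Y u v + 0 * fbracket k Y u v"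
    unfolding fbracket_def by (rule detf_linear_row[of 0]) (use assms in auto)
  then show ?thesis by simp
qed

lemma fbracket_span_right:
  assumes "\<And>j. j < k + 2 \<Longrightarrow> x j = (\<Sum>i<k. c i * Y i j) + a * u j + b * v j"
  shows "fbracket k Y w x = a * fbracket k Y w u + b * fbracket k Y w v"
proof -
  have "fbracket k Y w x = fbracket k Y w (\<lambda>j. 1 * (\<Sum>i<k. c i * Y i j) + 1 * (a * u j + b * v j))"
    by (rule fbracket_cong) (use assms in auto)
  then show ?thesis unfolding fbracket_add_scaled_right fbracket_sum_right by (simp add: fbracket_row)
qed

lemma detf_solve:
  assumes "detf d A \<noteq> 0"
  shows "\<exists>y. \<forall>j<d. (\<Sum>i<d. y i * A i j) = x j"
proof -
  let ?M = "Matrix.mat d d (\<lambda>(i, j). A j i)"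
  have M: "?M \<in> carrier_mat d d" by simp
  have "Determinant.det ?M \<noteq> 0" using assms detf_transpose[of d A] unfolding detf_def by simp
  then have "?M \<in> Units (ring_mat TYPE(real) d undefined)" by (rule det_non_zero_imp_unit[OF M])
  then obtain B where B: "B \<in> carrier_mat d d" "?M * B = 1\<^sub>m d"
    by (auto simp: Units_def ring_mat_def)
  let ?y = "B *\<^sub>v Matrix.vec d x"
  have y: "?y \<in> carrier_vec d" using B by simp
  have "?M *\<^sub>v ?y = (?M * B) *\<^sub>v Matrix.vec d x"
    by (rule assoc_mult_mat_vec[symmetric, of _ d d _ d]) (use B in auto)
  then have eq: "?M *\<^sub>v ?y = Matrix.vec d x" using B by simp
  have "(\<Sum>i<d. vec_index ?y i * A i j) = x j" if "j < d" for j
  proof -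
    have "x j = vec_index (?M *\<^sub>v ?y) j" unfolding eq using that by simp
    also have "\<dots> = (\<Sum>i<d. vec_index ?y i * A i j)"
      using that carrier_vecD[OF y] by (simp add: scalar_prod_def lessThan_atLeast0 mult.commute del: dim_mult_mat_vec)
    finally show ?thesis by simp
  qed
  then show ?thesis by blast
qed

text \<open>
  If the bracket is nonzero, the rows of \<open>Y\<close> together with \<open>u\<close>, \<open>v\<close> are a basis.
\<close>

lemma fbracket_decompose:
  assumes "fbracket k Y u v \<noteq> 0"
  obtains c a b where "\<And>j. j < k + 2 \<Longrightarrow> x j = (\<Sum>i<k. c i * Y i j) + a * u j + b * v j"
proof -
  obtain y where y: "\<forall>j<k+2. (\<Sum>i<k+2. y i * (if i < k then Y i j else if i = k then u j else v j)) = x j"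
    using detf_solve[OF assms[unfolded fbracket_def]] by blast
  show ?thesis
    by (rule that[of y "y k" "y (Suc k)"]) (use y in \<open>auto dest!: spec\<close>)
qed

text \<open>
  Modulo the row span of \<open>Y\<close> the vectors \<open>u\<close>, \<open>v\<close> span a plane on which the bracket is a
  determinant, and the statement is Cramer's rule for the three vectors \<open>u\<close>, \<open>p\<close>, \<open>q\<close> of this plane. In
  coordinates \<open>p = a u + b v\<close>, \<open>q = a' u + b' v\<close> both components cancel.
\<close>

lemma three_term_combination_in_row_span:
  assumes D: "fbracket k Y u v \<noteq> 0"
  shows "\<exists>x. \<forall>j<k + 2. fbracket k Y p q * u j - fbracket k Y u q * p j + fbracket k Y u p * q j = (\<Sum>i<k. x i * Y i j)"
proof -
  obtain c a b where p: "\<And>j. j < k + 2 \<Longrightarrow> p j = (\<Sum>i<k. c i * Y i j) + a * u j + b * v j"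
    by (rule fbracket_decompose[OF D, where x = p]) blast
  obtain c' a' b' where q: "\<And>j. j < k + 2 \<Longrightarrow> q j = (\<Sum>i<k. c' i * Y i j) + a' * u j + b' * v j"
    by (rule fbracket_decompose[OF D, where x = q]) blast
  let ?D = "fbracket k Y u v"
  have up: "fbracket k Y u p = b * ?D" and uq: "fbracket k Y u q = b' * ?D"
    using fbracket_span_right[OF p, where w = u] fbracket_span_right[OF q, where w = u] by (simp_all add: fbracket_same)
  have vp: "fbracket k Y v p = - (a * ?D)"
    using fbracket_span_right[OF p, where w = v] fbracket_swap[of k Y v u] by (simp add: fbracket_same)
  have pq: "fbracket k Y p q = (a * b' - a' * b) * ?D"
    using fbracket_span_right[OF q, where w = p] fbracket_swap[of k Y p u] fbracket_swap[of k Y p v] up vp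
    by (simp add: algebra_simps)
  have "fbracket k Y p q * u j - fbracket k Y u q * p j + fbracket k Y u p * q j =
      (\<Sum>i<k. (b * ?D * c' i - b' * ?D * c i) * Y i j)" if "j < k + 2" for j
  proof -
    have "(\<Sum>i<k. (b * ?D * c' i - b' * ?D * c i) * Y i j) =
       b * ?D * (\<Sum>i<k. c' i * Y i j) - b' * ?D * (\<Sum>i<k. c i * Y i j)"
      unfolding sum_distrib_left sum_subtractf[symmetric] by (rule sum.cong) (auto simp: algebra_simps)
    then show ?thesis unfolding pq up uq p[OF that] q[OF that] by (simp add: algebra_simps)
  qed
  then show ?thesis by (intro exI[of _ "\<lambda>i. b * ?D * c' i - b' * ?D * c i"]) blast
qed

section \<open>Signs of brackets on totally positive images\<close>

lemma strictly_alt_nonzero: "strictly_alt s w ps \<Longrightarrow> p \<in> set ps \<Longrightarrow> w p \<noteq> 0"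
  by (induction ps arbitrary: s) auto

lemma strictly_alt_cong: "(\<And>p. p \<in> set ps \<Longrightarrow> w p = w' p) \<Longrightarrow> strictly_alt s w ps \<longleftrightarrow> strictly_alt s w' ps"
  by (induction ps arbitrary: s) auto

text \<open>
  Split the \<open>k + 1\<close> strictly alternating positions into those left and those right of the zero \<open>a\<close>; \<open>\<sigma>\<close> is the sign
  required at the first position on the right. If \<open>w (a + 1)\<close> did not have that sign,
  then \<open>a\<close>, \<open>a + 1\<close> could be inserted between the two parts, as a zero fits either sign, and \<open>k + 3\<close>
  positions would alternate weakly. On the left one argues in the same way with \<open>a - 1\<close>, \<open>a\<close>.
\<close>

lemma neighbours_of_zero:
  assumes strictly_alt: "strictly_alt s w ps" "s \<noteq> 0" "positions n ps" "length ps = Suc k"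
    and no: "\<And>t qs. t \<noteq> 0 \<Longrightarrow> positions n qs \<Longrightarrow> length qs = k + 3 \<Longrightarrow> \<not> weakly_alt t w qs"
    and a: "a < n" "w a = 0"
  shows "\<exists>\<sigma>. (Suc a < n \<longrightarrow> \<sigma> * w (Suc a) > 0) \<and> (a > 0 \<longrightarrow> \<sigma> * w (a - 1) < 0)"
proof -
  define as bs where "as = takeWhile (\<lambda>p. p < a) ps" and "bs = dropWhile (\<lambda>p. p < a) ps"
  have ps: "ps = as @ bs" by (simp add: as_def bs_def)
  define \<sigma> where "\<sigma> = (-1) ^ length as * s"
  have s\<sigma>: "strictly_alt s w as" "strictly_alt \<sigma> w bs" using strictly_alt(1) unfolding ps strictly_alt_append \<sigma>_def by auto
  have srt: "sorted_wrt (<) as" "sorted_wrt (<) bs" "set as \<subseteq> {..<n}" "set bs \<subseteq> {..<n}"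
    using strictly_alt(3) unfolding ps positions_def sorted_wrt_append by auto
  have as: "p < a" if "p \<in> set as" for p using that set_takeWhileD unfolding as_def by metis
  have bs: "a < p" if "p \<in> set bs" for p
  proof (cases bs)
    case (Cons b bs')
    have "\<not> b < a" using hd_dropWhile[of "\<lambda>p. p < a" ps] Cons unfolding bs_def by auto
    moreover have "w b \<noteq> 0" using strictly_alt_nonzero[OF s\<sigma>(2)] Cons by simp
    ultimately have "a < b" using a(2) by (metis nat_neq_iff)
    then show ?thesis using that srt(2) Cons by auto
  qed (use that in simp)
  have len: "length as + length bs = Suc k" using strictly_alt(4) unfolding ps by simp
  have right: "\<sigma> * w (Suc a) > 0" if "Suc a < n"
  proof (rule ccontr)
    assume c: "\<not> \<sigma> * w (Suc a) > 0"
    have bs': "Suc a < p" if "p \<in> set bs" for p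
    proof (cases bs)
      case (Cons b bs')
      have "\<sigma> * w b > 0" using s\<sigma>(2) Cons by simp
      then have "b \<noteq> Suc a" using c by auto
      then have "Suc a < b" using bs[of b] Cons by auto
      then show ?thesis using that srt(2) Cons by auto
    qed (use that in simp)
    have "weakly_alt s w (as @ a # Suc a # bs)"
      unfolding weakly_alt_append using s\<sigma> c a(2) by (auto simp: \<sigma>_def intro: strictly_alt_imp_weakly_alt)
    moreover have "positions n (as @ a # Suc a # bs)"
    proof -
      have "\<forall>x\<in>set as. \<forall>y\<in>set bs. x < y" using as bs less_trans by blast
      moreover have "\<forall>x\<in>set bs. a < x \<and> Suc a < x" using bs bs' by blast
      moreover have "\<forall>x\<in>set as. x < a \<and> x < Suc a" using as less_SucI by blast
      ultimately show ?thesis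
        unfolding positions_def sorted_wrt_append using srt a that by auto
    qed
    ultimately show False using no[of s "as @ a # Suc a # bs"] strictly_alt(2) len by simp
  qed
  have left: "\<sigma> * w (a - 1) < 0" if "a > 0"
  proof (rule ccontr)
    assume c: "\<not> \<sigma> * w (a - 1) < 0"
    have as': "p < a - 1" if p: "p \<in> set as" for p
    proof (cases as rule: rev_cases)
      case (snoc as' b)
      have "(-1) ^ length as' * s * w b > 0" using s\<sigma>(1) snoc by (simp add: strictly_alt_append)
      then have "\<sigma> * w b < 0" unfolding \<sigma>_def snoc by simp
      then have "b \<noteq> a - 1" using c by auto
      then have "b < a - 1" using as[of b] snoc by auto
      then show ?thesis using p srt(1) snoc by (auto simp: sorted_wrt_append)
    qed (use p in simp)
    have "weakly_alt s w (as @ (a - 1) # a # bs)"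
      unfolding weakly_alt_append using s\<sigma> c a(2) by (auto simp: \<sigma>_def intro: strictly_alt_imp_weakly_alt)
    moreover have "positions n (as @ (a - 1) # a # bs)"
    proof -
      have "a - 1 < p" if "p \<in> set bs" for p using bs[OF that] by simp
      moreover have "\<forall>x\<in>set as. \<forall>y\<in>set bs. x < y" using as bs less_trans by blast
      moreover have "a - 1 < n" "a - 1 < a" using a that by auto
      ultimately show ?thesis
        unfolding positions_def sorted_wrt_append using srt as as' bs a by (auto dest: less_trans)
    qed
    ultimately show False using no[of s "as @ (a - 1) # a # bs"] strictly_alt(2) len by simp
  qed
  show ?thesis using right left by blast
qed

text \<open>
  Both factors of \<open>Y = C Z\<close> are totally positive; \<open>z j\<close> is row \<open>j\<close> of \<open>Z\<close>, with indices from \<open>0\<close>.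
\<close>

locale positive_pair =
  fixes k n :: nat and C z Y :: "nat \<Rightarrow> nat \<Rightarrow> real"
  assumes TP_C: "TP k n C" and TP_z: "TP (k + 2) n (\<lambda>l j. z j l)" and kn: "k + 2 \<le> n"
    and Y: "\<And>i l. Y i l = (\<Sum>j<n. C i j * z j l)"
begin

text \<open>
  A linear relation between the rows of \<open>C Z\<close>, \<open>Z\<^sub>1\<close> and \<open>Z\<^sub>2\<close> is a vector annihilated by \<open>Z\<close> that differs from a
  row combination of \<open>C\<close> only in its first two entries. If it is nonzero it alternates at \<open>k + 3\<close> positions, hence
  the row combination alternates at the last \<open>k + 1\<close> of them. If it is zero, the row combination vanishes
  outside the first two entries and so alternates weakly at positions \<open>2, \<dots>, k + 2\<close>. Both contradict the total
  positivity of \<open>C\<close>, unless the row combination and with it the whole relation is trivial.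
\<close>

lemma first_bracket_nonzero: "fbracket k Y (z 0) (z 1) \<noteq> 0"
proof
  assume "fbracket k Y (z 0) (z 1) = 0"
  then obtain x where x: "\<exists>i<k + 2. x i \<noteq> 0"
    "\<And>l. l < k + 2 \<Longrightarrow> (\<Sum>i<k + 2. x i * (if i < k then Y i l else if i = k then z 0 l else z 1 l)) = 0"
    unfolding fbracket_def detf_eq_0_iff by auto
  let ?u = "\<lambda>j. \<Sum>i<k. x i * C i j"
  let ?v = "\<lambda>j. ?u j + (if j = 0 then x k else 0) + (if j = 1 then x (Suc k) else 0)"
  have n: "0 < n" "1 < n" using kn by auto
  have ker: "(\<Sum>j<n. z j l * ?v j) = 0" if "l < k + 2" for l
  proof -
    have "(\<Sum>j<n. z j l * ?v j) = (\<Sum>j<n. z j l * ?u j) + x k * z 0 l + x (Suc k) * z 1 l"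
      using n by (simp add: distrib_left sum.distrib if_distrib[of "\<lambda>y. z _ _ * y"] sum.delta mult.commute cong: if_cong)
    also have "(\<Sum>j<n. z j l * ?u j) = (\<Sum>i<k. x i * Y i l)"
      unfolding Y sum_distrib_left by (subst sum.swap) (simp add: ac_simps)
    also have "(\<Sum>i<k. x i * Y i l) + x k * z 0 l + x (Suc k) * z 1 l = 0"
      using x(2)[OF that] by simp
    finally show ?thesis .
  qed
  show False
  proof (cases "\<exists>j<n. ?v j \<noteq> 0")
    case True
    obtain s ps where ps: "s \<noteq> 0" "positions n ps" "length ps = Suc (k + 2)" "strictly_alt s ?v ps"
      using kernel_vector_alternates[OF TP_z kn True] ker by blast
    then obtain p0 p1 qs where pq: "ps = p0 # p1 # qs" "length qs = Suc k"
      by (auto simp: length_Suc_conv numeral_2_eq_2)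
    have ge: "p > 1" if "p \<in> set qs" for p using ps(2) that unfolding pq positions_def by auto
    have "strictly_alt s ?v qs" using ps(4) pq(1) by simp
    moreover have "strictly_alt s ?v qs \<longleftrightarrow> strictly_alt s ?u qs" by (rule strictly_alt_cong) (auto dest: ge)
    ultimately have su: "strictly_alt s ?u qs" by simp
    have "\<exists>i<k. x i \<noteq> 0"
    proof (rule ccontr)
      assume "\<not> ?thesis"
      then have "?u p = 0" for p by simp
      then show False using su pq(2) by (cases qs) auto
    qed
    moreover have "positions n qs" using ps(2) unfolding pq positions_def by auto
    ultimately show False
      using row_combination_not_weakly_alternating[OF TP_C _ _ _ pq(2) ps(1), of x ?u] strictly_alt_imp_weakly_alt[OF su] by blast
  next
    case False
    then have v0: "?v j = 0" if "j < n" for j using that by blast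
    have u0: "?u j = 0" if "1 < j" "j < n" for j using v0[OF that(2)] that(1) by simp
    have xk: "\<forall>i<k. x i = 0"
    proof (rule ccontr)
      assume "\<not> ?thesis"
      then have xi: "\<exists>i<k. x i \<noteq> 0" by blast
      \<comment> \<open>Only the first of the positions \<open>1, \<dots>, k + 1\<close> (counted from \<open>0\<close>) can carry a nonzero value, so its sign fixes \<open>t\<close>.\<close>
      define t :: real where "t = (if ?u 1 \<ge> 0 then 1 else -1)"
      have "weakly_alt t ?u [1..<k + 2]"
        unfolding weakly_alt_nth
      proof (intro allI impI)
        fix j assume "j < length [1..<k + 2]"
        then have j: "j < Suc k" by (simp del: upt_Suc)
        show "0 \<le> (- 1) ^ j * t * ?u ([1..<k + 2] ! j)"
        proof (cases j)
          case 0
          then show ?thesis using j by (simp add: t_def del: upt_Suc)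
        next
          case (Suc i)
          then have "?u ([1..<k + 2] ! j) = 0" using j kn by (subst nth_upt) (auto intro!: u0)
          then show ?thesis by simp
        qed
      qed
      moreover have "positions n [1..<k + 2]" "length [1..<k + 2] = Suc k" "t \<noteq> 0"
        using kn by (auto simp: positions_def t_def simp del: upt_Suc)
      ultimately show False using row_combination_not_weakly_alternating[OF TP_C xi, of ?u] by blast
    qed
    then have "?u j = 0" for j by simp
    then have "x k = 0" "x (Suc k) = 0" using v0[of 0] v0[of 1] n by auto
    then have "x i = 0" if "i < k + 2" for i using xk that by (auto simp: less_Suc_eq numeral_2_eq_2)
    then show False using x(1) by blast
  qed
qed

text \<open>
  \<open>\<langle>Y u Z\<^sub>j\<rangle>\<close> is \<open>Z\<close> applied to the functional \<open>\<langle>Y u \<cdot>\<rangle>\<close>, which kills the rows of \<open>Y = C Z\<close>. So both variation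
  estimates apply, for \<open>C\<close> and for the transpose of \<open>Z\<close>.
\<close>

lemma bracket_row_alternates:
  assumes "fbracket k Y u v \<noteq> 0"
  shows "\<exists>s ps. s \<noteq> 0 \<and> positions n ps \<and> length ps = Suc k \<and> strictly_alt s (\<lambda>j. fbracket k Y u (z j)) ps"
    and "t \<noteq> 0 \<Longrightarrow> positions n qs \<Longrightarrow> length qs = k + 3 \<Longrightarrow> \<not> weakly_alt t (\<lambda>j. fbracket k Y u (z j)) qs"
proof -
  obtain c where c: "\<And>v. fbracket k Y u v = (\<Sum>l<k + 2. c l * v l)" by (rule fbracket_functional) blast
  have c0: "\<exists>l<k+2. c l \<noteq> 0"
  proof (rule ccontr)
    assume "\<not> ?thesis"
    then have "fbracket k Y u v = 0" unfolding c by simp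
    then show False using assms by simp
  qed
  show no: "t \<noteq> 0 \<Longrightarrow> positions n qs \<Longrightarrow> length qs = k + 3 \<Longrightarrow> \<not> weakly_alt t (\<lambda>j. fbracket k Y u (z j)) qs" for t qs
    using row_combination_not_weakly_alternating[OF TP_z c0, of "\<lambda>j. fbracket k Y u (z j)" qs t] by (simp add: c)
  have "\<exists>j<n. fbracket k Y u (z j) \<noteq> 0"
  proof (rule ccontr)
    assume "\<not> ?thesis"
    then have *: "\<And>j. j < k + 2 \<Longrightarrow> fbracket k Y u (z j) = 0" using kn by auto
    have "detf (k + 2) (\<lambda>i j. z j i) = 0"
      unfolding detf_eq_0_iff using c0 * unfolding c by (intro exI[of _ c]) auto
    moreover have "detf (k + 2) (\<lambda>i j. z ((\<lambda>j. j) j) i) > 0"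
      by (rule TP_minor_pos[OF TP_z]) (use kn in \<open>auto intro: strict_mono_onI\<close>)
    ultimately show False by simp
  qed
  moreover have "(\<Sum>j<n. C i j * fbracket k Y u (z j)) = 0" if "i < k" for i
  proof -
    have "(\<Sum>j<n. C i j * fbracket k Y u (z j)) = fbracket k Y u (\<lambda>l. \<Sum>j<n. C i j * z j l)"
      by (rule fbracket_sum_right[symmetric])
    also have "(\<lambda>l. \<Sum>j<n. C i j * z j l) = Y i" by (rule ext) (simp add: Y)
    finally show ?thesis using fbracket_row[OF that, of Y u] by simp
  qed
  ultimately show "\<exists>s ps. s \<noteq> 0 \<and> positions n ps \<and> length ps = Suc k \<and> strictly_alt s (\<lambda>j. fbracket k Y u (z j)) ps"
    using kernel_vector_alternates[OF TP_C, of "\<lambda>j. fbracket k Y u (z j)"] kn by auto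
qed

lemma bracket_row_neighbours:
  assumes "fbracket k Y (z a) v \<noteq> 0" "a < n"
  shows "\<exists>\<sigma>. (Suc a < n \<longrightarrow> \<sigma> * fbracket k Y (z a) (z (Suc a)) > 0) \<and> (a > 0 \<longrightarrow> \<sigma> * fbracket k Y (z a) (z (a - 1)) < 0)"
proof -
  obtain s ps where "s \<noteq> 0" "positions n ps" "length ps = Suc k" "strictly_alt s (\<lambda>j. fbracket k Y (z a) (z j)) ps"
    using bracket_row_alternates(1)[OF assms(1)] by blast
  then show ?thesis
    using neighbours_of_zero[of s "\<lambda>j. fbracket k Y (z a) (z j)" ps n k a] bracket_row_alternates(2)[OF assms(1)]
      assms(2) fbracket_same by blast
qed

text \<open>
  The brackets \<open>\<langle>Y Z\<^sub>a Z\<^sub>a\<^sub>-\<^sub>1\<rangle>\<close> and \<open>\<langle>Y Z\<^sub>a Z\<^sub>a\<^sub>+\<^sub>1\<rangle>\<close> are the values next to the zero of the sequence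
  \<open>\<langle>Y Z\<^sub>a Z\<^sub>j\<rangle>\<close>, hence of opposite sign; swapping the arguments of the first one makes the signs agree.
\<close>

lemma consecutive_brackets_same_sign:
  assumes "Suc a < n"
  shows "fbracket k Y (z 0) (z 1) * fbracket k Y (z a) (z (Suc a)) > 0"
  using assms
proof (induction a)
  case 0
  then show ?case using first_bracket_nonzero by (auto simp: zero_less_mult_iff linorder_neq_iff)
next
  case (Suc a)
  let ?B = "fbracket k Y (z a) (z (Suc a))"
  have IH: "fbracket k Y (z 0) (z 1) * ?B > 0" using Suc by simp
  have B: "fbracket k Y (z (Suc a)) (z a) = - ?B" by (rule fbracket_swap)
  have "fbracket k Y (z (Suc a)) (z a) \<noteq> 0" using IH B by auto
  from bracket_row_neighbours[OF this] Suc.prems obtain \<sigma> where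
    \<sigma>: "\<sigma> * fbracket k Y (z (Suc a)) (z (Suc (Suc a))) > 0" "\<sigma> * fbracket k Y (z (Suc a)) (z a) < 0" by auto
  then show ?case using IH unfolding B by (auto simp: zero_less_mult_iff mult_less_0_iff)
qed

text \<open>
  For \<open>u = Z\<^sub>1\<close> the sequence starts with a zero, which may be put in front of any alternating list. This
  caps strict alternation at \<open>k + 1\<close> positions. It also forces the signs at both ends: were the second
  or the last value not of the sign of the nearest alternating position, it could be added to the list
  together with the leading zero.
\<close>

lemma first_row_sign_changes:
  shows "fbracket k Y (z 0) (z 1) * ((-1) ^ k * fbracket k Y (z 0) (z (n - 1))) > 0"
    and "k > 0 \<Longrightarrow> var (map (\<lambda>j. fbracket k Y (z 0) (z j)) [1..<n]) = k"
proof -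
  let ?w = "\<lambda>j. fbracket k Y (z 0) (z j)"
  note alt = bracket_row_alternates[OF first_bracket_nonzero]
  obtain s ps where ps: "s \<noteq> 0" "positions n ps" "length ps = Suc k" "strictly_alt s ?w ps" using alt(1) by blast
  have w0: "?w 0 = 0" by (rule fbracket_same)
  have pos: "p > 0" if "p \<in> set ps" for p using strictly_alt_nonzero[OF ps(4) that] w0 by (cases p) auto
  have psn: "p < n" if "p \<in> set ps" for p using ps(2) that by (auto simp: positions_def)
  have w1: "s * ?w 1 > 0"
  proof (rule ccontr)
    assume c: "\<not> ?thesis"
    have "1 < p" if p: "p \<in> set ps" for p
    proof (cases ps)
      case (Cons b bs)
      then have "b \<noteq> 1" using ps(4) c by auto
      then have "1 < b" using pos[of b] Cons by auto
      then show ?thesis using p ps(2) Cons by (auto simp: positions_def)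
    qed (use p in simp)
    then have "positions n (0 # 1 # ps)" using ps(2) kn pos by (auto simp: positions_def)
    moreover have "weakly_alt s ?w (0 # 1 # ps)" using c w0 strictly_alt_imp_weakly_alt[OF ps(4)] by auto
    ultimately show False using alt(2)[OF ps(1), of "0 # 1 # ps"] ps(3) by simp
  qed
  have wn: "(-1) ^ k * s * ?w (n - 1) > 0"
  proof (rule ccontr)
    assume c: "\<not> ?thesis"
    have "p < n - 1" if p: "p \<in> set ps" for p
    proof (cases ps rule: rev_cases)
      case (snoc bs b)
      then have "length bs = k" using ps(3) by simp
      then have "(-1) ^ k * s * ?w b > 0" using ps(4) snoc by (simp add: strictly_alt_append)
      then have "b \<noteq> n - 1" using c by auto
      then have "b < n - 1" using psn[of b] snoc by auto
      then show ?thesis using p ps(2) snoc by (auto simp: positions_def sorted_wrt_append)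
    qed (use p in simp)
    then have "positions n (0 # ps @ [n - 1])"
      using ps(2) kn pos by (auto simp: positions_def sorted_wrt_append)
    moreover have "weakly_alt (- s) ?w (0 # ps @ [n - 1])"
      using c w0 strictly_alt_imp_weakly_alt[OF ps(4)] by (auto simp: weakly_alt_append ps(3))
    ultimately show False using alt(2)[of "- s" "0 # ps @ [n - 1]"] ps(1,3) by simp
  qed
  from w1 wn have "s * s * (?w 1 * ((-1) ^ k * ?w (n - 1))) > 0"
    using mult_pos_pos[OF w1 wn] by (simp add: ac_simps)
  moreover have "s * s > 0" using ps(1) by (simp add: zero_less_mult_iff linorder_neq_iff disj_commute)
  ultimately show "?w 1 * ((-1) ^ k * ?w (n - 1)) > 0" using zero_less_mult_pos by blast
  show "var (map ?w [1..<n]) = k" if "k > 0"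
  proof (rule antisym)
    show "k \<le> var (map ?w [1..<n])"
      unfolding var_ge_iff[OF that] using ps pos psn
      by (intro exI[of _ s] exI[of _ ps]) (auto simp: positions_def Suc_le_eq)
    show "var (map ?w [1..<n]) \<le> k"
    proof (rule ccontr)
      assume "\<not> ?thesis"
      then have "Suc k \<le> var (map ?w [1..<n])" by simp
      then obtain t qs where qs: "t \<noteq> 0" "sorted_wrt (<) qs" "set qs \<subseteq> {1..<n}"
        "length qs = Suc (Suc k)" "strictly_alt t ?w qs"
        unfolding var_ge_iff[OF zero_less_Suc] by blast
      have "positions n (0 # qs)" using qs(2,3) kn by (auto simp: positions_def)
      moreover have "weakly_alt (- t) ?w (0 # qs)" using w0 strictly_alt_imp_weakly_alt[OF qs(5)] by simp
      ultimately show False using alt(2)[of "- t" "0 # qs"] qs(1,4) by simp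
    qed
  qed
qed

end

section \<open>A nonnegative matrix from sign flips\<close>

text \<open>
  An increasing self-map satisfies \<open>j \<le> p j\<close>, and a permutation preserves the sum of all indices.
\<close>

lemma strict_mono_permutation_id:
  fixes p :: "nat \<Rightarrow> nat"
  assumes p: "p permutes {0..<d}" and mono: "\<And>i j. i < j \<Longrightarrow> j < d \<Longrightarrow> p i < p j" and i: "i < d"
  shows "p i = i"
proof -
  have ge: "j \<le> p j" if "j < d" for j
    using that
  proof (induction j)
    case (Suc j)
    then show ?case using mono[of j "Suc j"] by simp
  qed simp
  have "(\<Sum>j\<in>{0..<d}. j) = (\<Sum>j\<in>{0..<d}. p j)"
    using sum.permute[OF p, of "\<lambda>j. j"] by (simp add: comp_def)
  then have "\<not> (\<exists>j\<in>{0..<d}. j < p j)"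
    using ge sum_strict_mono_ex1[of "{0..<d}" "\<lambda>j. j" p] by auto
  then show ?thesis using ge[OF i] i by (metis atLeastLessThan_iff le0 le_neq_implies_less)
qed

text \<open>
  Row \<open>a\<close> lives on columns in the interval from \<open>lo a\<close> to \<open>hi a\<close>, and the intervals follow each other with at most
  an endpoint in common. A permutation contributing to the determinant must therefore be increasing.
\<close>

lemma det_of_staircase:
  fixes f lo hi :: "nat \<Rightarrow> nat"
  assumes f: "\<And>i j. i < j \<Longrightarrow> j < d \<Longrightarrow> f i < f j"
    and support: "\<And>a b. a < d \<Longrightarrow> b < d \<Longrightarrow> R a b \<noteq> 0 \<Longrightarrow> lo a \<le> f b \<and> f b \<le> hi a"
    and steps: "\<And>a b. a < b \<Longrightarrow> b < d \<Longrightarrow> hi a \<le> lo b"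
  shows "detf d R = (\<Prod>i = 0..<d. R i i)"
proof -
  have zero: "(\<Prod>i = 0..<d. R i (p i)) = 0" if p: "p permutes {0..<d}" "p \<noteq> id" for p
  proof (rule ccontr)
    assume nz: "\<not> ?thesis"
    have pd: "p i < d" if "i < d" for i using permutes_in_image[OF p(1), of i] that by simp
    have "p i < p j" if ij: "i < j" "j < d" for i j
    proof -
      have "R i (p i) \<noteq> 0" "R j (p j) \<noteq> 0" using nz ij by auto
      then have "f (p i) \<le> hi i" "lo j \<le> f (p j)" using support pd ij by (metis less_trans)+
      then have "f (p i) \<le> f (p j)" using steps[OF ij] by simp
      then have "\<not> p j < p i" using f[of "p j" "p i"] pd[of i] ij by fastforce
      moreover have "p i \<noteq> p j" using permutes_inj[OF p(1)] ij(1) by (metis injD nat_neq_iff)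
      ultimately show ?thesis by simp
    qed
    then have "p i = i" if "i < d" for i using strict_mono_permutation_id[OF p(1)] that by blast
    then have "p = id" using p(1) by (auto simp: permutes_def fun_eq_iff)
    then show False using p(2) by simp
  qed
  have "detf d R = (\<Sum>p\<in>{id}. signof p * (\<Prod>i = 0..<d. R i (p i)))"
    unfolding detf_permutes
    by (rule sum.mono_neutral_right) (auto simp: zero permutes_id finite_permutations)
  then show ?thesis by simp
qed

lemma detf_laplace_first_col:
  "detf (Suc d) A =
     (\<Sum>j\<le>d. (-1) ^ j * A j 0 * detf d (\<lambda>i l. A (if i < j then i else Suc i) (Suc l)))"
proof -
  have "detf (Suc d) A = detf (Suc d) (\<lambda>i j. A j i)" by (rule detf_transpose[symmetric])
  also have "\<dots> = (\<Sum>j\<le>d. (-1) ^ j * A j 0 * detf d (\<lambda>i l. A (if l < j then l else Suc l) (Suc i)))"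
    by (rule detf_laplace_first_row)
  also have "\<dots> = (\<Sum>j\<le>d. (-1) ^ j * A j 0 * detf d (\<lambda>i l. A (if i < j then i else Suc i) (Suc l)))"
  proof (rule sum.cong)
    fix j
    show "(-1) ^ j * A j 0 * detf d (\<lambda>i l. A (if l < j then l else Suc l) (Suc i)) =
        (-1) ^ j * A j 0 * detf d (\<lambda>i l. A (if i < j then i else Suc i) (Suc l))"
      using detf_transpose[of d "\<lambda>i l. A (if i < j then i else Suc i) (Suc l)"] by simp
  qed simp
  finally show ?thesis .
qed

lemma discrete_crossing:
  fixes x y :: nat
  assumes "x < y" "P x" "\<not> P y"
  shows "\<exists>i. x \<le> i \<and> i < y \<and> P i \<and> \<not> P (Suc i)"
  using assms
proof (induction y)
  case (Suc y)
  show ?case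
  proof (cases "P y")
    case True
    then show ?thesis using Suc.prems by (intro exI[of _ y]) auto
  next
    case False
    then have "x < y" using Suc.prems by (metis less_antisym)
    then show ?thesis using Suc.IH Suc.prems(2) False less_SucI by blast
  qed
qed simp

text \<open>
  Between two consecutive alternating positions choose a place where the sign required at the first of
  them is present but is lost at the next index. As \<open>w 1 > 0\<close>, the alternation has to start with a positive
  sign: otherwise position \<open>1\<close> could be added in front, giving one sign change too many.
\<close>

lemma sign_flip_rows:
  fixes w :: "nat \<Rightarrow> real"
  assumes k: "k > 0" and w1: "w 1 > 0" and n: "1 < n" and var: "var (map w [1..<n]) = k"
  shows "\<exists>I. (\<forall>a<k. 1 \<le> I a \<and> Suc (I a) < n \<and> (-1) ^ a * w (I a) > 0 \<and> (-1) ^ a * w (Suc (I a)) \<le> 0) \<and>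
             (\<forall>a b. a < b \<longrightarrow> b < k \<longrightarrow> Suc (I a) \<le> I b)"
proof -
  obtain s ps where ps: "s \<noteq> 0" "sorted_wrt (<) ps" "set ps \<subseteq> {1..<n}" "length ps = Suc k" "strictly_alt s w ps"
    using var_ge_iff[OF k, of w 1 n] var by auto
  have "s > 0"
  proof (rule ccontr)
    assume "\<not> s > 0"
    then have s: "s < 0" using ps(1) by simp
    obtain b bs where b: "ps = b # bs" using ps(4) by (cases ps) auto
    then have "b \<noteq> 1" using ps(5) s w1 by (auto simp: zero_less_mult_iff)
    then have "sorted_wrt (<) (1 # ps)" using ps(2,3) b by (auto simp: less_le)
    moreover have "strictly_alt (- s) w (1 # ps)" using ps(5) s w1 by (simp add: mult_neg_pos)
    moreover have "set (1 # ps) \<subseteq> {1..<n}" using ps(3) n by auto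
    ultimately have "Suc k \<le> var (map w [1..<n])"
      unfolding var_ge_iff[OF zero_less_Suc] using ps(1,4)
      by (intro exI[of _ "- s"] exI[of _ "1 # ps"]) auto
    then show False using var by simp
  qed
  then have sg: "(-1) ^ a * w (ps ! a) > 0" if "a \<le> k" for a
    using ps(4,5) that unfolding strictly_alt_nth by (auto simp: zero_less_mult_iff mult.assoc mult.left_commute[of _ s])
  have mono: "ps ! a < ps ! b" if "a < b" "b \<le> k" for a b
    using ps(2,4) that by (auto simp: sorted_wrt_iff_nth_less)
  have rng: "1 \<le> ps ! a" "ps ! a < n" if "a \<le> k" for a
    using ps(3,4) that nth_mem[of a ps] by fastforce+
  have "\<exists>i. ps ! a \<le> i \<and> i < ps ! Suc a \<and> (-1) ^ a * w i > 0 \<and> \<not> (-1) ^ a * w (Suc i) > 0" if a: "a < k" for a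
    using discrete_crossing[of "ps ! a" "ps ! Suc a" "\<lambda>i. (-1) ^ a * w i > 0"] sg[of a] sg[of "Suc a"] mono[of a "Suc a"] a
    by auto
  then obtain I where I: "\<And>a. a < k \<Longrightarrow> ps ! a \<le> I a \<and> I a < ps ! Suc a \<and> (-1) ^ a * w (I a) > 0 \<and> \<not> (-1) ^ a * w (Suc (I a)) > 0"
    by metis
  have "1 \<le> I a \<and> Suc (I a) < n \<and> (-1) ^ a * w (I a) > 0 \<and> (-1) ^ a * w (Suc (I a)) \<le> 0" if a: "a < k" for a
    using I[OF a] rng[of a] rng[of "Suc a"] a by auto
  moreover have "Suc (I a) \<le> I b" if ab: "a < b" "b < k" for a b
  proof -
    have "ps ! Suc a \<le> ps ! b" using mono[of "Suc a" b] ab by (cases "Suc a = b") auto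
    then show ?thesis using I[of a] I[OF ab(2)] ab by simp
  qed
  ultimately show ?thesis by blast
qed

text \<open>
  Row \<open>a\<close> of \<open>C\<close> holds, up to the sign \<open>(-1)\<^sup>a\<close>, the coefficients of the combination of \<open>Z\<^sub>1\<close>, \<open>Z\<^sub>i\<close>, \<open>Z\<^sub>i\<^sub>+\<^sub>1\<close> that lies in
  \<open>Y\<close>, where \<open>i\<close> is the place of the \<open>a\<close>-th flip. With this sign the entries off the first
  column are nonnegative and form a staircase, so minors without the first column are products of nonnegative
  entries. The first column itself alternates in sign, which is exactly cancelled by the signs of
  the Laplace expansion along it.
\<close>

lemma sign_flip_matrix:
  fixes z Y :: "nat \<Rightarrow> nat \<Rightarrow> real"
  assumes k: "k > 0" and n: "1 < n"
    and pos: "\<And>i. Suc i < n \<Longrightarrow> fbracket k Y (z i) (z (Suc i)) > 0"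
    and var: "var (map (\<lambda>j. fbracket k Y (z 0) (z j)) [1..<n]) = k"
  shows "\<exists>C. TNN k n C \<and> indep_rows k n C \<and>
     (\<forall>a<k. \<exists>x. \<forall>l<k + 2. (\<Sum>j<n. C a j * z j l) = (\<Sum>i<k. x i * Y i l))"
proof -
  let ?w = "\<lambda>j. fbracket k Y (z 0) (z j)"
  have w1: "?w 1 > 0" using pos[of 0] n by simp
  obtain I where I: "\<And>a. a < k \<Longrightarrow> 1 \<le> I a" "\<And>a. a < k \<Longrightarrow> Suc (I a) < n"
    "\<And>a. a < k \<Longrightarrow> (-1) ^ a * ?w (I a) > 0" "\<And>a. a < k \<Longrightarrow> (-1) ^ a * ?w (Suc (I a)) \<le> 0"
    "\<And>a b. a < b \<Longrightarrow> b < k \<Longrightarrow> Suc (I a) \<le> I b"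
    using sign_flip_rows[OF k w1 n var] by blast
  define C where "C = (\<lambda>a j. (-1) ^ a * (if j = 0 then fbracket k Y (z (I a)) (z (Suc (I a)))
      else if j = I a then - ?w (Suc (I a)) else if j = Suc (I a) then ?w (I a) else 0))"
  have C0: "(-1) ^ a * C a 0 > 0" if "a < k" for a
  proof -
    have "(-1) ^ a * C a 0 = fbracket k Y (z (I a)) (z (Suc (I a)))" by (simp add: C_def mult.assoc[symmetric] power_mult_distrib[symmetric])
    then show ?thesis using pos I(2)[OF that] by simp
  qed
  have Cnn: "C a j \<ge> 0" if "a < k" "j > 0" for a j
    using I(3,4)[OF that(1)] that(2) by (auto simp: C_def)
  have Csupp: "I a \<le> j \<and> j \<le> Suc (I a)" if "C a j \<noteq> 0" "j > 0" for a j
    using that by (auto simp: C_def split: if_splits)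
  have stair: "detf m (\<lambda>a b. C (g a) (f b)) = (\<Prod>a = 0..<m. C (g a) (f a))"
    if f: "\<And>i j. i < j \<Longrightarrow> j < m \<Longrightarrow> f i < f j" "\<And>i. i < m \<Longrightarrow> f i > 0"
      and g: "\<And>i j. i < j \<Longrightarrow> j < m \<Longrightarrow> g i < g j" "\<And>i. i < m \<Longrightarrow> g i < k" for m f and g :: "nat \<Rightarrow> nat"
  proof (rule det_of_staircase[where f = f and lo = "\<lambda>a. I (g a)" and hi = "\<lambda>a. Suc (I (g a))"])
    show "f i < f j" if "i < j" "j < m" for i j using f(1) that .
    show "I (g a) \<le> f b \<and> f b \<le> Suc (I (g a))" if "b < m" "C (g a) (f b) \<noteq> 0" for a b
      using Csupp[OF that(2) f(2)[OF that(1)]] .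
    show "Suc (I (g a)) \<le> I (g b)" if "a < b" "b < m" for a b
      using I(5)[OF g(1)[OF that] g(2)[OF that(2)]] .
  qed
  have "TNN k n C"
    unfolding TNN_def
  proof
    fix f assume f: "f \<in> sorted_maps k n"
    then have fm: "f i < f j" if "i < j" "j < k" for i j
      using that by (auto simp: sorted_maps_def strict_mono_on_def)
    show "0 \<le> detf k (\<lambda>i j. C i (f j))"
    proof (cases "f 0 = 0")
      case False
      have f0: "f i > 0" if "i < k" for i using fm[of 0 i] that False by (cases i) auto
      have "detf k (\<lambda>i j. C i (f j)) = (\<Prod>a = 0..<k. C a (f a))"
        using stair[of k f "\<lambda>a. a"] fm f0 by simp
      then show ?thesis using Cnn f0 by (auto intro!: prod_nonneg)
    next
      case True
      obtain d where d: "k = Suc d" using k by (cases k) auto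
      have f0: "f (Suc i) > 0" if "i < d" for i using fm[of 0 "Suc i"] that d by auto
      have "detf d (\<lambda>i l. C (if i < j then i else Suc i) (f (Suc l))) \<ge> 0" if "j \<le> d" for j
      proof -
        have "detf d (\<lambda>i l. C (if i < j then i else Suc i) (f (Suc l))) =
            (\<Prod>a = 0..<d. C (if a < j then a else Suc a) (f (Suc a)))"
          by (rule stair[of d "\<lambda>l. f (Suc l)" "\<lambda>i. if i < j then i else Suc i"])
             (use fm f0 d in auto)
        then show ?thesis using Cnn f0 d by (auto intro!: prod_nonneg)
      qed
      moreover have "(-1) ^ j * C j (f 0) \<ge> 0" if "j \<le> d" for j using C0[of j] that d True by auto
      ultimately have "(-1) ^ j * C j (f 0) * detf d (\<lambda>i l. C (if i < j then i else Suc i) (f (Suc l))) \<ge> 0"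
        if "j \<le> d" for j using mult_nonneg_nonneg that by blast
      then show ?thesis unfolding d detf_laplace_first_col by (intro sum_nonneg) auto
    qed
  qed
  moreover have "indep_rows k n C"
    unfolding indep_rows_def
  proof (intro allI impI)
    fix x i assume x: "\<forall>j<n. (\<Sum>i<k. x i * C i j) = 0" "i < k"
    \<comment> \<open>The entries \<open>C a (I a)\<close> may vanish, the entries one step to the right are positive.\<close>
    have "detf k (\<lambda>a b. C a (Suc (I b))) = (\<Prod>a = 0..<k. C a (Suc (I a)))"
      by (rule stair[of k "\<lambda>b. Suc (I b)" "\<lambda>a. a"]) (use I(5) in \<open>auto simp: Suc_le_eq\<close>)
    moreover have "C a (Suc (I a)) > 0" if "a < k" for a using I(3)[OF that] by (simp add: C_def)
    ultimately have "detf k (\<lambda>a b. C a (Suc (I b))) > 0" by (auto intro!: prod_pos)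
    then have "\<not> (\<exists>x. (\<exists>i<k. x i \<noteq> 0) \<and> (\<forall>j<k. (\<Sum>i<k. x i * C i (Suc (I j))) = 0))"
      using detf_eq_0_iff[of k "\<lambda>a b. C a (Suc (I b))"] by simp
    then show "x i = 0" using x I(2) by blast
  qed
  moreover have "\<exists>x. \<forall>l<k + 2. (\<Sum>j<n. C a j * z j l) = (\<Sum>i<k. x i * Y i l)" if a: "a < k" for a
  proof -
    let ?i = "I a"
    have i: "0 < ?i" "Suc ?i < n" using I(1,2)[OF a] by auto
    obtain x where x: "\<And>l. l < k + 2 \<Longrightarrow> fbracket k Y (z ?i) (z (Suc ?i)) * z 0 l - ?w (Suc ?i) * z ?i l + ?w ?i * z (Suc ?i) l
        = (\<Sum>i<k. x i * Y i l)"
      using three_term_combination_in_row_span[of k Y "z 0" "z 1" "z ?i" "z (Suc ?i)"] w1 by fastforce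
    have "(\<Sum>j<n. C a j * z j l) = (\<Sum>i<k. ((-1) ^ a * x i) * Y i l)" if l: "l < k + 2" for l
    proof -
      have "(\<Sum>j<n. C a j * z j l) = (\<Sum>j\<in>{0, ?i, Suc ?i}. C a j * z j l)"
        by (rule sum.mono_neutral_right) (use i in \<open>auto simp: C_def\<close>)
      also have "\<dots> = (-1) ^ a * (fbracket k Y (z ?i) (z (Suc ?i)) * z 0 l - ?w (Suc ?i) * z ?i l + ?w ?i * z (Suc ?i) l)"
        using i by (simp add: C_def algebra_simps)
      also have "\<dots> = (\<Sum>i<k. ((-1) ^ a * x i) * Y i l)"
        unfolding x[OF l] sum_distrib_left by (simp add: mult.assoc)
      finally show ?thesis .
    qed
    then show ?thesis by (intro exI[of _ "\<lambda>i. (-1) ^ a * x i"]) blast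
  qed
  ultimately show ?thesis by blast
qed

text \<open>
  This condition is closed and holds on totally nonnegative subspaces of dimension \<open>k\<close>.
\<close>

definition nonalternating :: "nat \<Rightarrow> nat \<Rightarrow> (nat \<Rightarrow> real) \<Rightarrow> bool" where
  "nonalternating k n v \<longleftrightarrow>
     (\<forall>s ps. s \<noteq> 0 \<longrightarrow> positions n ps \<longrightarrow> length ps = Suc k \<longrightarrow> \<not> strictly_alt s v ps)"

lemma nonalternating_kernel_trivial:
  assumes TP: "TP (k + 2) n (\<lambda>l j. z j l)" and kn: "k + 2 \<le> n"
    and v: "nonalternating k n v" and ker: "\<And>l. l < k + 2 \<Longrightarrow> (\<Sum>j<n. z j l * v j) = 0" and j: "j < n"
  shows "v j = 0"
proof (rule ccontr)
  assume "v j \<noteq> 0"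
  then have "\<exists>j<n. v j \<noteq> 0" using j by blast
  from kernel_vector_alternates[OF TP kn this ker] obtain s ps where
    ps: "s \<noteq> 0" "positions n ps" "length ps = Suc (k + 2)" "strictly_alt s v ps" by blast
  have "positions n (take (Suc k) ps)"
    using ps(2) unfolding positions_def by (auto dest: in_set_takeD intro: sorted_wrt_take)
  moreover have "strictly_alt s v (take (Suc k) ps)" using ps(4) unfolding strictly_alt_nth by auto
  ultimately show False using v ps(1,3) unfolding nonalternating_def by auto
qed

lemma product_indep_rows:
  assumes TP: "TP (k + 2) n (\<lambda>l j. z j l)" and kn: "k + 2 \<le> n"
    and C: "TNN k n C" "indep_rows k n C"
  shows "indep_rows k (k + 2) (\<lambda>i l. \<Sum>j<n. C i j * z j l)"
  unfolding indep_rows_def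
proof (intro allI impI)
  fix x i assume x: "\<forall>l<k + 2. (\<Sum>i<k. x i * (\<Sum>j<n. C i j * z j l)) = 0" and i: "i < k"
  let ?v = "\<lambda>j. \<Sum>i<k. x i * C i j"
  have "nonalternating k n ?v"
    unfolding nonalternating_def using TNN_row_combination_not_alternating[OF C, of ?v x] by blast
  moreover have "(\<Sum>j<n. z j l * ?v j) = 0" if "l < k + 2" for l
  proof -
    have "(\<Sum>j<n. z j l * ?v j) = (\<Sum>i<k. x i * (\<Sum>j<n. C i j * z j l))"
      unfolding sum_distrib_left by (subst sum.swap) (simp add: ac_simps)
    then show ?thesis using x that by simp
  qed
  ultimately have "\<forall>j<n. ?v j = 0" using nonalternating_kernel_trivial[OF TP kn, of ?v] by blast
  then show "x i = 0" using C(2) i unfolding indep_rows_def by blast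
qed

lemma bounded_pointwise_subsequence:
  fixes x :: "nat \<Rightarrow> 'i \<Rightarrow> real"
  assumes "finite I" "\<And>m i. i \<in> I \<Longrightarrow> \<bar>x m i\<bar> \<le> B"
  shows "\<exists>r l. strict_mono (r :: nat \<Rightarrow> nat) \<and> (\<forall>i\<in>I. (\<lambda>m. x (r m) i) \<longlonglongrightarrow> l i)"
  using assms
proof (induction I)
  case empty
  then show ?case by (intro exI[of _ id]) (auto simp: strict_mono_def)
next
  case (insert i I)
  have "\<exists>r l. strict_mono (r :: nat \<Rightarrow> nat) \<and> (\<forall>i\<in>I. (\<lambda>m. x (r m) i) \<longlonglongrightarrow> l i)"
    by (rule insert.IH) (use insert.prems in simp)
  then obtain r l where r: "strict_mono (r :: nat \<Rightarrow> nat)" "\<forall>i\<in>I. (\<lambda>m. x (r m) i) \<longlonglongrightarrow> l i"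
    by (elim exE conjE)
  have "x (r m) i \<in> {-B..B}" for m using insert.prems[of i "r m"] by (auto simp: abs_le_iff)
  then have "\<forall>m. x (r m) i \<in> {-B..B}" by blast
  then obtain li r' where r': "strict_mono (r' :: nat \<Rightarrow> nat)" "((\<lambda>m. x (r m) i) \<circ> r') \<longlonglongrightarrow> li"
    by (rule seq_compactE[OF compact_imp_seq_compact[OF compact_Icc]])
  have "(\<lambda>m. x ((r \<circ> r') m) i') \<longlonglongrightarrow> (l(i := li)) i'" if "i' \<in> insert i I" for i'
  proof (cases "i' = i")
    case True
    then show ?thesis using r'(2) by (simp add: comp_def)
  next
    case False
    then show ?thesis using that LIMSEQ_subseq_LIMSEQ[OF r(2)[rule_format, of i'] r'(1)] by (simp add: comp_def)
  qed
  then show ?case using strict_mono_o[OF r(1) r'(1)] by blast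
qed

lemma strictly_alt_divide: "c > 0 \<Longrightarrow> strictly_alt s (\<lambda>j. v j / c) ps \<longleftrightarrow> strictly_alt s v ps"
  by (induction ps arbitrary: s) (auto simp: zero_less_mult_iff zero_less_divide_iff divide_less_0_iff)

text \<open>
  Compactness: if \<open>v\<close> were unbounded while \<open>v Z\<close> stays bounded, the normalised vectors would have a limit point
  that is nonalternating, nonzero and annihilated by \<open>Z\<close>.
\<close>

lemma nonalternating_bounded:
  assumes TP: "TP (k + 2) n (\<lambda>l j. z j l)" and kn: "k + 2 \<le> n"
  shows "\<exists>B. \<forall>v. nonalternating k n v \<longrightarrow> (\<forall>l<k + 2. \<bar>\<Sum>j<n. z j l * v j\<bar> \<le> 1) \<longrightarrow> (\<forall>j<n. \<bar>v j\<bar> \<le> B)"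
proof (rule ccontr)
  assume "\<not> ?thesis"
  then have "\<forall>m. \<exists>v. nonalternating k n v \<and> (\<forall>l<k + 2. \<bar>\<Sum>j<n. z j l * v j\<bar> \<le> 1) \<and> (\<exists>j<n. \<not> \<bar>v j\<bar> \<le> real (Suc m))"
    by blast
  then obtain v where v: "\<And>m. nonalternating k n (v m)" "\<And>m l. l < k + 2 \<Longrightarrow> \<bar>\<Sum>j<n. z j l * v m j\<bar> \<le> 1"
    "\<And>m. \<exists>j<n. \<not> \<bar>v m j\<bar> \<le> real (Suc m)" by metis
  define S where "S m = (\<Sum>j<n. \<bar>v m j\<bar>)" for m
  have le_S: "\<bar>v m j\<bar> \<le> S m" if "j < n" for m j unfolding S_def using that by (auto intro!: member_le_sum)
  have S: "S m > real (Suc m)" for m using v(3)[of m] le_S[of _ m] by force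
  have S0: "S m > 0" for m using S[of m] by (meson less_trans of_nat_0_less_iff zero_less_Suc)
  define u where "u m j = v m j / S m" for m j
  have "\<bar>u m j\<bar> \<le> 1" if "j \<in> {..<n}" for m j
    using le_S[of j m] S0[of m] that by (simp add: u_def abs_divide)
  then have "\<exists>r l. strict_mono (r :: nat \<Rightarrow> nat) \<and> (\<forall>j\<in>{..<n}. (\<lambda>m. u (r m) j) \<longlonglongrightarrow> l j)"
    by (rule bounded_pointwise_subsequence[OF finite_lessThan])
  then obtain r l where r: "strict_mono (r :: nat \<Rightarrow> nat)" "\<forall>j\<in>{..<n}. (\<lambda>m. u (r m) j) \<longlonglongrightarrow> l j"
    by (elim exE conjE)
  have "(\<Sum>j<n. \<bar>u m j\<bar>) = 1" for m
    using S0[of m] unfolding u_def abs_divide sum_divide_distrib[symmetric] by (simp add: S_def)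
  then have "(\<lambda>m. \<Sum>j<n. \<bar>u (r m) j\<bar>) \<longlonglongrightarrow> 1" by simp
  moreover have "(\<lambda>m. \<Sum>j<n. \<bar>u (r m) j\<bar>) \<longlonglongrightarrow> (\<Sum>j<n. \<bar>l j\<bar>)"
    by (intro tendsto_sum tendsto_rabs) (simp add: r)
  ultimately have l1: "(\<Sum>j<n. \<bar>l j\<bar>) = 1" using LIMSEQ_unique by blast
  have ker: "(\<Sum>j<n. z j i * l j) = 0" if i: "i < k + 2" for i
  proof -
    have "(\<lambda>m. \<Sum>j<n. z j i * u (r m) j) \<longlonglongrightarrow> (\<Sum>j<n. z j i * l j)"
      by (intro tendsto_sum tendsto_mult_left) (simp add: r)
    moreover have "(\<lambda>m. \<Sum>j<n. z j i * u (r m) j) \<longlonglongrightarrow> 0"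
    proof (rule Lim_null_comparison[OF _ LIMSEQ_inverse_real_of_nat])
      have "norm (\<Sum>j<n. z j i * u (r m) j) \<le> inverse (real (Suc m))" for m
      proof -
        have "(\<Sum>j<n. z j i * u (r m) j) = (\<Sum>j<n. z j i * v (r m) j) / S (r m)"
          unfolding u_def sum_divide_distrib by simp
        then have "norm (\<Sum>j<n. z j i * u (r m) j) = \<bar>\<Sum>j<n. z j i * v (r m) j\<bar> / S (r m)"
          using S0[of "r m"] by (simp add: abs_divide)
        also have "\<dots> \<le> 1 / S (r m)" using v(2)[OF i, of "r m"] S0[of "r m"] by (simp add: divide_right_mono)
        also have "\<dots> \<le> 1 / real (Suc m)"
        proof (rule divide_left_mono)
          have "real (Suc m) \<le> real (Suc (r m))" using seq_suble[OF r(1), of m] by simp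
          then show "real (Suc m) \<le> S (r m)" using S[of "r m"] by linarith
        qed (use S0[of "r m"] in auto)
        finally show ?thesis by (simp add: inverse_eq_divide)
      qed
      then show "eventually (\<lambda>m. norm (\<Sum>j<n. z j i * u (r m) j) \<le> inverse (real (Suc m))) sequentially"
        by simp
    qed
    ultimately show ?thesis by (rule LIMSEQ_unique)
  qed
  have "nonalternating k n l"
    unfolding nonalternating_def
  proof (intro allI impI notI)
    fix s ps assume ps: "s \<noteq> 0" "positions n ps" "length ps = Suc k" "strictly_alt s l ps"
    have "eventually (\<lambda>m. strictly_alt s (u (r m)) ps) sequentially"
      by (rule eventually_strictly_alt[OF _ ps(4)]) (use r(2) ps(2) in \<open>auto simp: positions_def\<close>)
    then obtain m where "strictly_alt s (u (r m)) ps" by (auto simp: eventually_sequentially)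
    then have "strictly_alt s (v (r m)) ps" using strictly_alt_divide[OF S0[of "r m"]] unfolding u_def by blast
    then show False using v(1)[of "r m"] ps unfolding nonalternating_def by blast
  qed
  from nonalternating_kernel_trivial[OF TP kn this ker] have "l j = 0" if "j < n" for j using that by blast
  then show False using l1 by simp
qed

section \<open>Matrices, row spans and their topology\<close>

lemma pick_image_strict_mono:
  assumes f: "strict_mono_on {..<k} f" and j: "j < k"
  shows "pick (f ` {..<k}) j = f j"
proof -
  have inj: "inj_on f {..<k}" using f by (rule strict_mono_on_imp_inj_on)
  have "{a \<in> f ` {..<k}. a < f j} = f ` {..<j}"
  proof (intro equalityI subsetI)
    fix a assume "a \<in> {a \<in> f ` {..<k}. a < f j}"
    then obtain i where i: "i < k" "a = f i" "f i < f j" by auto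
    then have "i < j" using strict_mono_onD[OF f, of j i] j by (metis lessThan_iff not_less_iff_gr_or_eq)
    then show "a \<in> f ` {..<j}" using i by auto
  qed (use strict_mono_onD[OF f] j in auto)
  then have "card {a \<in> f ` {..<k}. a < f j} = j"
    using inj j by (simp add: card_image inj_on_subset)
  then show ?thesis using pick_card_in_set[of "f j" "f ` {..<k}"] j by auto
qed

lemma det_submatrix_columns:
  assumes C: "C \<in> carrier_mat k n" and J: "J \<subseteq> {..<n}" "card J = k"
  shows "Determinant.det (submatrix C UNIV J) = detf k (\<lambda>i j. C $$ (i, pick J j))"
proof -
  have "{j. j < dim_col C \<and> j \<in> J} = J" "{i. i < dim_row C \<and> i \<in> UNIV} = {..<k}" using C J by auto
  then have "submatrix C UNIV J = Matrix.mat k k (\<lambda>(i, j). C $$ (i, pick J j))"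
    unfolding submatrix_def using J by (auto simp: pick_UNIV)
  then show ?thesis unfolding detf_def by simp
qed

lemma det_submatrix_rows:
  assumes Z: "Z \<in> carrier_mat n p" and I: "I \<subseteq> {..<n}" "card I = p"
  shows "Determinant.det (submatrix Z I UNIV) = detf p (\<lambda>l j. Z $$ (pick I j, l))"
proof -
  have "{i. i < dim_row Z \<and> i \<in> I} = I" "{j. j < dim_col Z \<and> j \<in> UNIV} = {..<p}" using Z I by auto
  then have "submatrix Z I UNIV = Matrix.mat p p (\<lambda>(i, j). Z $$ (pick I i, j))"
    unfolding submatrix_def using I by (auto simp: pick_UNIV)
  then have "Determinant.det (submatrix Z I UNIV) = detf p (\<lambda>j l. Z $$ (pick I j, l))" unfolding detf_def by simp
  then show ?thesis using detf_transpose[of p "\<lambda>l j. Z $$ (pick I j, l)"] by simp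
qed

lemma sorted_maps_image:
  assumes "f \<in> sorted_maps k n"
  shows "strict_mono_on {..<k} f" "f ` {..<k} \<subseteq> {..<n}" "card (f ` {..<k}) = k"
  using assms strict_mono_on_imp_inj_on[of "{..<k}" f] by (auto simp: sorted_maps_def card_image)

lemma pick_strict_mono:
  assumes "finite J" "card J = k"
  shows "strict_mono_on {..<k} (pick J)"
  using assms pick_mono_le[of _ J] by (intro strict_mono_onI) auto

lemma TNN_iff_submatrix:
  assumes C: "C \<in> carrier_mat k n"
  shows "TNN k n (\<lambda>i j. C $$ (i, j)) \<longleftrightarrow>
    (\<forall>J \<subseteq> {..<n}. card J = k \<longrightarrow> Determinant.det (submatrix C UNIV J) \<ge> 0)"
proof (intro iffI allI impI)
  fix J assume T: "TNN k n (\<lambda>i j. C $$ (i, j))" and J: "J \<subseteq> {..<n}" "card J = k"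
  have fin: "finite J" using J(1) finite_subset by blast
  have "pick J j < n" if "j < k" for j using pick_in_set_le[of j J] J that by auto
  then show "Determinant.det (submatrix C UNIV J) \<ge> 0"
    unfolding det_submatrix_columns[OF C J]
    using TNN_minor_nonneg[OF T pick_strict_mono[OF fin J(2)]] by blast
next
  assume *: "\<forall>J \<subseteq> {..<n}. card J = k \<longrightarrow> Determinant.det (submatrix C UNIV J) \<ge> 0"
  show "TNN k n (\<lambda>i j. C $$ (i, j))"
    unfolding TNN_def
  proof
    fix f assume "f \<in> sorted_maps k n"
    note f = sorted_maps_image[OF this]
    have "detf k (\<lambda>i j. C $$ (i, pick (f ` {..<k}) j)) \<ge> 0"
      unfolding det_submatrix_columns[OF C f(2,3), symmetric] using * f(2,3) by blast
    then show "0 \<le> detf k (\<lambda>i j. C $$ (i, f j))"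
      using detf_cong[of k "\<lambda>i j. C $$ (i, pick (f ` {..<k}) j)" "\<lambda>i j. C $$ (i, f j)"]
        pick_image_strict_mono[OF f(1)] by simp
  qed
qed

lemma Mat_pos_TP:
  assumes "Z \<in> Mat_pos n p"
  shows "TP p n (\<lambda>l j. Z $$ (j, l))"
  unfolding TP_def
proof
  have Z: "Z \<in> carrier_mat n p" using assms by (simp add: Mat_pos_def)
  fix f assume "f \<in> sorted_maps p n"
  note f = sorted_maps_image[OF this]
  have "detf p (\<lambda>l j. Z $$ (pick (f ` {..<p}) j, l)) > 0"
    unfolding det_submatrix_rows[OF Z f(2,3), symmetric] using assms f(2,3) unfolding Mat_pos_def by blast
  then show "0 < detf p (\<lambda>l j. Z $$ (f j, l))"
    using detf_cong[of p "\<lambda>l j. Z $$ (pick (f ` {..<p}) j, l)" "\<lambda>l j. Z $$ (f j, l)"]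
      pick_image_strict_mono[OF f(1)] by simp
qed

lemma rowspan_eq_combinations:
  assumes A: "A \<in> carrier_mat d m"
  shows "rowspan m A = {Matrix.vec m (\<lambda>j. \<Sum>i<d. x i * A $$ (i, j)) | x. True}"
proof -
  have *: "transpose_mat A *\<^sub>v y = Matrix.vec m (\<lambda>j. \<Sum>i<d. vec_index y i * A $$ (i, j))"
    if "y \<in> carrier_vec d" for y
    using that A by (intro eq_vecI) (auto simp: scalar_prod_def lessThan_atLeast0 mult.commute)
  have "rowspan m A = (\<lambda>y. transpose_mat A *\<^sub>v y) ` carrier_vec d"
    unfolding vec_space.row_space_eq[OF A] using A by (auto intro!: mult_mat_vec_carrier[of _ m d])
  also have "\<dots> = {Matrix.vec m (\<lambda>j. \<Sum>i<d. x i * A $$ (i, j)) | x. True}"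
  proof (intro equalityI subsetI)
    fix v assume "v \<in> {Matrix.vec m (\<lambda>j. \<Sum>i<d. x i * A $$ (i, j)) | x. True}"
    then obtain x where "v = Matrix.vec m (\<lambda>j. \<Sum>i<d. x i * A $$ (i, j))" by blast
    then have "v = transpose_mat A *\<^sub>v Matrix.vec d x" by (subst *) (auto intro!: eq_vecI)
    then show "v \<in> (\<lambda>y. transpose_mat A *\<^sub>v y) ` carrier_vec d" by auto
  qed (use * in auto)
  finally show ?thesis .
qed

lemma indep_rows_cong:
  assumes "\<And>i j. i < d \<Longrightarrow> j < m \<Longrightarrow> M i j = M' i j"
  shows "indep_rows d m M \<longleftrightarrow> indep_rows d m M'"
proof -
  have "(\<Sum>i<d. x i * M i j) = (\<Sum>i<d. x i * M' i j)" if "j < m" for x j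
    using assms that by (intro sum.cong) auto
  then show ?thesis unfolding indep_rows_def by auto
qed

text \<open>
  The rank of the definition is the dimension of a column space spanned by a set of columns, so
  repeated rows of \<open>A\<close> have to be excluded first.
\<close>

lemma full_rank_iff_indep_rows:
  "A \<in> full_rank_mats d m \<longleftrightarrow> A \<in> carrier_mat d m \<and> indep_rows d m (\<lambda>i j. A $$ (i, j))"
proof -
  interpret vec_space "TYPE(real)" m .
  have "rank (transpose_mat A) = d \<longleftrightarrow> indep_rows d m (\<lambda>i j. A $$ (i, j))" if A: "A \<in> carrier_mat d m"
  proof -
    let ?T = "transpose_mat A"
    have T: "?T \<in> carrier_mat m d" using A by simp
    have mv: "?T *\<^sub>v v = 0\<^sub>v m \<longleftrightarrow> (\<forall>j<m. (\<Sum>i<d. vec_index v i * A $$ (i, j)) = 0)"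
      if "v \<in> carrier_vec d" for v
      using that A unfolding vec_eq_iff by (auto simp: scalar_prod_def lessThan_atLeast0 mult.commute)
    show ?thesis
    proof
      assume r: "rank ?T = d"
      have dist: "distinct (cols ?T)"
      proof (rule ccontr)
        assume "\<not> distinct (cols ?T)"
        then have lt: "card (set (cols ?T)) < d"
          using T cols_length[of ?T] card_length[of "cols ?T"] card_distinct[of "cols ?T"] by fastforce
        obtain S where S: "maximal S (\<lambda>T'. T' \<subseteq> set (cols ?T) \<and> lin_indpt T')"
          using maximal_exists[of "\<lambda>T'. T' \<subseteq> set (cols ?T) \<and> lin_indpt T'" "card (set (cols ?T))" "{}"]
          by (meson List.finite_set card_mono empty_iff empty_subsetI finite_lin_indpt2 rev_finite_subset)
        then have "card S \<le> card (set (cols ?T))" by (simp add: card_mono maximal_def)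
        then show False using rank_card_indpt[OF T S] r lt by simp
      qed
      show "indep_rows d m (\<lambda>i j. A $$ (i, j))"
        unfolding indep_rows_def
      proof (intro allI impI)
        fix x i assume x: "\<forall>j<m. (\<Sum>i<d. x i * A $$ (i, j)) = 0" and i: "i < d"
        have "?T *\<^sub>v Matrix.vec d x = 0\<^sub>v m" using x by (subst mv) auto
        then have "Matrix.vec d x = 0\<^sub>v d"
          using lin_depI[OF T vec_carrier _ _ dist, of x] full_rank_lin_indpt[OF T r dist] by blast
        then show "x i = 0" using i by (metis index_vec index_zero_vec(1))
      qed
    next
      assume ind: "indep_rows d m (\<lambda>i j. A $$ (i, j))"
      have inj: "v = 0\<^sub>v d" if v: "v \<in> carrier_vec d" "?T *\<^sub>v v = 0\<^sub>v m" for v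
        using ind v mv[OF v(1)] unfolding indep_rows_def by (auto simp: vec_eq_iff)
      have dist: "distinct (cols ?T)"
        unfolding distinct_conv_nth
      proof (intro allI impI)
        fix a b assume ab: "a < length (cols ?T)" "b < length (cols ?T)" "a \<noteq> b"
        then have ab': "a < d" "b < d" using A by auto
        show "cols ?T ! a \<noteq> cols ?T ! b"
        proof
          assume "cols ?T ! a = cols ?T ! b"
          then have "col ?T a = col ?T b" using ab by (simp add: cols_nth)
          then have eq: "A $$ (a, j) = A $$ (b, j)" if "j < m" for j
            using that ab' A by (auto simp: vec_eq_iff)
          define x where "x i = (if i = a then 1 else if i = b then -1 else 0 :: real)" for i
          have "(\<Sum>i<d. x i * A $$ (i, j)) = 0" if "j < m" for j
          proof -
            have "(\<Sum>i<d. x i * A $$ (i, j)) = (\<Sum>i\<in>{a, b}. x i * A $$ (i, j))"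
              by (rule sum.mono_neutral_right) (use ab' in \<open>auto simp: x_def\<close>)
            then show ?thesis using ab(3) eq[OF that] by (simp add: x_def)
          qed
          then have "x a = 0" using ind ab'(1) unfolding indep_rows_def by blast
          then show False by (simp add: x_def)
        qed
      qed
      have "lin_indpt (set (cols ?T))"
        using lin_depE[OF T _ dist] inj by metis
      then show "rank ?T = d" by (rule lin_indpt_full_rank[OF T dist])
    qed
  qed
  then show ?thesis unfolding full_rank_mats_def by auto
qed

lemma full_rank_mat_iff:
  "Matrix.mat d m (\<lambda>(i, j). M i j) \<in> full_rank_mats d m \<longleftrightarrow> indep_rows d m M"
  unfolding full_rank_iff_indep_rows using indep_rows_cong[of d m "\<lambda>i j. Matrix.mat d m (\<lambda>(i, j). M i j) $$ (i, j)" M]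
  by simp

text \<open>
  Write \<open>A = T B\<close>. Independent rows of \<open>A\<close> force \<open>T\<close> to be invertible.
\<close>

lemma rowspan_eqI:
  assumes A: "A \<in> full_rank_mats d m" and B: "B \<in> carrier_mat d m"
    and comb: "\<And>i. i < d \<Longrightarrow> \<exists>x. \<forall>j<m. A $$ (i, j) = (\<Sum>l<d. x l * B $$ (l, j))"
  shows "rowspan m A = rowspan m B"
proof -
  have Ac: "A \<in> carrier_mat d m" and Ai: "indep_rows d m (\<lambda>i j. A $$ (i, j))"
    using A unfolding full_rank_iff_indep_rows by auto
  obtain T where T: "\<And>i j. i < d \<Longrightarrow> j < m \<Longrightarrow> A $$ (i, j) = (\<Sum>l<d. T i l * B $$ (l, j))"
    using comb by metis
  have TB: "(\<Sum>i<d. x i * A $$ (i, j)) = (\<Sum>l<d. (\<Sum>i<d. x i * T i l) * B $$ (l, j))" if "j < m" for x j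
  proof -
    have "(\<Sum>i<d. x i * A $$ (i, j)) = (\<Sum>i<d. \<Sum>l<d. x i * T i l * B $$ (l, j))"
      using T that by (auto simp: sum_distrib_left mult.assoc intro!: sum.cong)
    then show ?thesis unfolding sum_distrib_right by (subst sum.swap) simp
  qed
  have "detf d T \<noteq> 0"
  proof
    assume "detf d T = 0"
    then obtain x where x: "\<exists>i<d. x i \<noteq> 0" "\<forall>l<d. (\<Sum>i<d. x i * T i l) = 0"
      unfolding detf_eq_0_iff by blast
    have "\<forall>j<m. (\<Sum>i<d. x i * A $$ (i, j)) = 0" using TB x(2) by simp
    then show False using Ai x(1) unfolding indep_rows_def by blast
  qed
  show ?thesis
  proof (intro equalityI subsetI)
    fix v assume "v \<in> rowspan m A"
    then obtain x where "v = Matrix.vec m (\<lambda>j. \<Sum>i<d. x i * A $$ (i, j))"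
      unfolding rowspan_eq_combinations[OF Ac] by blast
    then have "v = Matrix.vec m (\<lambda>j. \<Sum>l<d. (\<Sum>i<d. x i * T i l) * B $$ (l, j))"
      using TB by (auto intro!: eq_vecI)
    then show "v \<in> rowspan m B" unfolding rowspan_eq_combinations[OF B]
      by (intro CollectI exI[of _ "\<lambda>l. \<Sum>i<d. x i * T i l"]) simp
  next
    fix v assume "v \<in> rowspan m B"
    then obtain y where y: "v = Matrix.vec m (\<lambda>j. \<Sum>l<d. y l * B $$ (l, j))"
      unfolding rowspan_eq_combinations[OF B] by blast
    obtain x where x: "\<forall>l<d. (\<Sum>i<d. x i * T i l) = y l"
      using detf_solve[OF \<open>detf d T \<noteq> 0\<close>] by blast
    have "v = Matrix.vec m (\<lambda>j. \<Sum>i<d. x i * A $$ (i, j))"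
      unfolding y using TB x by (auto intro!: eq_vecI)
    then show "v \<in> rowspan m A" unfolding rowspan_eq_combinations[OF Ac]
      by (intro CollectI exI[of _ x]) simp
  qed
qed

lemma row_in_rowspan:
  assumes "rowspan m A = rowspan m B" "A \<in> carrier_mat d m" "B \<in> carrier_mat d' m" "i < d"
  shows "\<exists>x. \<forall>j<m. A $$ (i, j) = (\<Sum>l<d'. x l * B $$ (l, j))"
proof -
  have "Matrix.vec m (\<lambda>j. \<Sum>l<d. (if l = i then 1 else 0) * A $$ (l, j)) \<in> rowspan m A"
    unfolding rowspan_eq_combinations[OF assms(2)] by (rule CollectI, rule exI[of _ "\<lambda>l. if l = i then 1 else 0"]) simp
  then obtain x where "Matrix.vec m (\<lambda>j. \<Sum>l<d. (if l = i then 1 else 0) * A $$ (l, j)) =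
      Matrix.vec m (\<lambda>j. \<Sum>l<d'. x l * B $$ (l, j))"
    unfolding assms(1) rowspan_eq_combinations[OF assms(3)] by blast
  then have "A $$ (i, j) = (\<Sum>l<d'. x l * B $$ (l, j))" if "j < m" for j
    using that assms(4) unfolding vec_eq_iff by (auto simp: if_distrib[of "\<lambda>y. y * _"] sum.delta cong: if_cong)
  then show ?thesis by blast
qed

lemma bracket_eq_fbracket:
  assumes Y: "Y \<in> carrier_mat k (k + 2)"
  shows "bracket Y u v = fbracket k (\<lambda>i j. Y $$ (i, j)) (vec_index u) (vec_index v)"
proof -
  have "mat_of_rows (dim_col Y) (Matrix.rows Y @ [u, v]) =
    Matrix.mat (k + 2) (k + 2) (\<lambda>(i, j). if i < k then Y $$ (i, j) else if i = k then vec_index u j else vec_index v j)"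
  proof (rule eq_matI)
    fix i j assume "i < dim_row (Matrix.mat (k + 2) (k + 2)
        (\<lambda>(i, j). if i < k then Y $$ (i, j) else if i = k then vec_index u j else vec_index v j))"
      "j < dim_col (Matrix.mat (k + 2) (k + 2)
        (\<lambda>(i, j). if i < k then Y $$ (i, j) else if i = k then vec_index u j else vec_index v j))"
    then have ij: "i < k + 2" "j < k + 2" by auto
    then consider "i < k" | "i = k" | "i = Suc k" by linarith
    then show "mat_of_rows (dim_col Y) (Matrix.rows Y @ [u, v]) $$ (i, j) =
      Matrix.mat (k + 2) (k + 2) (\<lambda>(i, j). if i < k then Y $$ (i, j) else if i = k then vec_index u j else vec_index v j) $$ (i, j)"
      by cases (use ij Y in \<open>auto simp: mat_of_rows_index nth_append\<close>)
  qed (use Y in auto)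
  then show ?thesis unfolding bracket_def fbracket_def detf_def by simp
qed

lemma detf_mult:
  "detf d (\<lambda>i j. \<Sum>a<d. T i a * S a j) = detf d T * detf d S"
proof -
  have "Matrix.mat d d (\<lambda>(i, j). \<Sum>a<d. T i a * S a j) =
      Matrix.mat d d (\<lambda>(i, j). T i j) * Matrix.mat d d (\<lambda>(i, j). S i j)"
    by (rule eq_matI) (auto simp: scalar_prod_def lessThan_atLeast0)
  then show ?thesis unfolding detf_def by (simp add: det_mult[of _ d])
qed

lemma indep_rows_of_minor:
  assumes "detf d (\<lambda>i j. M i (f j)) \<noteq> 0" "\<And>j. j < d \<Longrightarrow> f j < n"
  shows "indep_rows d n M"
  using assms unfolding indep_rows_def detf_eq_0_iff by blast

text \<open>
  The product topology on finitely many real entries, spelled out with uniform error bounds.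
\<close>

lemma openin_subtopology_mat:
  assumes F: "F \<subseteq> carrier_mat r c"
  shows "openin (subtopology (mat_topology r c) F) S \<longleftrightarrow> S \<subseteq> F \<and>
    (\<forall>M\<in>S. \<exists>e>0. \<forall>N\<in>F. (\<forall>i<r. \<forall>j<c. \<bar>N $$ (i, j) - M $$ (i, j)\<bar> < e) \<longrightarrow> N \<in> S)"
    (is "?L \<longleftrightarrow> ?R")
proof -
  let ?I = "{..<r} \<times> {..<c}"
  let ?f = "\<lambda>A :: real mat. \<lambda>ij \<in> ?I. A $$ ij"
  let ?P = "product_topology (\<lambda>_. euclideanreal) ?I"
  have op: "openin (mat_topology r c) T \<longleftrightarrow> (\<exists>U. openin ?P U \<and> T = ?f -` U \<inter> carrier_mat r c)" for T
    unfolding mat_topology_def openin_pullback_topology by blast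
  show ?thesis
  proof
    assume ?L
    then obtain U where U: "openin ?P U" "S = ?f -` U \<inter> carrier_mat r c \<inter> F"
      unfolding openin_subtopology op by blast
    have "\<exists>e>0. \<forall>N\<in>F. (\<forall>i<r. \<forall>j<c. \<bar>N $$ (i, j) - M $$ (i, j)\<bar> < e) \<longrightarrow> N \<in> S" if M: "M \<in> S" for M
    proof -
      have "?f M \<in> U" using M U by auto
      then obtain W where W: "finite {i \<in> ?I. W i \<noteq> topspace euclideanreal}" "\<And>ij. ij \<in> ?I \<Longrightarrow> open (W ij)"
        "?f M \<in> Pi\<^sub>E ?I W" "Pi\<^sub>E ?I W \<subseteq> U"
        using U(1)[unfolded openin_product_topology_alt, rule_format, OF \<open>?f M \<in> U\<close>]
        unfolding open_openin[symmetric] by blast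
      have "\<exists>e>0. \<forall>y. \<bar>y - M $$ ij\<bar> < e \<longrightarrow> y \<in> W ij" if "ij \<in> ?I" for ij
      proof -
        have "M $$ ij \<in> W ij" using W(3) that by (auto simp: PiE_def Pi_def)
        then show ?thesis using W(2)[OF that] unfolding open_real by blast
      qed
      then obtain e where e: "\<And>ij. ij \<in> ?I \<Longrightarrow> e ij > 0 \<and> (\<forall>y. \<bar>y - M $$ ij\<bar> < e ij \<longrightarrow> y \<in> W ij)" by metis
      let ?e = "Min (insert 1 (e ` ?I))"
      have e0: "?e > 0" using e by (subst Min_gr_iff) auto
      have ele: "?e \<le> e ij" if "ij \<in> ?I" for ij using that by (intro Min_le) auto
      have "N \<in> S" if N: "N \<in> F" "\<forall>i<r. \<forall>j<c. \<bar>N $$ (i, j) - M $$ (i, j)\<bar> < ?e" for N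
      proof -
        have "N $$ ij \<in> W ij" if ij: "ij \<in> ?I" for ij
        proof -
          have "\<bar>N $$ ij - M $$ ij\<bar> < ?e" using N(2) ij by auto
          then have "\<bar>N $$ ij - M $$ ij\<bar> < e ij" using ele[OF ij] by linarith
          then show ?thesis using e[OF ij] by blast
        qed
        then have "?f N \<in> Pi\<^sub>E ?I W" by auto
        then have "?f N \<in> U" by (rule subsetD[OF W(4)])
        then show ?thesis unfolding U(2) using N(1) F by blast
      qed
      then show ?thesis using e0 by blast
    qed
    then show ?R using U(2) by auto
  next
    assume R: ?R
    have "\<exists>T. openin (subtopology (mat_topology r c) F) T \<and> M \<in> T \<and> T \<subseteq> S" if M: "M \<in> S" for M
    proof -
      obtain e where e: "e > 0"
        "\<forall>N\<in>F. (\<forall>i<r. \<forall>j<c. \<bar>N $$ (i, j) - M $$ (i, j)\<bar> < e) \<longrightarrow> N \<in> S" using R M by blast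
      let ?U = "Pi\<^sub>E ?I (\<lambda>ij. {M $$ ij - e<..<M $$ ij + e})"
      have U: "openin ?P ?U" by (subst openin_PiE) auto
      let ?T = "?f -` ?U \<inter> carrier_mat r c \<inter> F"
      have "openin (subtopology (mat_topology r c) F) ?T"
        unfolding openin_subtopology op using U by blast
      moreover have "M \<in> ?T" using M R F e(1) by auto
      moreover have "?T \<subseteq> S"
      proof
        fix N assume N: "N \<in> ?T"
        have "\<bar>N $$ (i, j) - M $$ (i, j)\<bar> < e" if "i < r" "j < c" for i j
        proof -
          have "?f N \<in> ?U" using N by blast
          from PiE_mem[OF this, of "(i, j)"] show ?thesis using that by (auto simp: abs_less_iff)
        qed
        then show "N \<in> S" using e(2) N by blast
      qed
      ultimately show ?thesis by blast
    qed
    then show ?L by (subst openin_subopen) blast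
  qed
qed

section \<open>Comparing the amplituhedron with the sign-flip set\<close>

text \<open>
  The two spaces compared have the same dimension because \<open>C Z\<close> has full rank, so it suffices that the rows of
  \<open>C Z\<close> lie in the row span of \<open>Y\<close>.
\<close>

lemma amplituhedronI:
  fixes Z :: "real mat" and C :: "nat \<Rightarrow> nat \<Rightarrow> real"
  assumes Z: "Z \<in> Mat_pos n (k + 2)" and kn: "k + 2 \<le> n"
    and C: "TNN k n C" "indep_rows k n C" and Y: "Y \<in> carrier_mat k (k + 2)"
    and comb: "\<And>a. a < k \<Longrightarrow> \<exists>x. \<forall>l<k + 2. (\<Sum>j<n. C a j * Z $$ (j, l)) = (\<Sum>i<k. x i * Y $$ (i, l))"
  shows "rowspan (k + 2) Y \<in> amplituhedron n k Z"
proof -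
  let ?C = "Matrix.mat k n (\<lambda>(i, j). C i j)"
  have Zc: "Z \<in> carrier_mat n (k + 2)" using Z by (simp add: Mat_pos_def)
  have Cc: "?C \<in> carrier_mat k n" by simp
  have Cf: "?C \<in> full_rank_mats k n" unfolding full_rank_mat_iff by (rule C(2))
  have fn: "f j < n" if "f \<in> sorted_maps k n" "j < k" for f j using that by (auto simp: sorted_maps_def)
  have "TNN k n (\<lambda>i j. ?C $$ (i, j))"
    unfolding TNN_def
  proof
    fix f assume f: "f \<in> sorted_maps k n"
    have "detf k (\<lambda>i j. ?C $$ (i, f j)) = detf k (\<lambda>i j. C i (f j))"
      by (rule detf_cong) (use fn[OF f] in simp)
    then show "0 \<le> detf k (\<lambda>i j. ?C $$ (i, f j))" using C(1) f unfolding TNN_def by simp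
  qed
  then have "rowspan n ?C \<in> Gr_nonneg k n"
    using rowspan_full_rank_mats[of n k] Cf TNN_iff_submatrix[OF Cc]
    unfolding Gr_nonneg_def represents_def by blast
  moreover have "Ztilde Z (rowspan n ?C) = rowspan (k + 2) Y"
  proof -
    have CZ: "(?C * Z) $$ (i, l) = (\<Sum>j<n. C i j * Z $$ (j, l))" if "i < k" "l < k + 2" for i l
      using that Zc by (auto simp: scalar_prod_def lessThan_atLeast0)
    have "indep_rows k (k + 2) (\<lambda>i l. \<Sum>j<n. C i j * Z $$ (j, l))"
      by (rule product_indep_rows[OF Mat_pos_TP[OF Z] kn C])
    then have "indep_rows k (k + 2) (\<lambda>i l. (?C * Z) $$ (i, l))"
      by (subst indep_rows_cong) (rule CZ)
    then have "?C * Z \<in> full_rank_mats k (k + 2)"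
      unfolding full_rank_iff_indep_rows using mult_carrier_mat[OF Cc Zc] by blast
    then have "rowspan (k + 2) (?C * Z) = rowspan (k + 2) Y"
      by (rule rowspan_eqI[OF _ Y]) (use comb CZ in simp)
    then show ?thesis using Ztilde_rowspan[OF Cc Zc] by simp
  qed
  ultimately show ?thesis unfolding amplituhedron_def by (metis imageI)
qed

lemma F_open_subset_amplituhedron:
  assumes k: "k > 0" and kn: "k + 2 \<le> n" and Z: "Z \<in> Mat_pos n (k + 2)"
  shows "F_open n k Z \<subseteq> amplituhedron n k Z"
proof
  fix V assume "V \<in> F_open n k Z"
  then obtain Y where Y: "represents k (k + 2) Y V"
    "\<And>i. i + 1 < n \<Longrightarrow> bracket Y (Matrix.row Z i) (Matrix.row Z (i + 1)) > 0"
    "var (map (\<lambda>j. bracket Y (Matrix.row Z 0) (Matrix.row Z j)) [1..<n]) = k"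
    unfolding F_open_def by blast
  have Yc: "Y \<in> carrier_mat k (k + 2)" and V: "V = rowspan (k + 2) Y"
    using Y(1) unfolding represents_def full_rank_mats_def by auto
  have Zc: "Z \<in> carrier_mat n (k + 2)" using Z by (simp add: Mat_pos_def)
  let ?Y = "\<lambda>i j. Y $$ (i, j)" and ?z = "\<lambda>j l. Z $$ (j, l)"
  have br: "bracket Y (Matrix.row Z i) (Matrix.row Z j) = fbracket k ?Y (?z i) (?z j)" if "i < n" "j < n" for i j
    unfolding bracket_eq_fbracket[OF Yc] by (rule fbracket_cong) (use that Zc in auto)
  have "\<exists>C. TNN k n C \<and> indep_rows k n C \<and>
     (\<forall>a<k. \<exists>x. \<forall>l<k + 2. (\<Sum>j<n. C a j * ?z j l) = (\<Sum>i<k. x i * ?Y i l))"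
  proof (rule sign_flip_matrix[OF k])
    show "1 < n" using kn by simp
    show "fbracket k ?Y (?z i) (?z (Suc i)) > 0" if "Suc i < n" for i
      using Y(2)[of i] br[of i "Suc i"] that by simp
    have "map (\<lambda>j. fbracket k ?Y (?z 0) (?z j)) [1..<n] = map (\<lambda>j. bracket Y (Matrix.row Z 0) (Matrix.row Z j)) [1..<n]"
      using br kn by simp
    from this[symmetric] show "var (map (\<lambda>j. fbracket k ?Y (?z 0) (?z j)) [1..<n]) = k" using Y(3) by (simp only:)
  qed
  then show "V \<in> amplituhedron n k Z" unfolding V using amplituhedronI[OF Z kn _ _ Yc] by blast
qed

lemma var_scale:
  assumes "c \<noteq> 0"
  shows "var (map (\<lambda>j. c * w j) l) = var (map w l)"
proof -
  have "filter (\<lambda>x. x \<noteq> 0) (map (\<lambda>j. c * w j) l) = map ((*) c) (filter (\<lambda>x. x \<noteq> 0) (map w l))"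
    using assms by (induction l) auto
  moreover have "sign_changes (map ((*) c) ys) = sign_changes ys" for ys
  proof (induction ys rule: sign_changes.induct)
    case (1 x y l)
    have "c * x * (c * y) = (c * c) * (x * y)" by simp
    moreover have "c * c > 0" using assms by (simp add: zero_less_mult_iff linorder_neq_iff disj_commute)
    ultimately have "c * x * (c * y) < 0 \<longleftrightarrow> x * y < 0" by (simp only: mult_less_0_iff) auto
    then show ?case using 1 by simp
  qed auto
  ultimately show ?thesis unfolding var_eq_sign_changes by simp
qed

text \<open>
  The brackets of \<open>N = C Z\<close> have the required signs up to one common sign, the sign \<open>t\<close> of the
  first bracket. If it is negative, the first row is negated, which represents the same space (\<open>W\<close>).
\<close>

lemma TP_image_in_F_open:
  fixes Z :: "real mat" and C :: "nat \<Rightarrow> nat \<Rightarrow> real"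
  assumes k: "k > 0" and kn: "k + 2 \<le> n" and Z: "Z \<in> Mat_pos n (k + 2)" and C: "TP k n C"
  defines "N \<equiv> Matrix.mat k (k + 2) (\<lambda>(i, l). \<Sum>j<n. C i j * Z $$ (j, l))"
  shows "N \<in> full_rank_mats k (k + 2)" and "rowspan (k + 2) N \<in> F_open n k Z"
proof -
  let ?z = "\<lambda>j l. Z $$ (j, l)"
  let ?Y = "\<lambda>i l. \<Sum>j<n. C i j * ?z j l"
  have Zc: "Z \<in> carrier_mat n (k + 2)" using Z by (simp add: Mat_pos_def)
  interpret positive_pair k n C ?z ?Y
    by unfold_locales (use C Mat_pos_TP[OF Z] kn in auto)
  have TNN: "TNN k n C" using C unfolding TP_def TNN_def by (auto intro: less_imp_le)
  have "detf k (\<lambda>i j. C i ((\<lambda>j. j) j)) > 0"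
    by (rule TP_minor_pos[OF C]) (use kn in \<open>auto intro: strict_mono_onI\<close>)
  then have "indep_rows k n C" using indep_rows_of_minor[of k C "\<lambda>j. j" n] kn by simp
  then have Yi: "indep_rows k (k + 2) ?Y" by (rule product_indep_rows[OF TP_z kn TNN])
  then show N: "N \<in> full_rank_mats k (k + 2)"
    unfolding N_def full_rank_mat_iff .
  let ?D = "fbracket k ?Y (?z 0) (?z 1)"
  define t :: real where "t = (if ?D > 0 then 1 else -1)"
  have t: "t * ?D > 0" "t \<noteq> 0" using first_bracket_nonzero by (auto simp: t_def)
  have sgn: "t * E > 0" if "?D * E > 0" for E using t(1) that by (auto simp: zero_less_mult_iff)
  define W where "W = (if ?D > 0 then ?Y else ?Y(0 := \<lambda>l. - ?Y 0 l))"
  have W: "fbracket k W u v = t * fbracket k ?Y u v" for u v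
    using fbracket_uminus_row[OF k, of ?Y u v] by (simp add: W_def t_def)
  let ?M = "Matrix.mat k (k + 2) (\<lambda>(i, l). W i l)"
  have Mc: "?M \<in> carrier_mat k (k + 2)" by simp
  have rs: "rowspan (k + 2) N = rowspan (k + 2) ?M"
  proof (rule rowspan_eqI[OF N Mc])
    fix i assume i: "i < k"
    let ?s = "if i = 0 then t else 1"
    have "?Y i l = ?s * W i l" for l by (auto simp: W_def t_def)
    then have "N $$ (i, l) = (\<Sum>l'<k. (if l' = i then ?s else 0) * ?M $$ (l', l))" if "l < k + 2" for l
      using i that by (simp add: N_def if_distrib[of "\<lambda>y. y * _"] sum.delta cong: if_cong)
    then show "\<exists>x. \<forall>j<k + 2. N $$ (i, j) = (\<Sum>l<k. x l * ?M $$ (l, j))"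
      by (intro exI[of _ "\<lambda>l'. if l' = i then ?s else 0"]) blast
  qed
  have Mf: "?M \<in> full_rank_mats k (k + 2)"
  proof -
    have "indep_rows k (k + 2) W"
      unfolding indep_rows_def
    proof (intro allI impI)
      fix x i assume x: "\<forall>j<k + 2. (\<Sum>i<k. x i * W i j) = 0" "i < k"
      have "(\<Sum>i<k. x i * W i j) = (\<Sum>i<k. ((if i = 0 then t else 1) * x i) * ?Y i j)" for j
        by (rule sum.cong) (auto simp: W_def t_def)
      then have "\<forall>j<k + 2. (\<Sum>i<k. ((if i = 0 then t else 1) * x i) * ?Y i j) = 0" using x(1) by metis
      then have "(if i = 0 then t else 1) * x i = 0"
        using Yi[unfolded indep_rows_def, THEN spec[of _ "\<lambda>i. (if i = 0 then t else 1) * x i"]] x(2) by blast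
      then show "x i = 0" using t(2) by (auto split: if_splits)
    qed
    then show ?thesis unfolding full_rank_mat_iff .
  qed
  have br: "bracket ?M (Matrix.row Z i) (Matrix.row Z j) = t * fbracket k ?Y (?z i) (?z j)" if "i < n" "j < n" for i j
    unfolding bracket_eq_fbracket[OF Mc] W[symmetric] by (rule fbracket_cong) (use that Zc in auto)
  have "bracket ?M (Matrix.row Z i) (Matrix.row Z (i + 1)) > 0" if i: "i + 1 < n" for i
    using sgn[OF consecutive_brackets_same_sign[of i]] br[of i "i + 1"] i by simp
  moreover have "bracket ?M (Matrix.row Z (n - 1)) ((-1) ^ (k + 1) \<cdot>\<^sub>v Matrix.row Z 0) > 0"
  proof -
    have "bracket ?M (Matrix.row Z (n - 1)) ((-1) ^ (k + 1) \<cdot>\<^sub>v Matrix.row Z 0) =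
        fbracket k W (?z (n - 1)) (\<lambda>l. (-1) ^ (k + 1) * ?z 0 l + 0 * ?z 0 l)"
      unfolding bracket_eq_fbracket[OF Mc] by (rule fbracket_cong) (use kn Zc in auto)
    also have "\<dots> = (-1) ^ (k + 1) * (t * fbracket k ?Y (?z (n - 1)) (?z 0))"
      unfolding fbracket_add_scaled_right W by simp
    also have "\<dots> = t * ((-1) ^ k * fbracket k ?Y (?z 0) (?z (n - 1)))"
      unfolding fbracket_swap[of k ?Y "?z (n - 1)" "?z 0"] by simp
    finally have eq: "bracket ?M (Matrix.row Z (n - 1)) ((-1) ^ (k + 1) \<cdot>\<^sub>v Matrix.row Z 0) =
        t * ((-1) ^ k * fbracket k ?Y (?z 0) (?z (n - 1)))" .
    show ?thesis unfolding eq by (rule sgn[OF first_row_sign_changes(1)])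
  qed
  moreover have "var (map (\<lambda>j. bracket ?M (Matrix.row Z 0) (Matrix.row Z j)) [1..<n]) = k"
  proof -
    have eq: "map (\<lambda>j. bracket ?M (Matrix.row Z 0) (Matrix.row Z j)) [1..<n] =
        map (\<lambda>j. t * fbracket k ?Y (?z 0) (?z j)) [1..<n]" using br kn by simp
    show ?thesis unfolding eq var_scale[OF t(2)] by (rule first_row_sign_changes(2)[OF k])
  qed
  moreover have "represents k (k + 2) ?M (rowspan (k + 2) N)"
    unfolding represents_def using Mf rs by simp
  moreover have "rowspan (k + 2) N \<in> Gr k (k + 2)" using rowspan_full_rank_mats N by blast
  ultimately show "rowspan (k + 2) N \<in> F_open n k Z" unfolding F_open_def by blast
qed

lemma amplituhedronE:
  assumes Z: "Z \<in> Mat_pos n (k + 2)" and kn: "k + 2 \<le> n" and V: "V \<in> amplituhedron n k Z"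
  obtains C where "TNN k n C" "indep_rows k n C"
    "Matrix.mat k (k + 2) (\<lambda>(i, l). \<Sum>j<n. C i j * Z $$ (j, l)) \<in> full_rank_mats k (k + 2)"
    "V = rowspan (k + 2) (Matrix.mat k (k + 2) (\<lambda>(i, l). \<Sum>j<n. C i j * Z $$ (j, l)))"
proof -
  have Zc: "Z \<in> carrier_mat n (k + 2)" using Z by (simp add: Mat_pos_def)
  obtain U where U: "U \<in> Gr_nonneg k n" "V = Ztilde Z U" using V unfolding amplituhedron_def by blast
  then obtain A where A: "represents k n A U"
    "\<forall>J \<subseteq> {..<n}. card J = k \<longrightarrow> Determinant.det (submatrix A UNIV J) \<ge> 0"
    unfolding Gr_nonneg_def by blast
  have Ac: "A \<in> carrier_mat k n" and Ai: "indep_rows k n (\<lambda>i j. A $$ (i, j))" and Ar: "rowspan n A = U"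
    using A(1) unfolding represents_def full_rank_iff_indep_rows by auto
  have AT: "TNN k n (\<lambda>i j. A $$ (i, j))" unfolding TNN_iff_submatrix[OF Ac] by (rule A(2))
  have eq: "A * Z = Matrix.mat k (k + 2) (\<lambda>(i, l). \<Sum>j<n. A $$ (i, j) * Z $$ (j, l))"
    using Ac Zc by (intro eq_matI) (auto simp: scalar_prod_def lessThan_atLeast0)
  have "indep_rows k (k + 2) (\<lambda>i l. \<Sum>j<n. A $$ (i, j) * Z $$ (j, l))"
    by (rule product_indep_rows[OF Mat_pos_TP[OF Z] kn AT Ai])
  then have "Matrix.mat k (k + 2) (\<lambda>(i, l). \<Sum>j<n. A $$ (i, j) * Z $$ (j, l)) \<in> full_rank_mats k (k + 2)"
    unfolding full_rank_mat_iff .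
  moreover have "V = rowspan (k + 2) (A * Z)" using U(2) Ar Ztilde_rowspan[OF Ac Zc] by simp
  ultimately show ?thesis using that[OF AT Ai] unfolding eq by blast
qed

lemma amplituhedron_subset_closure:
  assumes k: "k > 0" and kn: "k + 2 \<le> n" and Z: "Z \<in> Mat_pos n (k + 2)"
  shows "amplituhedron n k Z \<subseteq> Gr_topology k (k + 2) closure_of F_open n k Z"
proof
  fix V assume "V \<in> amplituhedron n k Z"
  then obtain C where C: "TNN k n C" "indep_rows k n C" and
    M: "Matrix.mat k (k + 2) (\<lambda>(i, l). \<Sum>j<n. C i j * Z $$ (j, l)) \<in> full_rank_mats k (k + 2)" and
    V: "V = rowspan (k + 2) (Matrix.mat k (k + 2) (\<lambda>(i, l). \<Sum>j<n. C i j * Z $$ (j, l)))"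
    by (rule amplituhedronE[OF Z kn])
  let ?N = "\<lambda>C. Matrix.mat k (k + 2) (\<lambda>(i, l). \<Sum>j<n. C i j * Z $$ (j, l))"
  obtain f where f: "f \<in> sorted_maps k n" "detf k (\<lambda>i j. C i (f j)) \<noteq> 0"
    using indep_rows_sorted_minor[OF C(2)] by blast
  then have fpos: "detf k (\<lambda>i j. C i (f j)) > 0" using C(1) unfolding TNN_def by force
  show "V \<in> Gr_topology k (k + 2) closure_of F_open n k Z"
    unfolding in_closure_of topspace_Gr_topology
  proof (intro conjI allI impI)
    show "V \<in> Gr k (k + 2)" using rowspan_full_rank_mats M V by blast
    fix T assume T: "V \<in> T \<and> openin (Gr_topology k (k + 2)) T"
    have sub: "full_rank_mats k (k + 2) \<subseteq> carrier_mat k (k + 2)" unfolding full_rank_mats_def by blast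
    let ?T = "{A \<in> full_rank_mats k (k + 2). rowspan (k + 2) A \<in> T}"
    have NT: "?N C \<in> ?T" using M V T by simp
    have "\<forall>M\<in>?T. \<exists>e>0. \<forall>N\<in>full_rank_mats k (k + 2).
        (\<forall>i<k. \<forall>j<k + 2. \<bar>N $$ (i, j) - M $$ (i, j)\<bar> < e) \<longrightarrow> N \<in> ?T"
      using T[THEN conjunct2, unfolded openin_Gr_topology openin_subtopology_mat[OF sub]] by (elim conjE)
    from bspec[OF this NT] obtain e where e: "e > 0" "\<forall>N\<in>full_rank_mats k (k + 2).
        (\<forall>i<k. \<forall>j<k + 2. \<bar>N $$ (i, j) - ?N C $$ (i, j)\<bar> < e) \<longrightarrow> N \<in> ?T"
      by (elim exE conjE)
    define X where "X = (\<Sum>j<n. \<Sum>l<k + 2. \<bar>Z $$ (j, l)\<bar>)"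
    have X0: "X \<ge> 0" unfolding X_def by (intro sum_nonneg) auto
    have "e / (1 + X) > 0" using e(1) X0 by simp
    from TNN_approx_TP[OF C(1) f(1) fpos this] obtain C' where
      C': "TP k n C'" "\<And>i j. i < k \<Longrightarrow> j < n \<Longrightarrow> \<bar>C' i j - C i j\<bar> < e / (1 + X)" by blast
    note N' = TP_image_in_F_open[OF k kn Z C'(1)]
    have "\<bar>?N C' $$ (i, l) - ?N C $$ (i, l)\<bar> < e" if il: "i < k" "l < k + 2" for i l
    proof -
      have "\<bar>?N C' $$ (i, l) - ?N C $$ (i, l)\<bar> = \<bar>\<Sum>j<n. (C' i j - C i j) * Z $$ (j, l)\<bar>"
        using il by (simp add: sum_subtractf left_diff_distrib)
      also have "\<dots> \<le> (\<Sum>j<n. \<bar>(C' i j - C i j) * Z $$ (j, l)\<bar>)" by (rule sum_abs)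
      also have "\<dots> \<le> (\<Sum>j<n. e / (1 + X) * (\<Sum>l<k + 2. \<bar>Z $$ (j, l)\<bar>))"
      proof (rule sum_mono)
        fix j assume j: "j \<in> {..<n}"
        have "\<bar>Z $$ (j, l)\<bar> \<le> (\<Sum>l<k + 2. \<bar>Z $$ (j, l)\<bar>)" using il(2) by (intro member_le_sum) auto
        then show "\<bar>(C' i j - C i j) * Z $$ (j, l)\<bar> \<le> e / (1 + X) * (\<Sum>l<k + 2. \<bar>Z $$ (j, l)\<bar>)"
          unfolding abs_mult using C'(2)[OF il(1), of j] j e(1) X0 by (intro mult_mono) auto
      qed
      also have "\<dots> = e / (1 + X) * X" unfolding X_def sum_distrib_left ..
      also have "\<dots> < e" using e(1) X0 by (simp add: field_simps)
      finally show ?thesis .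
    qed
    then have "?N C' \<in> ?T" using bspec[OF e(2) N'(1)] by blast
    then have "rowspan (k + 2) (?N C') \<in> T" by simp
    then show "\<exists>y. y \<in> F_open n k Z \<and> y \<in> T" using N'(2) by blast
  qed
qed

section \<open>The amplituhedron is closed\<close>

text \<open>
  A representative \<open>N\<close> of a point of the amplituhedron is \<open>T A Z\<close> with \<open>A\<close> totally nonnegative and \<open>T\<close> square.
  The minors of \<open>C = T A\<close> are \<open>det T\<close> times nonnegative numbers; that no two of them have opposite signs
  is a condition that passes to limits.
\<close>

lemma amplituhedron_lift:
  assumes Z: "Z \<in> Mat_pos n (k + 2)" and kn: "k + 2 \<le> n"
    and N: "N \<in> full_rank_mats k (k + 2)" "rowspan (k + 2) N \<in> amplituhedron n k Z"
  shows "\<exists>C. (\<forall>i<k. nonalternating k n (C i)) \<and>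
    (\<forall>f\<in>sorted_maps k n. \<forall>g\<in>sorted_maps k n. detf k (\<lambda>i j. C i (f j)) * detf k (\<lambda>i j. C i (g j)) \<ge> 0) \<and>
    (\<forall>i<k. \<forall>l<k + 2. (\<Sum>j<n. C i j * Z $$ (j, l)) = N $$ (i, l))"
proof -
  obtain A where A: "TNN k n A" "indep_rows k n A" and
    rs: "rowspan (k + 2) N = rowspan (k + 2) (Matrix.mat k (k + 2) (\<lambda>(i, l). \<Sum>j<n. A i j * Z $$ (j, l)))"
    by (rule amplituhedronE[OF Z kn N(2)])
  have Nc: "N \<in> carrier_mat k (k + 2)" using N(1) unfolding full_rank_mats_def by blast
  have "\<exists>x. \<forall>l<k + 2. N $$ (i, l) = (\<Sum>a<k. x a * (\<Sum>j<n. A a j * Z $$ (j, l)))" if "i < k" for i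
    using row_in_rowspan[OF rs Nc _ that, of k] by auto
  then have "\<forall>i. \<exists>x. i < k \<longrightarrow> (\<forall>l<k + 2. N $$ (i, l) = (\<Sum>a<k. x a * (\<Sum>j<n. A a j * Z $$ (j, l))))"
    by blast
  from choice[OF this] obtain T where
    T: "\<And>i l. i < k \<Longrightarrow> l < k + 2 \<Longrightarrow> N $$ (i, l) = (\<Sum>a<k. T i a * (\<Sum>j<n. A a j * Z $$ (j, l)))"
    by blast
  define C where "C i j = (\<Sum>a<k. T i a * A a j)" for i j
  have "nonalternating k n (C i)" for i
    unfolding nonalternating_def using TNN_row_combination_not_alternating[OF A, of "C i" "T i"] by (auto simp: C_def)
  moreover have "detf k (\<lambda>i j. C i (f j)) * detf k (\<lambda>i j. C i (g j)) \<ge> 0"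
    if "f \<in> sorted_maps k n" "g \<in> sorted_maps k n" for f g
  proof -
    have m: "detf k (\<lambda>i j. C i (h j)) = detf k T * detf k (\<lambda>i j. A i (h j))" for h
      unfolding C_def by (rule detf_mult)
    have "detf k (\<lambda>i j. C i (f j)) * detf k (\<lambda>i j. C i (g j)) =
      (detf k T * detf k T) * (detf k (\<lambda>i j. A i (f j)) * detf k (\<lambda>i j. A i (g j)))"
      unfolding m by (simp only: ac_simps)
    moreover have "detf k (\<lambda>i j. A i (f j)) * detf k (\<lambda>i j. A i (g j)) \<ge> 0"
      using A(1) that unfolding TNN_def by (intro mult_nonneg_nonneg) auto
    ultimately show ?thesis by (metis mult_nonneg_nonneg zero_le_square)
  qed
  moreover have "(\<Sum>j<n. C i j * Z $$ (j, l)) = N $$ (i, l)" if "i < k" "l < k + 2" for i l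
    unfolding T[OF that] C_def sum_distrib_left sum_distrib_right
    by (subst sum.swap) (simp only: ac_simps)
  ultimately show ?thesis by blast
qed

text \<open>
  Lift the sequence to matrices \<open>C m\<close> with \<open>C m Z = N m\<close>. Their rows are nonalternating, so they are bounded
  because the \<open>N m\<close> are, and a subsequence converges to some \<open>L\<close> with \<open>L Z = M\<close>. No two minors
  of \<open>L\<close> have opposite signs, so all are nonnegative, if necessary after negating the first row.
\<close>

lemma amplituhedron_sequentially_closed:
  assumes k: "k > 0" and kn: "k + 2 \<le> n" and Z: "Z \<in> Mat_pos n (k + 2)"
    and N: "\<And>m. N m \<in> full_rank_mats k (k + 2)" "\<And>m. rowspan (k + 2) (N m) \<in> amplituhedron n k Z"
    and M: "M \<in> full_rank_mats k (k + 2)"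
    and lim: "\<And>i l. i < k \<Longrightarrow> l < k + 2 \<Longrightarrow> (\<lambda>m. N m $$ (i, l)) \<longlonglongrightarrow> M $$ (i, l)"
  shows "rowspan (k + 2) M \<in> amplituhedron n k Z"
proof -
  have Mc: "M \<in> carrier_mat k (k + 2)" and Mi: "indep_rows k (k + 2) (\<lambda>i j. M $$ (i, j))"
    using M unfolding full_rank_iff_indep_rows by auto
  have "\<forall>m. \<exists>C. (\<forall>i<k. nonalternating k n (C i)) \<and>
    (\<forall>f\<in>sorted_maps k n. \<forall>g\<in>sorted_maps k n. detf k (\<lambda>i j. C i (f j)) * detf k (\<lambda>i j. C i (g j)) \<ge> 0) \<and>
    (\<forall>i<k. \<forall>l<k + 2. (\<Sum>j<n. C i j * Z $$ (j, l)) = N m $$ (i, l))"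
    by (rule allI, rule amplituhedron_lift[OF Z kn N])
  from choice[OF this] obtain C where C:
    "\<And>m i. i < k \<Longrightarrow> nonalternating k n (C m i)"
    "\<And>m f g. f \<in> sorted_maps k n \<Longrightarrow> g \<in> sorted_maps k n \<Longrightarrow>
       detf k (\<lambda>i j. C m i (f j)) * detf k (\<lambda>i j. C m i (g j)) \<ge> 0"
    "\<And>m i l. i < k \<Longrightarrow> l < k + 2 \<Longrightarrow> (\<Sum>j<n. C m i j * Z $$ (j, l)) = N m $$ (i, l)"
    by blast
  obtain B where B: "\<And>v. nonalternating k n v \<Longrightarrow> (\<forall>l<k + 2. \<bar>\<Sum>j<n. Z $$ (j, l) * v j\<bar> \<le> 1) \<Longrightarrow> (\<forall>j<n. \<bar>v j\<bar> \<le> B)"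
    using nonalternating_bounded[OF Mat_pos_TP[OF Z] kn] by blast
  have "\<exists>b. \<forall>m. \<bar>N m $$ (i, l)\<bar> \<le> b" if "i < k" "l < k + 2" for i l
    using convergent_imp_Bseq[OF convergentI[OF lim[OF that]]] unfolding Bseq_def by auto
  then have "\<forall>il. \<exists>b. fst il < k \<longrightarrow> snd il < k + 2 \<longrightarrow> (\<forall>m. \<bar>N m $$ il\<bar> \<le> b)"
    by (auto simp: split_paired_all)
  from choice[OF this] obtain b' where b': "\<forall>il. fst il < k \<longrightarrow> snd il < k + 2 \<longrightarrow> (\<forall>m. \<bar>N m $$ il\<bar> \<le> b' il)" by blast
  define b where "b i l = b' (i, l)" for i l
  have b: "\<bar>N m $$ (i, l)\<bar> \<le> b i l" if "i < k" "l < k + 2" for i l m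
    using b'[rule_format, of "(i, l)"] that by (simp add: b_def)
  define K where "K = 1 + (\<Sum>i<k. \<Sum>l<k + 2. \<bar>b i l\<bar>)"
  have K: "K > 0" unfolding K_def by (intro add_pos_nonneg sum_nonneg) auto
  have NK: "\<bar>N m $$ (i, l)\<bar> \<le> K" if il: "i < k" "l < k + 2" for i l m
  proof -
    have "\<bar>b i l\<bar> \<le> (\<Sum>l<k + 2. \<bar>b i l\<bar>)" using il by (intro member_le_sum) auto
    also have "\<dots> \<le> (\<Sum>i<k. \<Sum>l<k + 2. \<bar>b i l\<bar>)"
      using il by (intro member_le_sum[where f = "\<lambda>i. \<Sum>l<k + 2. \<bar>b i l\<bar>"]) (auto intro: sum_nonneg)
    finally show ?thesis using b[OF il, of m] unfolding K_def by linarith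
  qed
  have CB: "\<bar>C m i j\<bar> \<le> K * B" if ij: "i < k" "j < n" for m i j
  proof -
    have "nonalternating k n (\<lambda>j. C m i j / K)"
      using C(1)[OF ij(1), of m] strictly_alt_divide[OF K] unfolding nonalternating_def by blast
    moreover have "\<forall>l<k + 2. \<bar>\<Sum>j<n. Z $$ (j, l) * (C m i j / K)\<bar> \<le> 1"
    proof (intro allI impI)
      fix l assume l: "l < k + 2"
      have "(\<Sum>j<n. Z $$ (j, l) * (C m i j / K)) = N m $$ (i, l) / K"
        unfolding C(3)[OF ij(1) l, symmetric] sum_divide_distrib by (simp add: mult.commute)
      then show "\<bar>\<Sum>j<n. Z $$ (j, l) * (C m i j / K)\<bar> \<le> 1"
        using NK[OF ij(1) l, of m] K by (simp add: abs_divide)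
    qed
    ultimately have "\<bar>C m i j / K\<bar> \<le> B" using B ij(2) by blast
    then show ?thesis using K by (simp add: abs_divide pos_divide_le_eq mult.commute)
  qed
  let ?x = "\<lambda>m (ij :: nat \<times> nat). C m (fst ij) (snd ij)"
  have "\<exists>r l. strict_mono (r :: nat \<Rightarrow> nat) \<and> (\<forall>ij\<in>{..<k} \<times> {..<n}. (\<lambda>m. ?x (r m) ij) \<longlonglongrightarrow> l ij)"
    by (rule bounded_pointwise_subsequence[where B = "K * B"]) (use CB in auto)
  then obtain r and l :: "nat \<times> nat \<Rightarrow> real" where r: "strict_mono (r :: nat \<Rightarrow> nat)"
    "\<forall>ij\<in>{..<k} \<times> {..<n}. (\<lambda>m. ?x (r m) ij) \<longlonglongrightarrow> l ij" by (elim exE conjE)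
  define L where "L i j = l (i, j)" for i j
  have CL: "(\<lambda>m. C (r m) i j) \<longlonglongrightarrow> L i j" if "i < k" "j < n" for i j
    using r(2)[rule_format, of "(i, j)"] that by (simp add: L_def)
  have LM: "(\<Sum>j<n. L i j * Z $$ (j, l)) = M $$ (i, l)" if il: "i < k" "l < k + 2" for i l
  proof (rule LIMSEQ_unique)
    show "(\<lambda>m. \<Sum>j<n. C (r m) i j * Z $$ (j, l)) \<longlonglongrightarrow> (\<Sum>j<n. L i j * Z $$ (j, l))"
      by (intro tendsto_sum tendsto_mult_right) (use CL il in auto)
    show "(\<lambda>m. \<Sum>j<n. C (r m) i j * Z $$ (j, l)) \<longlonglongrightarrow> M $$ (i, l)"
      unfolding C(3)[OF il] using LIMSEQ_subseq_LIMSEQ[OF lim[OF il] r(1)] by (simp add: comp_def)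
  qed
  let ?m = "\<lambda>f. detf k (\<lambda>i j. L i (f j))"
  have coh: "?m f * ?m g \<ge> 0" if fg: "f \<in> sorted_maps k n" "g \<in> sorted_maps k n" for f g
  proof (rule LIMSEQ_le_const)
    have "f j < n" "g j < n" if "j < k" for j using fg that by (auto simp: sorted_maps_def)
    then show "(\<lambda>m. detf k (\<lambda>i j. C (r m) i (f j)) * detf k (\<lambda>i j. C (r m) i (g j))) \<longlonglongrightarrow> ?m f * ?m g"
      by (intro tendsto_mult tendsto_detf) (use CL in auto)
  qed (use C(2)[OF fg] in blast)
  have Li: "indep_rows k n L"
    unfolding indep_rows_def
  proof (intro allI impI)
    fix x i assume x: "\<forall>j<n. (\<Sum>i<k. x i * L i j) = 0" "i < k"
    have "(\<Sum>i<k. x i * M $$ (i, l)) = 0" if "l < k + 2" for l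
    proof -
      have "(\<Sum>i<k. x i * M $$ (i, l)) = (\<Sum>i<k. \<Sum>j<n. x i * L i j * Z $$ (j, l))"
      proof (rule sum.cong)
        fix i assume "i \<in> {..<k}"
        then have "i < k" by simp
        show "x i * M $$ (i, l) = (\<Sum>j<n. x i * L i j * Z $$ (j, l))"
          unfolding LM[OF \<open>i < k\<close> that, symmetric] sum_distrib_left by (simp only: mult.assoc)
      qed simp
      also have "\<dots> = (\<Sum>j<n. (\<Sum>i<k. x i * L i j) * Z $$ (j, l))"
        unfolding sum_distrib_right by (rule sum.swap)
      finally show ?thesis using x(1) by simp
    qed
    then show "x i = 0" using Mi x(2) unfolding indep_rows_def by blast
  qed
  obtain f0 where f0: "f0 \<in> sorted_maps k n" "?m f0 \<noteq> 0" using indep_rows_sorted_minor[OF Li] by blast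
  define t :: real where "t = (if ?m f0 > 0 then 1 else -1)"
  have t: "t \<noteq> 0" "t * t = 1" by (auto simp: t_def)
  define L' where "L' i j = (if i = 0 then t * L i j else L i j)" for i j
  have m': "detf k (\<lambda>i j. L' i (f j)) = t * ?m f" for f
  proof -
    have "detf k (\<lambda>i j. L' i (f j)) = t * ?m f + 0 * ?m f"
      by (rule detf_linear_row[OF k]) (auto simp: L'_def)
    then show ?thesis by simp
  qed
  have "TNN k n L'"
    unfolding TNN_def m'
  proof
    fix f assume "f \<in> sorted_maps k n"
    then show "0 \<le> t * ?m f" using coh[OF f0(1)] f0(2) by (auto simp: t_def zero_le_mult_iff not_less)
  qed
  moreover have "indep_rows k n L'"
  proof (rule indep_rows_of_minor)
    show "detf k (\<lambda>i j. L' i (f0 j)) \<noteq> 0" unfolding m' using t f0 by simp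
    show "f0 j < n" if "j < k" for j using f0(1) that by (auto simp: sorted_maps_def)
  qed
  moreover have "\<exists>x. \<forall>l<k + 2. (\<Sum>j<n. L' a j * Z $$ (j, l)) = (\<Sum>i<k. x i * M $$ (i, l))" if a: "a < k" for a
  proof -
    let ?s = "if a = 0 then t else 1"
    have "(\<Sum>j<n. L' a j * Z $$ (j, l)) = (\<Sum>i<k. (if i = a then ?s else 0) * M $$ (i, l))" if l: "l < k + 2" for l
    proof -
      have "(\<Sum>i<k. (if i = a then ?s else 0) * M $$ (i, l)) = ?s * M $$ (a, l)"
        using a by (simp add: if_distrib[of "\<lambda>y. y * _"] sum.delta cong: if_cong)
      also have "\<dots> = (\<Sum>j<n. L' a j * Z $$ (j, l))"
        unfolding LM[OF a l, symmetric] L'_def sum_distrib_left by (rule sum.cong) auto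
      finally show ?thesis by simp
    qed
    then show ?thesis by (intro exI[of _ "\<lambda>i. if i = a then ?s else 0"]) blast
  qed
  ultimately show ?thesis by (rule amplituhedronI[OF Z kn _ _ Mc])
qed

lemma closedin_amplituhedron:
  assumes k: "k > 0" and kn: "k + 2 \<le> n" and Z: "Z \<in> Mat_pos n (k + 2)"
  shows "closedin (Gr_topology k (k + 2)) (amplituhedron n k Z)"
proof -
  let ?F = "full_rank_mats k (k + 2)"
  have sub: "?F \<subseteq> carrier_mat k (k + 2)" unfolding full_rank_mats_def by blast
  have "amplituhedron n k Z \<subseteq> Gr k (k + 2)"
  proof
    fix V assume "V \<in> amplituhedron n k Z"
    then show "V \<in> Gr k (k + 2)"
      by (rule amplituhedronE[OF Z kn]) (use rowspan_full_rank_mats in blast)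
  qed
  moreover have "openin (Gr_topology k (k + 2)) (Gr k (k + 2) - amplituhedron n k Z)"
    unfolding openin_Gr_topology openin_subtopology_mat[OF sub]
  proof (intro conjI ballI)
    fix M assume "M \<in> {A \<in> ?F. rowspan (k + 2) A \<in> Gr k (k + 2) - amplituhedron n k Z}"
    then have M: "M \<in> ?F" "rowspan (k + 2) M \<notin> amplituhedron n k Z" by auto
    show "\<exists>e>0. \<forall>N\<in>?F. (\<forall>i<k. \<forall>j<k + 2. \<bar>N $$ (i, j) - M $$ (i, j)\<bar> < e) \<longrightarrow>
        N \<in> {A \<in> ?F. rowspan (k + 2) A \<in> Gr k (k + 2) - amplituhedron n k Z}"
    proof (rule ccontr)
      assume none: "\<not> ?thesis"
      have "\<exists>N. N \<in> ?F \<and> (\<forall>i<k. \<forall>j<k + 2. \<bar>N $$ (i, j) - M $$ (i, j)\<bar> < inverse (real (Suc m))) \<and>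
          rowspan (k + 2) N \<in> amplituhedron n k Z" for m
      proof (rule ccontr)
        assume c: "\<not> ?thesis"
        have "inverse (real (Suc m)) > 0" by simp
        moreover have "rowspan (k + 2) N \<in> Gr k (k + 2)" if "N \<in> ?F" for N
          using rowspan_full_rank_mats that by blast
        ultimately show False using none c by blast
      qed
      then have "\<forall>m. \<exists>N. N \<in> ?F \<and> (\<forall>i<k. \<forall>j<k + 2. \<bar>N $$ (i, j) - M $$ (i, j)\<bar> < inverse (real (Suc m))) \<and>
          rowspan (k + 2) N \<in> amplituhedron n k Z" by blast
      from choice[OF this] obtain N where N: "\<And>m. N m \<in> ?F" "\<And>m. rowspan (k + 2) (N m) \<in> amplituhedron n k Z"
        "\<And>m i j. i < k \<Longrightarrow> j < k + 2 \<Longrightarrow> \<bar>N m $$ (i, j) - M $$ (i, j)\<bar> < inverse (real (Suc m))" by blast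
      have lim: "(\<lambda>m. N m $$ (i, l)) \<longlonglongrightarrow> M $$ (i, l)" if "i < k" "l < k + 2" for i l
      proof -
        have "(\<lambda>m. N m $$ (i, l) - M $$ (i, l)) \<longlonglongrightarrow> 0"
          by (rule Lim_null_comparison[OF _ LIMSEQ_inverse_real_of_nat])
            (use N(3)[OF that] in \<open>auto intro!: always_eventually less_imp_le\<close>)
        then show ?thesis by (simp add: LIM_zero_iff)
      qed
      have "rowspan (k + 2) M \<in> amplituhedron n k Z"
        by (rule amplituhedron_sequentially_closed[OF k kn Z N(1) N(2) M(1) lim])
      then show False using M(2) by contradiction
    qed
  qed auto
  ultimately show ?thesis unfolding closedin_def topspace_Gr_topology by blast
qed

theorem theorem5p1:
  fixes k n :: nat and Z :: "real mat"
  assumes "k > 0" and "n > 0" and "k + 2 \<le> n" and "Z \<in> Mat_pos n (k + 2)"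
  shows "amplituhedron n k Z = Gr_topology k (k + 2) closure_of F_open n k Z"
proof
  show "amplituhedron n k Z \<subseteq> Gr_topology k (k + 2) closure_of F_open n k Z"
    using amplituhedron_subset_closure assms by blast
  show "Gr_topology k (k + 2) closure_of F_open n k Z \<subseteq> amplituhedron n k Z"
    using closure_of_minimal[OF F_open_subset_amplituhedron closedin_amplituhedron] assms by blast
qed

end
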